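(* Suppose $n$ is an odd integer with $t_2\leq n<\min\{t_1,t_3\}$, and put $K=k_1+k_2+k_3$. Then: (i) the $\mathfrak{BI}$-module $\mathscr M_n(x_2)$ is isomorphic to $W_1\oplus W_1$, where $W_1=O_{n-t_2}\big(k_3+\tfrac{n+1}{2},\,-K-\tfrac{n+1}{2},\,-k_1-\tfrac{n+1}{2}\big)^{(-1,-1)}$; (ii) the $\mathfrak{BI}$-module $\mathscr M_n/\mathscr M_n(x_2)$ is isomorphic to $W_2\oplus W_2$, where $W_2=O_{t_2-1}(k_3,\,-K-n-1,\,k_1)$. Moreover, if $k_1,k_3\geq0$, then $W_1$ and $W_2$ are irreducible and $W_1$ is isomorphic to $O_{n-t_2}\big(-k_3-\tfrac{n+1}{2},\,K+\tfrac{n+1}{2},\,-k_1-\tfrac{n+1}{2}\big)$.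
   Context: Fix real numbers $k_1,k_2,k_3$. For $i=1,2,3$ let $R_i$ be the operator on functions on $\mathbb R^3$ replacing $x_i$ by $-x_i$, and $T_if=\frac{\partial f}{\partial x_i}+k_i\frac{f-R_if}{x_i}$ (Dunkl operators). Let $\sigma_1=\begin{pmatrix}0&1\\1&0\end{pmatrix}$, $\sigma_2=\begin{pmatrix}0&-\sqrt{-1}\\ \sqrt{-1}&0\end{pmatrix}$, $\sigma_3=\begin{pmatrix}1&0\\0&-1\end{pmatrix}$, and let $e_i$ act on $\mathbb C^2$ by $\sigma_i$. Tensor products are over $\mathbb R$; $\mathbb R[\cdots]_m$ denotes homogeneous polynomials of degree $m$. Let $\mathbf D=e_1\otimes T_1+e_2\otimes T_2+e_3\otimes T_3$ and $\mathscr M_n=\ker(\mathbf D|_{\mathbb C^2\otimes\mathbb R[x_1,x_2,x_3]_n})$. For $i=1,2,3$ set $t_i=-2k_i$ if $2k_i$ is an odd negative integer, and $t_i=\infty$ otherwise. For $i=1,2,3$, $\mathscr M_n(x_i)=\mathscr M_n\cap\bigoplus_{j=t_i}^n\mathbb C^2\otimes(x_i^j\cdot\mathbb R[x_p,x_q]_{n-j})$ where $\{p,q\}=\{1,2,3\}\setminus\{i\}$ (it is $\{0\}$ if $n<t_i$); it is a $\mathfrak{BI}$-submodule of $\mathscr M_n$. $\mathfrak{BI}$ is the unital associative $\mathbb C$-algebra generated by $X,Y,Z$ with relations saying that $\{X,Y\}-Z$, $\{Y,Z\}-X$, $\{Z,X\}-Y$ commute with $X,Y,Z$ ($\{A,B\}=AB+BA$).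 $\mathscr M_n$ is a $\mathfrak{BI}$-module via $X=(\sqrt{-1}\,e_1\otimes(x_3T_2-x_2T_3)+\tfrac12)R_2R_3+k_2R_3+k_3R_2$, $Y=(\sqrt{-1}\,e_2\otimes(x_1T_3-x_3T_1)+\tfrac12)R_1R_3+k_3R_1+k_1R_3$, $Z=(\sqrt{-1}\,e_3\otimes(x_2T_1-x_1T_2)+\tfrac12)R_1R_2+k_1R_2+k_2R_1$, operators composed right to left, $R_i$ acting on the polynomial factor. Twisting: for a $\mathfrak{BI}$-module $V$ and algebra automorphism $\varepsilon$, $V^\varepsilon$ is $V$ with action $x\cdot v=\varepsilon(x)v$. The automorphism $(-1,-1)$ is $X\mapsto -X$, $Y\mapsto -Y$, $Z\mapsto Z$. For $a,b,c\in\mathbb C$ and even $d\geq0$, $O_d(a,b,c)$ is the $\mathfrak{BI}$-module $\mathbb C^{d+1}$ in which, w.r.t. a basis $v_0,\dots,v_d$, $X$ acts by the lower bidiagonal matrix with diagonal $(\theta_0,\dots,\theta_d)$ and subdiagonal entries $1$, $Y$ by the upper bidiagonal matrix with diagonal $(\theta^*_0,\dots,\theta^*_d)$ and superdiagonal $(\varphi_1,\dots,\varphi_d)$, and $Z=\{X,Y\}-(2ab-c(d+1))$, where $\theta_i=\frac{(-1)^i(2a-d+2i)}{2}$, $\theta^*_i=\frac{(-1)^i(2b-d+2i)}{2}$, $\varphi_i=\frac{i(d+1-2i-2a-2b-2c)}{2}$ ($i$ even), $\varphi_i=\frac{(i-d-1)(d+1-2i-2a-2b+2c)}{2}$ ($i$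 odd). *)

theory Defs
  imports Complex_Main "HOL-Library.Extended_Nat"
begin

text \<open>A module over BI is described by its underlying complex vector space (a subspace of
  the space of functions 'i => complex) together with the actions of the three generators.
  Since BI is generated by X, Y, Z, module maps are exactly linear maps intertwining them.\<close>

record 'i bimod =
  car :: "('i \<Rightarrow> complex) set"
  opX :: "('i \<Rightarrow> complex) \<Rightarrow> ('i \<Rightarrow> complex)"
  opY :: "('i \<Rightarrow> complex) \<Rightarrow> ('i \<Rightarrow> complex)"
  opZ :: "('i \<Rightarrow> complex) \<Rightarrow> ('i \<Rightarrow> complex)"

definition clinear_on :: "('i \<Rightarrow> complex) set \<Rightarrow> (('i \<Rightarrow> complex) \<Rightarrow> ('j \<Rightarrow> complex)) \<Rightarrow> bool" where
  "clinear_on S f \<longleftrightarrow>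
     (\<forall>u\<in>S. \<forall>v\<in>S. f (\<lambda>x. u x + v x) = (\<lambda>y. f u y + f v y)) \<and>
     (\<forall>c. \<forall>u\<in>S. f (\<lambda>x. c * u x) = (\<lambda>y. c * f u y))"

definition intertwines :: "'i bimod \<Rightarrow> 'j bimod \<Rightarrow> (('i \<Rightarrow> complex) \<Rightarrow> ('j \<Rightarrow> complex)) \<Rightarrow> bool" where
  "intertwines M N f \<longleftrightarrow>
     (\<forall>u\<in>car M. f (opX M u) = opX N (f u) \<and> f (opY M u) = opY N (f u) \<and> f (opZ M u) = opZ N (f u))"

definition bimod_iso :: "'i bimod \<Rightarrow> 'j bimod \<Rightarrow> bool" where
  "bimod_iso M N \<longleftrightarrow> (\<exists>f. clinear_on (car M) f \<and> bij_betw f (car M) (car N) \<and> intertwines M N f)"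

text \<open>The quotient module M/U is isomorphic to N: there is a surjective module map
  from M onto N with kernel exactly U (first isomorphism theorem).\<close>
definition bimod_quot_iso :: "'i bimod \<Rightarrow> ('i \<Rightarrow> complex) set \<Rightarrow> 'j bimod \<Rightarrow> bool" where
  "bimod_quot_iso M U N \<longleftrightarrow>
     (\<exists>f. clinear_on (car M) f \<and> f ` car M = car N \<and>
          {u \<in> car M. f u = (\<lambda>_. 0)} = U \<and> intertwines M N f)"

definition csubspace :: "('i \<Rightarrow> complex) set \<Rightarrow> bool" where
  "csubspace U \<longleftrightarrow> (\<lambda>_. 0) \<in> U \<and> (\<forall>u\<in>U. \<forall>v\<in>U. (\<lambda>x. u x + v x) \<in> U) \<and>
                    (\<forall>c. \<forall>u\<in>U. (\<lambda>x. c * u x) \<in> U)"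

definition bimod_irred :: "'i bimod \<Rightarrow> bool" where
  "bimod_irred M \<longleftrightarrow> car M \<noteq> {\<lambda>_. 0} \<and>
     (\<forall>U. U \<subseteq> car M \<and> csubspace U \<and> opX M ` U \<subseteq> U \<and> opY M ` U \<subseteq> U \<and> opZ M ` U \<subseteq> U
          \<longrightarrow> U = {\<lambda>_. 0} \<or> U = car M)"

definition dsum_op :: "(('i \<Rightarrow> complex) \<Rightarrow> ('i \<Rightarrow> complex)) \<Rightarrow> (('j \<Rightarrow> complex) \<Rightarrow> ('j \<Rightarrow> complex))
    \<Rightarrow> (('i + 'j) \<Rightarrow> complex) \<Rightarrow> (('i + 'j) \<Rightarrow> complex)" where
  "dsum_op F G w = case_sum (F (\<lambda>i. w (Inl i))) (G (\<lambda>j. w (Inr j)))"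

definition bimod_dsum :: "'i bimod \<Rightarrow> 'j bimod \<Rightarrow> ('i + 'j) bimod" where
  "bimod_dsum M N = \<lparr> car = {w. (\<lambda>i. w (Inl i)) \<in> car M \<and> (\<lambda>j. w (Inr j)) \<in> car N},
      opX = dsum_op (opX M) (opX N), opY = dsum_op (opY M) (opY N), opZ = dsum_op (opZ M) (opZ N) \<rparr>"

definition bimod_twist :: "'i bimod \<Rightarrow> 'i bimod" where
  "bimod_twist M = \<lparr> car = car M, opX = (\<lambda>u x. - opX M u x), opY = (\<lambda>u x. - opY M u x),
                     opZ = opZ M \<rparr>"

text \<open>Coordinates w.r.t. the basis v_0..v_d: a vector is a function nat => complex vanishing
  beyond d.\<close>

definition Otheta :: "nat \<Rightarrow> complex \<Rightarrow> nat \<Rightarrow> complex" where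
  "Otheta d a i = (-1) ^ i * (2 * a - of_nat d + 2 * of_nat i) / 2"

definition Ophi :: "nat \<Rightarrow> complex \<Rightarrow> complex \<Rightarrow> complex \<Rightarrow> nat \<Rightarrow> complex" where
  "Ophi d a b c i = (if even i
      then of_nat i * (of_nat d + 1 - 2 * of_nat i - 2 * a - 2 * b - 2 * c) / 2
      else (of_nat i - of_nat d - 1) * (of_nat d + 1 - 2 * of_nat i - 2 * a - 2 * b + 2 * c) / 2)"

text \<open>X v_j = theta_j v_j + v_(j+1) (lower bidiagonal, subdiagonal 1).\<close>
definition OX :: "nat \<Rightarrow> complex \<Rightarrow> (nat \<Rightarrow> complex) \<Rightarrow> (nat \<Rightarrow> complex)" where
  "OX d a u = (\<lambda>i. if i \<le> d then Otheta d a i * u i + (if i = 0 then 0 else u (i - 1)) else 0)"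

text \<open>Y v_j = theta*_j v_j + phi_j v_(j-1) (upper bidiagonal, superdiagonal phi).\<close>
definition OY :: "nat \<Rightarrow> complex \<Rightarrow> complex \<Rightarrow> complex \<Rightarrow> (nat \<Rightarrow> complex) \<Rightarrow> (nat \<Rightarrow> complex)" where
  "OY d a b c u = (\<lambda>i. if i \<le> d then Otheta d b i * u i
                        + (if i < d then Ophi d a b c (i + 1) * u (i + 1) else 0) else 0)"

definition Omod :: "nat \<Rightarrow> complex \<Rightarrow> complex \<Rightarrow> complex \<Rightarrow> nat bimod" where
  "Omod d a b c = \<lparr> car = {u. \<forall>i>d. u i = 0},
      opX = OX d a, opY = OY d a b c,
      opZ = (\<lambda>u i. OX d a (OY d a b c u) i + OY d a b c (OX d a u) i
                   - (2 * a * b - c * (of_nat d + 1)) * u i) \<rparr>"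

text \<open>An element of C^2 (x) R[x1,x2,x3] is a finitely supported coefficient function on
  (component, monomial); component False/True = first/second coordinate of C^2, a monomial
  x1^a x2^b x3^c is the triple (a,b,c).  Variables are indexed 1,2,3; the parameters k are
  given as a function nat => real (only k 1, k 2, k 3 matter).\<close>

type_synonym mono = "nat \<times> nat \<times> nat"
type_synonym cpoly = "bool \<times> mono \<Rightarrow> complex"

fun ex :: "nat \<Rightarrow> mono \<Rightarrow> nat" where
  "ex j (a, b, c) = (if j = 1 then a else if j = 2 then b else c)"

fun incr :: "nat \<Rightarrow> mono \<Rightarrow> mono" where
  "incr j (a, b, c) = (if j = 1 then (a + 1, b, c) else if j = 2 then (a, b + 1, c) else (a, b, c + 1))"

fun decr :: "nat \<Rightarrow> mono \<Rightarrow> mono" where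
  "decr j (a, b, c) = (if j = 1 then (a - 1, b, c) else if j = 2 then (a, b - 1, c) else (a, b, c - 1))"

fun mdeg :: "mono \<Rightarrow> nat" where
  "mdeg (a, b, c) = a + b + c"

definition refl :: "nat \<Rightarrow> cpoly \<Rightarrow> cpoly" where
  "refl j f = (\<lambda>(s, m). (-1) ^ ex j m * f (s, m))"

text \<open>T_j f = d f/d x_j + k_j (f - R_j f)/x_j; on monomials
  T_j x_j^e = (e + k_j (1 - (-1)^e)) x_j^(e-1).\<close>
definition dunkl :: "(nat \<Rightarrow> real) \<Rightarrow> nat \<Rightarrow> cpoly \<Rightarrow> cpoly" where
  "dunkl k j f = (\<lambda>(s, m). (of_nat (ex j m + 1) + of_real (k j) * (1 - (-1) ^ (ex j m + 1)))
                            * f (s, incr j m))"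

definition xmul :: "nat \<Rightarrow> cpoly \<Rightarrow> cpoly" where
  "xmul j f = (\<lambda>(s, m). if ex j m = 0 then 0 else f (s, decr j m))"

definition pauli :: "nat \<Rightarrow> cpoly \<Rightarrow> cpoly" where
  "pauli j f = (\<lambda>(s, m).
     if j = 1 then f (\<not> s, m)
     else if j = 2 then (if s then \<i> * f (False, m) else - \<i> * f (True, m))
     else (if s then - f (s, m) else f (s, m)))"

definition dirac :: "(nat \<Rightarrow> real) \<Rightarrow> cpoly \<Rightarrow> cpoly" where
  "dirac k f = (\<lambda>x. pauli 1 (dunkl k 1 f) x + pauli 2 (dunkl k 2 f) x + pauli 3 (dunkl k 3 f) x)"

text \<open>C^2 (x) R[x1,x2,x3]_n (homogeneous of degree n; automatically finitely supported)\<close>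
definition homog :: "nat \<Rightarrow> cpoly set" where
  "homog n = {f. \<forall>s m. f (s, m) \<noteq> 0 \<longrightarrow> mdeg m = n}"

definition Mn :: "(nat \<Rightarrow> real) \<Rightarrow> nat \<Rightarrow> cpoly set" where
  "Mn k n = {f \<in> homog n. dirac k f = (\<lambda>_. 0)}"

definition tval :: "real \<Rightarrow> enat" where
  "tval r = (if \<exists>m::nat. odd m \<and> 2 * r = - real m then enat (nat \<lfloor>- 2 * r\<rfloor>) else \<infinity>)"

definition Mnx :: "(nat \<Rightarrow> real) \<Rightarrow> nat \<Rightarrow> nat \<Rightarrow> cpoly set" where
  "Mnx k n i = {f \<in> Mn k n. \<forall>s m. f (s, m) \<noteq> 0 \<longrightarrow> tval (k i) \<le> enat (ex i m)}"

definition Jop :: "(nat \<Rightarrow> real) \<Rightarrow> nat \<Rightarrow> nat \<Rightarrow> nat \<Rightarrow> cpoly \<Rightarrow> cpoly" where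
  "Jop k i p q f = (let g = refl p (refl q f) in
     (\<lambda>x. \<i> * pauli i (\<lambda>y. xmul q (dunkl k p g) y - xmul p (dunkl k q g) y) x + g x / 2
          + of_real (k p) * refl q f x + of_real (k q) * refl p f x))"

definition Mmod :: "(nat \<Rightarrow> real) \<Rightarrow> nat \<Rightarrow> (bool \<times> mono) bimod" where
  "Mmod k n = \<lparr> car = Mn k n, opX = Jop k 1 2 3, opY = Jop k 2 3 1, opZ = Jop k 3 1 2 \<rparr>"

definition Mxmod :: "(nat \<Rightarrow> real) \<Rightarrow> nat \<Rightarrow> nat \<Rightarrow> (bool \<times> mono) bimod" where
  "Mxmod k n i = \<lparr> car = Mnx k n i, opX = Jop k 1 2 3, opY = Jop k 2 3 1, opZ = Jop k 3 1 2 \<rparr>"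

end

theory Submission
  imports Defs
begin

text \<open>The Dirac equation expresses the \<open>x\<^sub>1\<close>-derivative through the other two, and \<open>n < t\<^sub>1\<close> makes the
  factors \<open>m + k\<^sub>1 (1 - (-1)\<^sup>m)\<close>, \<open>1 \<le> m \<le> n\<close>, invertible; hence restriction to \<open>x\<^sub>1 = 0\<close> identifies
  \<open>M\<^sub>n\<close> with the \<open>\<complex>\<^sup>2\<close>-valued forms of degree \<open>n\<close> in \<open>x\<^sub>2, x\<^sub>3\<close>.  There \<open>X, Y, Z\<close> only involve \<open>e\<^sub>1\<close>, and
  after a rescaling of the monomials the two eigenspaces of \<open>e\<^sub>1\<close> carry the same matrices: \<open>X\<close>
  tridiagonal, \<open>Y\<close> upper and \<open>Z\<close> lower bidiagonal.  The off-diagonal entry at \<open>x\<^sub>2\<close>-degree \<open>t\<^sub>2\<close> vanishes,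
  which splits off \<open>M\<^sub>n(x\<^sub>2)\<close>.  On the submodule and on the quotient, the passage to the basis of \<open>O\<^sub>d\<close> is,
  up to diagonal factors and one shear, the Pascal matrix \<open>y\<^sup>j \<mapsto> (1 + y)\<^sup>j\<close>.

  Irreducibility: if \<open>U\<close> is a submodule of \<open>O\<^sub>d\<close> and \<open>r\<close> is the least top index of a nonzero vector of \<open>U\<close>,
  this vector \<open>u\<close> is an eigenvector of \<open>Y\<close> and \<open>(Y - \<theta>\<^sup>*\<^sub>r) (Y - \<theta>\<^sup>*\<^sub>r\<^sub>+\<^sub>1) X u = 0\<close>; for \<open>r > 0\<close> its coordinate
  \<open>r - 1\<close> is a product of nonzero linear factors.  The last isomorphism comes from Schur's lemma: a
  \<open>Y\<close>-eigenvector for the last eigenvalue generates an image of the module with reversed eigenvalues.\<close>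

section \<open>Irreducibility of the modules O\<close>

text \<open>\<open>Z\<close> never needs an analysis of its own: on the restricted solutions, as on
  \<open>O_d\<close>, it is \<open>{X, Y}\<close> minus a constant, so it suffices to match
  \<open>X\<close>, \<open>Y\<close> and that constant. The two isomorphic summands come from the
  eigenvalues \<open>\<epsilon> = 1\<close> and \<open>\<epsilon> = -1\<close> of
  \<open>e_1\<close>. The Dirac equation eliminates \<open>T_1\<close> on the plane x_1 = 0, and
  what remains involves \<open>e_1\<close> and scalars only; after the rescaling just
  \<open>\<epsilon>\<close>^2 = 1 is left in the matrices. Since n is odd, the exponents of x_2 and
  x_3 in a monomial of degree n have opposite parity, so every reflection there is a sign depending
  on one exponent. The Pascal matrix is a Taylor expansion. With the even and the odd coordinates
  collected into two polynomials in y, the derivatives in \<open>X\<close> carry the factor 1 - y;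
  expanding around y = 1 makes the operator triangular. For the reversed module, the images of the
  basis vectors are forced by the action of \<open>X\<close>. The difficulty is to show that
  \<open>Y\<close> acts on them as it should and that the chain stops after index d; both follow
  from the cubic relations between \<open>X\<close> and \<open>Y\<close> and from the separation of
  the eigenvalues of \<open>Y\<close>.\<close>

lemma csubspace_sum:
  assumes "csubspace U" "finite I" "\<And>i. i \<in> I \<Longrightarrow> f i \<in> U"
  shows "(\<lambda>x. \<Sum>i\<in>I. f i x) \<in> U"
  using assms(2,3)
proof (induction I rule: finite_induct)
  case empty
  then show ?case using assms(1) by (simp add: csubspace_def)
next
  case (insert a F)
  then have "(\<lambda>x. f a x + (\<Sum>i\<in>F. f i x)) \<in> U"
    using assms(1) by (simp add: csubspace_def)
  then show ?case using insert by simp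
qed

lemma csubspace_diff:
  assumes "csubspace U" "u \<in> U" "v \<in> U"
  shows "(\<lambda>x. u x - c * v x) \<in> U"
proof -
  have "(\<lambda>x. - c * v x) \<in> U" using assms by (simp only: csubspace_def)
  moreover have "\<forall>u\<in>U. \<forall>v\<in>U. (\<lambda>x. u x + v x) \<in> U"
    using assms(1) by (simp add: csubspace_def)
  ultimately show ?thesis using assms(2) by fastforce
qed

lemma car_Omod [simp]: "car (Omod d a b c) = {u. \<forall>i>d. u i = 0}"
  and opX_Omod [simp]: "opX (Omod d a b c) = OX d a"
  and opY_Omod [simp]: "opY (Omod d a b c) = OY d a b c"
  by (auto simp: Omod_def)

lemma Ophi_0 [simp]: "Ophi d a b c 0 = 0"
  by (simp add: Ophi_def)

text \<open>For even d the index d + 1 is odd and its factor i - d - 1 is zero. This allows the cut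
  at d to be ignored in computations with \<open>Y\<close>.\<close>

lemma Ophi_top: "even d \<Longrightarrow> Ophi d a b c (Suc d) = 0"
  by (simp add: Ophi_def)

lemma OY_even: "even d \<Longrightarrow> i \<le> d \<Longrightarrow>
   OY d a b c u i = Otheta d b i * u i + Ophi d a b c (i + 1) * u (i + 1)"
  by (cases "i = d") (simp_all add: OY_def Ophi_top)

definition unit_vec :: "nat \<Rightarrow> nat \<Rightarrow> complex" where
  "unit_vec j = (\<lambda>i. if i = j then 1 else 0)"

text \<open>All subdiagonal entries of \<open>X\<close> are 1, so subtracting the diagonal part from
  \<open>X v_j\<close> leaves exactly \<open>v_(j+1)\<close>.\<close>

lemma Omod_generated:
  assumes "csubspace U" "U \<subseteq> {u. \<forall>i>d. u i = 0}" "OX d a ` U \<subseteq> U" "unit_vec 0 \<in> U"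
  shows "U = {u. \<forall>i>d. u i = 0}"
proof -
  have e: "unit_vec j \<in> U" if "j \<le> d" for j
    using that
  proof (induction j)
    case 0 show ?case using assms(4) .
  next
    case (Suc j)
    then have j: "unit_vec j \<in> U" by simp
    then have "(\<lambda>x. OX d a (unit_vec j) x - Otheta d a j * unit_vec j x) \<in> U"
      using assms(1,3) by (intro csubspace_diff) auto
    also have "(\<lambda>x. OX d a (unit_vec j) x - Otheta d a j * unit_vec j x) = unit_vec (Suc j)"
      using Suc.prems by (auto simp: OX_def unit_vec_def fun_eq_iff)
    finally show ?case .
  qed
  have "u \<in> U" if "\<forall>i>d. u i = 0" for u
  proof -
    have "(\<lambda>x. \<Sum>i\<in>{..d}. u i * unit_vec i x) \<in> U"
      using e assms(1) by (intro csubspace_sum) (auto simp: csubspace_def)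
    also have "(\<lambda>x. \<Sum>i\<in>{..d}. u i * unit_vec i x) = u"
    proof
      fix x
      have "(\<Sum>i\<in>{..d}. u i * unit_vec i x) = (\<Sum>i\<in>{..d}. if i = x then u i else 0)"
        by (intro sum.cong) (auto simp: unit_vec_def)
      also have "\<dots> = u x" using that by (simp add: sum.delta)
      finally show "(\<Sum>i\<in>{..d}. u i * unit_vec i x) = u x" .
    qed
    finally show ?thesis .
  qed
  then show ?thesis using assms(2) by auto
qed

text \<open>The elimination for \<open>Omod_no_lowest_vector\<close> at even x = r:
  \<open>U0\<close>, \<open>U1\<close>, \<open>U2\<close> are the coordinates r, r - 1, r - 2 of the
  vector, \<open>A\<close>, \<open>B\<close>, \<open>C\<close> the eigenvalues of \<open>Y\<close>
  at r, r + 1, r - 1, and \<open>F\<close> is \<open>Ophi\<close> at r. The premises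
  \<open>U1\<close> and \<open>U2\<close> are rows of the eigenvector equation, \<open>Q\<close> is
  row r - 1 of the quadratic one.\<close>

lemma Omod_irred_step_even:
  fixes a b c x d U0 U1 U2 :: complex
  defines "F \<equiv> x * (d + 1 - 2 * x - 2 * a - 2 * b - 2 * c) / 2"
  assumes U1: "(2 * b - d + 2 * x - 1) * U1 = F * U0"
    and U2: "2 * U2 = (x - 1 - d - 1) * (d + 1 - 2 * (x - 1) - 2 * a - 2 * b + 2 * c) / 2 * U1"
    and A: "A = (2 * b - d + 2 * x) / 2" and B: "B = - (2 * b - d + 2 * (x + 1)) / 2"
    and C: "C = - (2 * b - d + 2 * (x - 1)) / 2"
    and Q: "(C - A) * (C - B) * (- (2 * a - d + 2 * (x - 1)) / 2 * U1 + U2)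
      + F * (C - B) * ((2 * a - d + 2 * x) / 2 * U0 + U1)
      + F * ((x + 1 - d - 1) * (d + 1 - 2 * (x + 1) - 2 * a - 2 * b + 2 * c) / 2) * U0 = 0"
  shows "F * U0 * ((d + 1 - 2 * x + 2 * a - 2 * b + 2 * c) * (d + 1 - x - 2 * b)) = 0"
proof -
  \<comment> \<open>\<open>D\<close> = \<open>A - C\<close> may be zero, so \<open>U1\<close> is not
    solved for. The whole equation is multiplied by \<open>D\<close> and \<open>D * U1\<close> is
    replaced.\<close>
  define D where "D = 2 * b - d + 2 * x - 1"
  define p where "p = (x - 1 - d - 1) * (d + 1 - 2 * (x - 1) - 2 * a - 2 * b + 2 * c) / 4"
  define r where "r = (x + 1 - d - 1) * (d + 1 - 2 * (x + 1) - 2 * a - 2 * b + 2 * c) / 2"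
  have U1': "D * U1 = F * U0" using U1 by (simp add: D_def)
  have U2': "U2 = p * U1" using U2 by (simp add: p_def field_simps)
  have CA: "C - A = - D" and CB: "C - B = 2" by (simp_all add: A B C D_def field_simps)
  have "- D * 2 * (- (2 * a - d + 2 * (x - 1)) / 2 * U1 + p * U1)
      + F * 2 * ((2 * a - d + 2 * x) / 2 * U0 + U1) + F * r * U0 = 0"
    using Q unfolding CA CB U2' r_def .
  then have "D * (- D * 2 * (- (2 * a - d + 2 * (x - 1)) / 2 * U1 + p * U1)
      + F * 2 * ((2 * a - d + 2 * x) / 2 * U0 + U1) + F * r * U0) = 0" by simp
  also have "D * (- D * 2 * (- (2 * a - d + 2 * (x - 1)) / 2 * U1 + p * U1)
      + F * 2 * ((2 * a - d + 2 * x) / 2 * U0 + U1) + F * r * U0) =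
     (- D * 2 * (- (2 * a - d + 2 * (x - 1)) / 2 + p) + 2 * F) * (D * U1)
      + F * U0 * (D * (2 * a - d + 2 * x) + D * r)"
    by (simp add: field_simps)
  also have "\<dots> = F * U0 * (- 2 * D * (- (2 * a - d + 2 * (x - 1)) / 2 + p) + 2 * F
      + D * (2 * a - d + 2 * x) + D * r)"
    unfolding U1' by (simp add: algebra_simps)
  \<comment> \<open>The cubic terms in x cancel and the rest splits into two linear factors; these
    are the factors listed in \<open>Oregular\<close>.\<close>
  also have "- 2 * D * (- (2 * a - d + 2 * (x - 1)) / 2 + p) + 2 * F
      + D * (2 * a - d + 2 * x) + D * r =
      - ((d + 1 - 2 * x + 2 * a - 2 * b + 2 * c) * (d + 1 - x - 2 * b))"
    unfolding D_def p_def r_def F_def by (simp add: field_simps)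
  finally show ?thesis by simp
qed

text \<open>The same elimination with the two formulas for \<open>Ophi\<close> exchanged and the
  eigenvalue signs flipped: \<open>C - B\<close> is now -2, c changes sign in the first factor, and
  the second becomes 2b + x.\<close>

lemma Omod_irred_step_odd:
  fixes a b c x d U0 U1 U2 :: complex
  defines "F \<equiv> (x - d - 1) * (d + 1 - 2 * x - 2 * a - 2 * b + 2 * c) / 2"
  assumes U1: "(2 * b - d + 2 * x - 1) * U1 = - F * U0"
    and U2: "2 * U2 = - (x - 1) * (d + 1 - 2 * (x - 1) - 2 * a - 2 * b - 2 * c) / 2 * U1"
    and A: "A = - (2 * b - d + 2 * x) / 2" and B: "B = (2 * b - d + 2 * (x + 1)) / 2"
    and C: "C = (2 * b - d + 2 * (x - 1)) / 2"
    and Q: "(C - A) * (C - B) * ((2 * a - d + 2 * (x - 1)) / 2 * U1 + U2)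
      + F * (C - B) * (- (2 * a - d + 2 * x) / 2 * U0 + U1)
      + F * ((x + 1) * (d + 1 - 2 * (x + 1) - 2 * a - 2 * b - 2 * c) / 2) * U0 = 0"
  shows "F * U0 * ((d + 1 - 2 * x + 2 * a - 2 * b - 2 * c) * (2 * b + x)) = 0"
proof -
  define D where "D = 2 * b - d + 2 * x - 1"
  define p where "p = - (x - 1) * (d + 1 - 2 * (x - 1) - 2 * a - 2 * b - 2 * c) / 4"
  define r where "r = (x + 1) * (d + 1 - 2 * (x + 1) - 2 * a - 2 * b - 2 * c) / 2"
  have U1': "D * U1 = - F * U0" using U1 by (simp add: D_def)
  have U2': "U2 = p * U1" using U2 by (simp add: p_def field_simps)
  have CA: "C - A = D" and CB: "C - B = - 2" by (simp_all add: A B C D_def field_simps)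
  have "D * - 2 * ((2 * a - d + 2 * (x - 1)) / 2 * U1 + p * U1)
      + F * - 2 * (- (2 * a - d + 2 * x) / 2 * U0 + U1) + F * r * U0 = 0"
    using Q unfolding CA CB U2' r_def .
  then have "D * (D * - 2 * ((2 * a - d + 2 * (x - 1)) / 2 * U1 + p * U1)
      + F * - 2 * (- (2 * a - d + 2 * x) / 2 * U0 + U1) + F * r * U0) = 0" by simp
  also have "D * (D * - 2 * ((2 * a - d + 2 * (x - 1)) / 2 * U1 + p * U1)
      + F * - 2 * (- (2 * a - d + 2 * x) / 2 * U0 + U1) + F * r * U0) =
     (D * - 2 * ((2 * a - d + 2 * (x - 1)) / 2 + p) - 2 * F) * (D * U1)
      + F * U0 * (D * (2 * a - d + 2 * x) + D * r)"
    by (simp add: field_simps)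
  also have "\<dots> = F * U0 * (2 * D * ((2 * a - d + 2 * (x - 1)) / 2 + p) + 2 * F
      + D * (2 * a - d + 2 * x) + D * r)"
    unfolding U1' by (simp add: algebra_simps)
  also have "2 * D * ((2 * a - d + 2 * (x - 1)) / 2 + p) + 2 * F
      + D * (2 * a - d + 2 * x) + D * r =
      (d + 1 - 2 * x + 2 * a - 2 * b - 2 * c) * (2 * b + x)"
    unfolding D_def p_def r_def F_def by (simp add: field_simps)
  finally show ?thesis by simp
qed

text \<open>A sufficient condition for irreducibility: at each index r neither the superdiagonal
  entry nor the cofactor produced by the elimination vanishes.\<close>

definition Oregular :: "nat \<Rightarrow> complex \<Rightarrow> complex \<Rightarrow> complex \<Rightarrow> bool" where
  "Oregular d a b c \<longleftrightarrow> (\<forall>r. 1 \<le> r \<and> r \<le> d \<longrightarrow> Ophi d a b c r \<noteq> 0 \<and>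
     (if even r
      then (of_nat d + 1 - 2 * of_nat r + 2 * a - 2 * b + 2 * c) * (of_nat d + 1 - of_nat r - 2 * b)
      else (of_nat d + 1 - 2 * of_nat r + 2 * a - 2 * b - 2 * c) * (2 * b + of_nat r)) \<noteq> 0)"

text \<open>Row r - 1 of \<open>y2\<close> involves only the coordinates r, r - 1, r - 2 of u. Two
  rows of the eigenvector equation eliminate the lower two, which leaves \<open>u r\<close> times
  factors that \<open>Oregular\<close> keeps nonzero.\<close>

lemma Omod_no_lowest_vector:
  assumes "even d" "Oregular d a b c" "1 \<le> r" "r \<le> d" "u r \<noteq> 0" "\<forall>i>r. u i = 0"
    and ev: "OY d a b c u = (\<lambda>i. Otheta d b r * u i)"
    and y1: "y1 = (\<lambda>i. OY d a b c (OX d a u) i - Otheta d b (Suc r) * OX d a u i)"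
    and y2: "(\<lambda>i. OY d a b c y1 i - Otheta d b r * y1 i) = (\<lambda>_. 0)"
  shows False
proof -
  obtain s where r: "r = Suc s" using \<open>1 \<le> r\<close> by (cases r) auto
  define U0 where "U0 = u r"
  define U1 where "U1 = u s"
  \<comment> \<open>For r = 1 there is no coordinate r - 2. The value 0 keeps \<open>e2\<close>
    valid there, because \<open>Ophi\<close> is 0 at index 0.\<close>
  define U2 where "U2 = (if s = 0 then 0 else u (s - 1))"
  define A where "A = Otheta d b r"
  define B where "B = Otheta d b (Suc r)"
  define C where "C = Otheta d b s"
  define w where "w = OX d a u"
  have wr: "w r = Otheta d a r * U0 + U1" and ws: "w s = Otheta d a s * U1 + U2"
    using \<open>r \<le> d\<close> by (simp_all add: w_def OX_def r U0_def U1_def U2_def)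
  \<comment> \<open>At r = d the coordinate \<open>w (Suc r)\<close> is cut off and differs from
    \<open>U0\<close>, but its coefficient is then 0; the multiplied form covers both cases.\<close>
  have wr': "Ophi d a b c (Suc r) * w (Suc r) = Ophi d a b c (Suc r) * U0"
    using \<open>r \<le> d\<close> assms(6) Ophi_top[OF \<open>even d\<close>, of a b c]
    by (cases "r = d") (simp_all add: w_def OX_def U0_def)
  have y1r: "y1 r = (A - B) * w r + Ophi d a b c (Suc r) * U0"
    using wr' by (simp add: y1 OY_even[OF \<open>even d\<close> \<open>r \<le> d\<close>] w_def[symmetric] A_def B_def algebra_simps)
  have y1s: "y1 s = (C - B) * w s + Ophi d a b c r * w r"
    using \<open>r \<le> d\<close>
    by (simp add: y1 OY_even[OF \<open>even d\<close>] w_def[symmetric] C_def B_def r algebra_simps)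
  have "OY d a b c y1 s - A * y1 s = 0"
    using fun_cong[OF y2, of s] by (simp add: A_def)
  then have Q0: "(C - A) * y1 s + Ophi d a b c r * y1 r = 0"
    using \<open>r \<le> d\<close> by (simp add: OY_even[OF \<open>even d\<close>] C_def r algebra_simps)
  have Q: "(C - A) * (C - B) * (Otheta d a s * U1 + U2)
      + Ophi d a b c r * (C - B) * (Otheta d a r * U0 + U1)
      + Ophi d a b c r * Ophi d a b c (Suc r) * U0 = 0"
    using Q0 unfolding y1r y1s wr ws by (simp add: algebra_simps)
  have e1: "(A - C) * U1 = Ophi d a b c r * U0"
    using fun_cong[OF ev, of s] \<open>r \<le> d\<close>
    by (simp add: OY_even[OF \<open>even d\<close>] A_def C_def U0_def U1_def r algebra_simps)
  have e2: "(A - Otheta d b (s - 1)) * U2 = Ophi d a b c s * U1"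
  proof (cases s)
    case (Suc q)
    then show ?thesis
      using fun_cong[OF ev, of q] \<open>r \<le> d\<close>
      by (simp add: OY_even[OF \<open>even d\<close>] A_def C_def U2_def U1_def r algebra_simps)
  qed (simp add: U2_def)
  have F: "Ophi d a b c r \<noteq> 0" "U0 \<noteq> 0" using assms by (auto simp: Oregular_def U0_def)
  have R: "(if even r
      then (of_nat d + 1 - 2 * of_nat r + 2 * a - 2 * b + 2 * c) * (of_nat d + 1 - of_nat r - 2 * b)
      else (of_nat d + 1 - 2 * of_nat r + 2 * a - 2 * b - 2 * c) * (2 * b + of_nat r)) \<noteq> 0"
    using assms unfolding Oregular_def by blast
  have xs: "of_nat s = (of_nat r - 1 :: complex)" by (simp add: r)
  show False
  proof (cases "even r")
    case True
    define F where "F = of_nat r * (of_nat d + 1 - 2 * of_nat r - 2 * a - 2 * b - 2 * c) / 2"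
    have Fr: "Ophi d a b c r = F" using True by (simp add: Ophi_def F_def)
    have A': "A = (2 * b - of_nat d + 2 * of_nat r) / 2"
      and B': "B = - (2 * b - of_nat d + 2 * (of_nat r + 1)) / 2"
      and C': "C = - (2 * b - of_nat d + 2 * (of_nat r - 1)) / 2"
      and ths: "Otheta d a s = - (2 * a - of_nat d + 2 * (of_nat r - 1)) / 2"
      and thr: "Otheta d a r = (2 * a - of_nat d + 2 * of_nat r) / 2"
      using True by (simp_all add: A_def B_def C_def Otheta_def r field_simps)
    obtain q where s: "s = Suc q" using True r by (cases s) auto
    have e2': "2 * U2 = (of_nat r - 1 - of_nat d - 1) * (of_nat d + 1 - 2 * (of_nat r - 1) - 2 * a - 2 * b + 2 * c) / 2 * U1"
    proof -
      have "A - Otheta d b (s - 1) = 2"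
        using True by (simp add: A' Otheta_def r s field_simps)
      moreover have "Ophi d a b c s = (of_nat r - 1 - of_nat d - 1) * (of_nat d + 1 - 2 * (of_nat r - 1) - 2 * a - 2 * b + 2 * c) / 2"
        using True by (simp add: Ophi_def xs[symmetric] r)
      ultimately show ?thesis using e2 by metis
    qed
    have ph: "Ophi d a b c (Suc r) = (of_nat r + 1 - of_nat d - 1) * (of_nat d + 1 - 2 * (of_nat r + 1) - 2 * a - 2 * b + 2 * c) / 2"
      using True by (simp add: Ophi_def algebra_simps)
    have "A - C = 2 * b - of_nat d + 2 * of_nat r - 1"
      by (simp add: A' C' field_simps)
    with e1 have e1': "(2 * b - of_nat d + 2 * of_nat r - 1) * U1 = F * U0"
      by (simp add: Fr)
    from Omod_irred_step_even[OF e1'[unfolded F_def] e2' A' B' C'] Q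
    have "F * U0 * ((of_nat d + 1 - 2 * of_nat r + 2 * a - 2 * b + 2 * c) * (of_nat d + 1 - of_nat r - 2 * b)) = 0"
      unfolding Fr ph ths thr F_def by blast
    then show False using F R True Fr \<open>U0 \<noteq> 0\<close> by simp
  next
    case False
    define F where "F = (of_nat r - of_nat d - 1) * (of_nat d + 1 - 2 * of_nat r - 2 * a - 2 * b + 2 * c) / 2"
    have Fr: "Ophi d a b c r = F" using False by (simp add: Ophi_def F_def)
    have A': "A = - (2 * b - of_nat d + 2 * of_nat r) / 2"
      and B': "B = (2 * b - of_nat d + 2 * (of_nat r + 1)) / 2"
      and C': "C = (2 * b - of_nat d + 2 * (of_nat r - 1)) / 2"
      and ths: "Otheta d a s = (2 * a - of_nat d + 2 * (of_nat r - 1)) / 2"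
      and thr: "Otheta d a r = - (2 * a - of_nat d + 2 * of_nat r) / 2"
      using False by (simp_all add: A_def B_def C_def Otheta_def r field_simps)
    have e2': "2 * U2 = - (of_nat r - 1) * (of_nat d + 1 - 2 * (of_nat r - 1) - 2 * a - 2 * b - 2 * c) / 2 * U1"
    proof (cases s)
      case (Suc q)
      have "A - Otheta d b (s - 1) = - 2"
        using False by (simp add: A' Otheta_def r Suc field_simps)
      moreover have "Ophi d a b c s = (of_nat r - 1) * (of_nat d + 1 - 2 * (of_nat r - 1) - 2 * a - 2 * b - 2 * c) / 2"
        using False by (simp add: Ophi_def xs[symmetric] r)
      ultimately have "- 2 * U2 = (of_nat r - 1) * (of_nat d + 1 - 2 * (of_nat r - 1) - 2 * a - 2 * b - 2 * c) / 2 * U1"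
        using e2 by metis
      then show ?thesis by (metis minus_divide_left minus_equation_iff mult_minus_left)
    qed (simp add: U2_def r)
    have ph: "Ophi d a b c (Suc r) = (of_nat r + 1) * (of_nat d + 1 - 2 * (of_nat r + 1) - 2 * a - 2 * b - 2 * c) / 2"
      using False by (simp add: Ophi_def algebra_simps)
    have "- (A - C) = 2 * b - of_nat d + 2 * of_nat r - 1"
      by (simp add: A' C' field_simps)
    then have "(2 * b - of_nat d + 2 * of_nat r - 1) * U1 = - ((A - C) * U1)"
      by (metis mult_minus_left)
    then have e1': "(2 * b - of_nat d + 2 * of_nat r - 1) * U1 = - F * U0"
      by (simp add: e1 Fr)
    from Omod_irred_step_odd[OF e1'[unfolded F_def] e2' A' B' C'] Q
    have "F * U0 * ((of_nat d + 1 - 2 * of_nat r + 2 * a - 2 * b - 2 * c) * (2 * b + of_nat r)) = 0"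
      unfolding Fr ph ths thr F_def by blast
    then show False using F R False Fr \<open>U0 \<noteq> 0\<close> by simp
  qed
qed

lemma Omod_irred:
  assumes "even d" "Oregular d a b c"
  shows "bimod_irred (Omod d a b c)"
  unfolding bimod_irred_def
proof (intro conjI allI impI, goal_cases)
  case 1
  have "unit_vec 0 \<in> car (Omod d a b c)" "unit_vec 0 \<noteq> (\<lambda>_. 0)"
    by (auto simp: unit_vec_def fun_eq_iff)
  then show ?case by blast
next
  case (2 U)
  then have U: "U \<subseteq> {u. \<forall>i>d. u i = 0}" "csubspace U" "OX d a ` U \<subseteq> U" "OY d a b c ` U \<subseteq> U"
    by auto
  show ?case
  proof (cases "U = {\<lambda>_. 0}")
    case False
    define P where "P r \<longleftrightarrow> (\<exists>u\<in>U. u \<noteq> (\<lambda>_. 0) \<and> (\<forall>i>r. u i = 0))" for r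
    define r where "r = (LEAST r. P r)"
    have "(\<lambda>_. 0) \<in> U" using U(2) by (simp add: csubspace_def)
    with False obtain u0 where "u0 \<in> U" "u0 \<noteq> (\<lambda>_. 0)" by blast
    then have Pd: "P d" using U(1) unfolding P_def by blast
    then have "r \<le> d" unfolding r_def by (rule Least_le)
    have "P r" unfolding r_def by (rule LeastI[of P d, OF Pd])
    then obtain u where u: "u \<in> U" "u \<noteq> (\<lambda>_. 0)" "\<forall>i>r. u i = 0" unfolding P_def by blast
    have min: "v = (\<lambda>_. 0)" if "v \<in> U" "\<forall>i\<ge>r. v i = 0" for v
    proof (rule ccontr)
      assume v: "v \<noteq> (\<lambda>_. 0)"
      then have "r \<noteq> 0" using that(2) by auto
      then have "P (r - 1)" unfolding P_def using that v by (intro bexI[of _ v]) auto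
      then have "r \<le> r - 1" unfolding r_def by (rule Least_le)
      then show False using \<open>r \<noteq> 0\<close> by simp
    qed
    have ur: "u r \<noteq> 0" using min[OF u(1)] u(2,3) by (metis le_eq_less_or_eq)
    have Ym: "(\<lambda>i. OY d a b c v i - x * v i) \<in> U" if "v \<in> U" for v x
      using that U by (intro csubspace_diff) auto
    have ev: "OY d a b c u = (\<lambda>i. Otheta d b r * u i)"
    proof -
      have "(\<lambda>i. OY d a b c u i - Otheta d b r * u i) = (\<lambda>_. 0)"
        using u(3) \<open>r \<le> d\<close> by (intro min Ym u(1)) (auto simp: OY_def le_less)
      then show ?thesis by (simp add: fun_eq_iff)
    qed
    \<comment> \<open>\<open>X u\<close> reaches index r + 1 at most. Subtracting the eigenvalue at
      r + 1 removes that coordinate, and subtracting the one at r in \<open>y2\<close> removes the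
      next, so the minimality of r applies.\<close>
    define y1 where "y1 = (\<lambda>i. OY d a b c (OX d a u) i - Otheta d b (Suc r) * OX d a u i)"
    have y1U: "y1 \<in> U" unfolding y1_def using U(3) u(1) by (intro Ym) auto
    have y1z: "y1 i = 0" if "i > r" for i
      using that u(3) by (cases "i = Suc r") (auto simp: y1_def OY_def OX_def)
    have y2: "(\<lambda>i. OY d a b c y1 i - Otheta d b r * y1 i) = (\<lambda>_. 0)"
    proof (intro min Ym y1U allI impI)
      fix i assume "r \<le> i"
      then show "OY d a b c y1 i - Otheta d b r * y1 i = 0"
        using y1z[of i] y1z[of "Suc i"] \<open>r \<le> d\<close> by (cases "i = r") (simp_all add: OY_def)
    qed
    have "r = 0"
    proof (rule ccontr)
      assume "r \<noteq> 0"
      then have "1 \<le> r" by simp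
      from Omod_no_lowest_vector[OF assms this \<open>r \<le> d\<close> ur u(3) ev y1_def y2] show False .
    qed
    then have "u = (\<lambda>i. u 0 * unit_vec 0 i)"
      using u(3) by (intro ext) (simp add: unit_vec_def)
    then have "unit_vec 0 = (\<lambda>i. inverse (u 0) * u i)"
      using ur \<open>r = 0\<close> u(3) by (intro ext) (simp add: unit_vec_def)
    then have "unit_vec 0 \<in> U" using U(2) u(1) by (simp add: csubspace_def)
    from Omod_generated[OF U(2,1,3) this] show ?thesis by simp
  qed simp
qed

lemma bimod_irred_twist:
  assumes "bimod_irred M"
  shows "bimod_irred (bimod_twist M)"
  unfolding bimod_irred_def
proof (intro conjI allI impI, goal_cases)
  case 1
  then show ?case using assms by (simp add: bimod_irred_def bimod_twist_def)
next
  case (2 U)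
  have neg: "f ` U \<subseteq> U" if "(\<lambda>u x. - f u x) ` U \<subseteq> U" for f
  proof
    fix v assume "v \<in> f ` U"
    then obtain u where "u \<in> U" "v = f u" by blast
    then have "(\<lambda>x. - f u x) \<in> U" using that by blast
    then have "(\<lambda>x. -1 * - f u x) \<in> U" using 2 by (simp only: csubspace_def)
    then show "v \<in> U" using \<open>v = f u\<close> by simp
  qed
  from 2 have "U \<subseteq> car M \<and> csubspace U \<and> opX M ` U \<subseteq> U \<and> opY M ` U \<subseteq> U \<and> opZ M ` U \<subseteq> U"
    by (simp add: bimod_twist_def neg)
  then show ?case using assms unfolding bimod_irred_def by (simp add: bimod_twist_def)
qed

section \<open>Reversing the order of the eigenvalues\<close>

text \<open>Since \<open>\<phi>\<^sub>d\<^sub>+\<^sub>1 = 0\<close>, truncation to the indices up to \<open>d\<close> maps the untruncated operators to \<open>OX\<close> and \<open>OY\<close>.\<close>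

definition tX :: "nat \<Rightarrow> complex \<Rightarrow> (nat \<Rightarrow> complex) \<Rightarrow> nat \<Rightarrow> complex" where
  "tX d a u i = Otheta d a i * u i + (if i = 0 then 0 else u (i - 1))"

definition tY :: "nat \<Rightarrow> complex \<Rightarrow> complex \<Rightarrow> complex \<Rightarrow> (nat \<Rightarrow> complex) \<Rightarrow> nat \<Rightarrow> complex" where
  "tY d a b c u i = Otheta d b i * u i + Ophi d a b c (i + 1) * u (i + 1)"

lemma OX_cut:
  assumes "\<And>i. i \<le> d \<Longrightarrow> u i = v i" "i \<le> d"
  shows "OX d a u i = tX d a v i"
  using assms by (simp add: OX_def tX_def)

lemma OY_cut:
  assumes "even d" "\<And>i. i \<le> d \<Longrightarrow> u i = v i" "i \<le> d"
  shows "OY d a b c u i = tY d a b c v i"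
  using assms Ophi_top[OF \<open>even d\<close>, of a b c]
  by (cases "i = d") (simp_all add: OY_even tY_def)

lemma Otheta_sum: "Otheta d a (Suc i) + Otheta d a i = - ((-1) ^ i)"
  by (cases "even i") (simp_all add: Otheta_def field_simps)

lemma Otheta_Suc: "Otheta d a (Suc i) = - ((-1) ^ i) - Otheta d a i"
  using Otheta_sum[of d a i] by (simp add: algebra_simps)

text \<open>The left side is the coefficient of \<open>u i\<close> in row i + 1 of XXY + 2 XYX +
  YXX. Multiplied by \<open>p (Suc i)\<close> it is also the coefficient above the diagonal in the
  relation with \<open>X\<close> and \<open>Y\<close> exchanged, so one identity serves
  both.\<close>

lemma relation_coeff_offdiag:
  fixes i :: nat and a b c :: complex and d :: nat
  defines "t \<equiv> Otheta d a" and "s \<equiv> Otheta d b" and "p \<equiv> Ophi d a b c"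
  shows "(t (Suc i) + t i) * (s (Suc i) + s i) + p i + 2 * p (Suc i) + p (Suc (Suc i))
     + 2 * (t (Suc i) * s (Suc i) + t i * s i) = 2 * (2 * a * b - c * (of_nat d + 1))"
  unfolding t_def s_def p_def Otheta_sum
  by (cases "even i") (simp_all add: Otheta_def Ophi_def field_simps)

lemma relation_coeff_diag:
  fixes i :: nat and a b c :: complex and d :: nat
  defines "t \<equiv> Otheta d a" and "s \<equiv> Otheta d b" and "p \<equiv> Ophi d a b c"
  shows "4 * t (Suc i) ^ 2 * s (Suc i) + p (Suc i) * (3 * t (Suc i) + t i)
     + p (Suc (Suc i)) * (3 * t (Suc i) + t (Suc (Suc i)))
     = 2 * (2 * a * b - c * (of_nat d + 1)) * t (Suc i) + s (Suc i) + (2 * c * a - b * (of_nat d + 1))"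
  unfolding t_def s_def p_def
  by (cases "even i") (simp_all add: Otheta_def Ophi_def field_simps power2_eq_square)

lemma relation_coeff_diag':
  fixes i :: nat and a b c :: complex and d :: nat
  defines "t \<equiv> Otheta d a" and "s \<equiv> Otheta d b" and "p \<equiv> Ophi d a b c"
  shows "4 * s (Suc i) ^ 2 * t (Suc i) + p (Suc i) * (3 * s (Suc i) + s i)
     + p (Suc (Suc i)) * (3 * s (Suc i) + s (Suc (Suc i)))
     = 2 * (2 * a * b - c * (of_nat d + 1)) * s (Suc i) + t (Suc i) + (2 * b * c - a * (of_nat d + 1))"
  unfolding t_def s_def p_def
  by (cases "even i") (simp_all add: Otheta_def Ophi_def field_simps power2_eq_square)

lemma relation_coeff_diag_0':
  fixes a b c :: complex and d :: nat
  defines "t \<equiv> Otheta d a" and "s \<equiv> Otheta d b" and "p \<equiv> Ophi d a b c"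
  shows "4 * s 0 ^ 2 * t 0 + p (Suc 0) * (3 * s 0 + s (Suc 0))
     = 2 * (2 * a * b - c * (of_nat d + 1)) * s 0 + t 0 + (2 * b * c - a * (of_nat d + 1))"
  unfolding t_def s_def p_def
  by (simp add: Otheta_def Ophi_def field_simps power2_eq_square)

lemma Otheta_sum3:
  "Otheta d a (Suc (Suc i)) + Otheta d a (Suc i) + (Otheta d a (Suc i) + Otheta d a i) = 0"
  by (simp add: Otheta_sum)

lemma Otheta_sum_square: "(Otheta d a (Suc i) + Otheta d a i) ^ 2 = 1"
  by (cases "even i") (simp_all add: Otheta_sum)

lemma relation_coeff_diag_0:
  fixes a b c :: complex and d :: nat
  defines "t \<equiv> Otheta d a" and "s \<equiv> Otheta d b" and "p \<equiv> Ophi d a b c"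
  shows "4 * t 0 ^ 2 * s 0 + p (Suc 0) * (3 * t 0 + t (Suc 0))
     = 2 * (2 * a * b - c * (of_nat d + 1)) * t 0 + s 0 + (2 * c * a - b * (of_nat d + 1))"
  unfolding t_def s_def p_def
  by (simp add: Otheta_def Ophi_def field_simps power2_eq_square)

text \<open>This is \<open>{Z, X}\<close> = \<open>Y\<close> + constant with \<open>Z\<close>
  replaced by \<open>{X, Y}\<close> minus its constant. The outermost coefficients are settled by
  the fact that neighbouring diagonal entries sum to an alternating sign; the inner ones are the
  identities above.\<close>

lemma t_relation_X:
  "tX d a (tX d a (tY d a b c u)) i + 2 * tX d a (tY d a b c (tX d a u)) i + tY d a b c (tX d a (tX d a u)) i
    = 2 * (2 * a * b - c * (of_nat d + 1)) * tX d a u i + tY d a b c u i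
      + (2 * c * a - b * (of_nat d + 1)) * u i" (is "?L = ?R")
proof -
  let ?t = "Otheta d a" and ?s = "Otheta d b" and ?p = "Ophi d a b c"
  consider "i = 0" | "i = Suc 0" | j where "i = Suc (Suc j)" by (metis not0_implies_Suc)
  then show ?thesis
  proof cases
    case 1
    have "?L = (4 * ?t 0 ^ 2 * ?s 0 + ?p (Suc 0) * (3 * ?t 0 + ?t (Suc 0))) * u 0
        + (?t (Suc 0) + ?t 0) ^ 2 * ?p (Suc 0) * u (Suc 0)"
      unfolding 1 by (simp add: tX_def tY_def algebra_simps power2_eq_square)
    also have "\<dots> = ?R" unfolding Otheta_sum3 relation_coeff_diag_0 Otheta_sum_square
      by (simp add: 1 tX_def tY_def algebra_simps)
    finally show ?thesis .
  next
    case 2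
    have "?L = ((?t (Suc 0) + ?t 0) * (?s (Suc 0) + ?s 0) + ?p 0 + 2 * ?p (Suc 0) + ?p (Suc (Suc 0))
          + 2 * (?t (Suc 0) * ?s (Suc 0) + ?t 0 * ?s 0)) * u 0
        + (4 * ?t (Suc 0) ^ 2 * ?s (Suc 0) + ?p (Suc 0) * (3 * ?t (Suc 0) + ?t 0)
          + ?p (Suc (Suc 0)) * (3 * ?t (Suc 0) + ?t (Suc (Suc 0)))) * u (Suc 0)
        + (?t (Suc (Suc 0)) + ?t (Suc 0)) ^ 2 * ?p (Suc (Suc 0)) * u (Suc (Suc 0))"
      unfolding 2 by (simp add: tX_def tY_def algebra_simps power2_eq_square)
    also have "\<dots> = ?R" unfolding Otheta_sum3 relation_coeff_diag relation_coeff_offdiag Otheta_sum_square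
      by (simp add: 2 tX_def tY_def algebra_simps)
    finally show ?thesis .
  next
    case (3 j)
    let ?j = "Suc j"
    have "?L = ((?s (Suc ?j) + ?s ?j) + (?s (Suc j) + ?s j)) * u j
        + ((?t (Suc ?j) + ?t ?j) * (?s (Suc ?j) + ?s ?j) + ?p ?j + 2 * ?p (Suc ?j) + ?p (Suc (Suc ?j))
          + 2 * (?t (Suc ?j) * ?s (Suc ?j) + ?t ?j * ?s ?j)) * u ?j
        + (4 * ?t (Suc ?j) ^ 2 * ?s (Suc ?j) + ?p (Suc ?j) * (3 * ?t (Suc ?j) + ?t ?j)
          + ?p (Suc (Suc ?j)) * (3 * ?t (Suc ?j) + ?t (Suc (Suc ?j)))) * u (Suc ?j)
        + (?t (Suc (Suc ?j)) + ?t (Suc ?j)) ^ 2 * ?p (Suc (Suc ?j)) * u (Suc (Suc ?j))"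
      unfolding 3 by (simp add: tX_def tY_def algebra_simps power2_eq_square)
    also have "\<dots> = ?R" unfolding Otheta_sum3 relation_coeff_diag relation_coeff_offdiag Otheta_sum_square
      by (simp add: 3 tX_def tY_def algebra_simps)
    finally show ?thesis .
  qed
qed

text \<open>The companion relation \<open>{Z, Y}\<close> = \<open>X\<close> + constant, with
  \<open>Z\<close> eliminated in the same way.\<close>

lemma t_relation_Y:
  "tY d a b c (tY d a b c (tX d a u)) i + 2 * tY d a b c (tX d a (tY d a b c u)) i + tX d a (tY d a b c (tY d a b c u)) i
    = 2 * (2 * a * b - c * (of_nat d + 1)) * tY d a b c u i + tX d a u i
      + (2 * b * c - a * (of_nat d + 1)) * u i" (is "?L = ?R")
proof -
  let ?t = "Otheta d a" and ?s = "Otheta d b" and ?p = "Ophi d a b c"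
  let ?e = "?p (Suc i) * ?p (Suc (Suc i)) * ((?t (Suc (Suc i)) + ?t (Suc i)) + (?t (Suc i) + ?t i)) * u (Suc (Suc i))
        + ?p (Suc i) * ((?t (Suc i) + ?t i) * (?s (Suc i) + ?s i) + ?p i + 2 * ?p (Suc i) + ?p (Suc (Suc i))
          + 2 * (?t (Suc i) * ?s (Suc i) + ?t i * ?s i)) * u (Suc i)"
  show ?thesis
  proof (cases i)
    case 0
    have "?L = ?e + (4 * ?s 0 ^ 2 * ?t 0 + ?p (Suc 0) * (3 * ?s 0 + ?s (Suc 0))) * u 0"
      unfolding 0 by (simp add: tX_def tY_def algebra_simps power2_eq_square)
    also have "\<dots> = ?R" unfolding Otheta_sum3 relation_coeff_diag_0' relation_coeff_offdiag
      by (simp add: 0 tX_def tY_def algebra_simps)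
    finally show ?thesis .
  next
    case (Suc j)
    have "?L = ?e + (4 * ?s (Suc j) ^ 2 * ?t (Suc j) + ?p (Suc j) * (3 * ?s (Suc j) + ?s j)
          + ?p (Suc (Suc j)) * (3 * ?s (Suc j) + ?s (Suc (Suc j)))) * u (Suc j)
        + (?s (Suc j) + ?s j) ^ 2 * u j"
      unfolding Suc by (simp add: tX_def tY_def algebra_simps power2_eq_square)
    also have "\<dots> = ?R" unfolding Otheta_sum3 relation_coeff_diag' relation_coeff_offdiag Otheta_sum_square
      by (simp add: Suc tX_def tY_def algebra_simps)
    finally show ?thesis .
  qed
qed

lemma O_relation_X:
  assumes "even d" "\<forall>i>d. u i = 0"
  shows "OX d a (OX d a (OY d a b c u)) i + 2 * OX d a (OY d a b c (OX d a u)) i + OY d a b c (OX d a (OX d a u)) i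
    = 2 * (2 * a * b - c * (of_nat d + 1)) * OX d a u i + OY d a b c u i
      + (2 * c * a - b * (of_nat d + 1)) * u i"
proof (cases "i \<le> d")
  case True
  have "OX d a (OX d a (OY d a b c u)) i = tX d a (tX d a (tY d a b c u)) i"
    "OX d a (OY d a b c (OX d a u)) i = tX d a (tY d a b c (tX d a u)) i"
    "OY d a b c (OX d a (OX d a u)) i = tY d a b c (tX d a (tX d a u)) i"
    "OX d a u i = tX d a u i" "OY d a b c u i = tY d a b c u i"
    using True by (auto intro!: OX_cut OY_cut[OF \<open>even d\<close>])
  then show ?thesis using t_relation_X by metis
next
  case False
  then show ?thesis using assms(2) by (simp add: OX_def OY_def)
qed

lemma O_relation_Y:
  assumes "even d" "\<forall>i>d. u i = 0"
  shows "OY d a b c (OY d a b c (OX d a u)) i + 2 * OY d a b c (OX d a (OY d a b c u)) i + OX d a (OY d a b c (OY d a b c u)) i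
    = 2 * (2 * a * b - c * (of_nat d + 1)) * OY d a b c u i + OX d a u i
      + (2 * b * c - a * (of_nat d + 1)) * u i"
proof (cases "i \<le> d")
  case True
  have "OY d a b c (OY d a b c (OX d a u)) i = tY d a b c (tY d a b c (tX d a u)) i"
    "OY d a b c (OX d a (OY d a b c u)) i = tY d a b c (tX d a (tY d a b c u)) i"
    "OX d a (OY d a b c (OY d a b c u)) i = tX d a (tY d a b c (tY d a b c u)) i"
    "OX d a u i = tX d a u i" "OY d a b c u i = tY d a b c u i"
    using True by (auto intro!: OX_cut OY_cut[OF \<open>even d\<close>])
  then show ?thesis using t_relation_Y by metis
next
  case False
  then show ?thesis using assms(2) by (simp add: OX_def OY_def)
qed

section \<open>Schur's lemma and inverses of module maps\<close>

definition bimod_wf :: "'i bimod \<Rightarrow> bool" where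
  "bimod_wf M \<longleftrightarrow> csubspace (car M) \<and>
     opX M ` car M \<subseteq> car M \<and> opY M ` car M \<subseteq> car M \<and> opZ M ` car M \<subseteq> car M \<and>
     opX M (\<lambda>_. 0) = (\<lambda>_. 0) \<and> opY M (\<lambda>_. 0) = (\<lambda>_. 0) \<and> opZ M (\<lambda>_. 0) = (\<lambda>_. 0)"

lemma csubspace_zero: "csubspace U \<Longrightarrow> (\<lambda>_. 0) \<in> U"
  by (simp add: csubspace_def)

lemma csubspace_add:
  assumes "csubspace U" "u \<in> U" "v \<in> U"
  shows "(\<lambda>x. u x + v x) \<in> U"
  using bspec[OF bspec[OF assms(1)[unfolded csubspace_def, THEN conjunct2, THEN conjunct1] assms(2)] assms(3)] .

lemma csubspace_scale:
  assumes "csubspace U" "u \<in> U"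
  shows "(\<lambda>x. c * u x) \<in> U"
  using bspec[OF spec[OF assms(1)[unfolded csubspace_def, THEN conjunct2, THEN conjunct2]] assms(2)] .

text \<open>Kernel and image are submodules. Stability of the carriers is not part of
  \<open>bimod_irred\<close> and is supplied by \<open>bimod_wf\<close>.\<close>

lemma bimod_schur:
  assumes M: "bimod_irred M" "bimod_wf M" and N: "bimod_irred N" "bimod_wf N"
    and f: "clinear_on (car M) f" "intertwines M N f" "f ` car M \<subseteq> car N"
    and nz: "u0 \<in> car M" "f u0 \<noteq> (\<lambda>_. 0)"
  shows "bij_betw f (car M) (car N)"
proof -
  note wf = M(2)[unfolded bimod_wf_def]
  have sM: "csubspace (car M)" using wf by blast
  note zM = csubspace_zero[OF sM] and addM = csubspace_add[OF sM] and scaleM = csubspace_scale[OF sM]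
  have add: "f (\<lambda>x. u x + v x) = (\<lambda>y. f u y + f v y)" if "u \<in> car M" "v \<in> car M" for u v
    using f(1) that by (simp add: clinear_on_def)
  have scale: "f (\<lambda>x. c * u x) = (\<lambda>y. c * f u y)" if "u \<in> car M" for c u
    using f(1) that by (simp add: clinear_on_def)
  have int: "f (opX M u) = opX N (f u)" "f (opY M u) = opY N (f u)" "f (opZ M u) = opZ N (f u)"
    if "u \<in> car M" for u
    using f(2) that by (auto simp: intertwines_def)
  have f0: "f (\<lambda>_. 0) = (\<lambda>_. 0)" using scale[OF zM, of 0] by simp
  define k where "k = {u \<in> car M. f u = (\<lambda>_. 0)}"
  have subN: "csubspace (f ` car M)"
    unfolding csubspace_def
  proof (intro conjI ballI allI)
    show "(\<lambda>_. 0) \<in> f ` car M" by (rule image_eqI[of _ f "\<lambda>_. 0"]) (simp_all add: f0 zM)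
  next
    fix u v assume "u \<in> f ` car M" "v \<in> f ` car M"
    then obtain u' v' where uv: "u = f u'" "v = f v'" "u' \<in> car M" "v' \<in> car M" by blast
    have "(\<lambda>x. u' x + v' x) \<in> car M" by (intro addM uv)
    then show "(\<lambda>x. u x + v x) \<in> f ` car M"
      by (intro image_eqI[of _ _ "\<lambda>x. u' x + v' x"]) (simp_all add: uv add)
  next
    fix c u assume "u \<in> f ` car M"
    then obtain u' where u: "u = f u'" "u' \<in> car M" by blast
    have "(\<lambda>x. c * u' x) \<in> car M" by (intro scaleM u)
    then show "(\<lambda>x. c * u x) \<in> f ` car M"
      by (intro image_eqI[of _ _ "\<lambda>x. c * u' x"]) (simp_all add: u scale)
  qed
  have clN: "opX N ` f ` car M \<subseteq> f ` car M" "opY N ` f ` car M \<subseteq> f ` car M" "opZ N ` f ` car M \<subseteq> f ` car M"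
    using wf by (auto simp: image_subset_iff int[symmetric])
  have "f ` car M \<noteq> {\<lambda>_. 0}" using nz by blast
  then have surj: "f ` car M = car N"
    using N(1)[unfolded bimod_irred_def, THEN conjunct2, rule_format, of "f ` car M"] subN clN f(3) by blast
  have sub: "csubspace k"
    unfolding csubspace_def k_def
    by (auto simp: f0 add scale intro: zM addM scaleM)
  have "opX M ` k \<subseteq> k" "opY M ` k \<subseteq> k" "opZ M ` k \<subseteq> k"
    using wf N(2) int unfolding bimod_wf_def k_def by auto
  moreover have "k \<subseteq> car M" "k \<noteq> car M" using nz by (auto simp: k_def)
  ultimately have "k = {\<lambda>_. 0}"
    using M(1)[unfolded bimod_irred_def, THEN conjunct2, rule_format, of k] sub by blast
  moreover have "inj_on f (car M)" if k: "k = {\<lambda>_. 0}"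
  proof (rule inj_onI)
    fix u v assume uv: "u \<in> car M" "v \<in> car M" "f u = f v"
    have v': "(\<lambda>x. -1 * v x) \<in> car M" by (rule scaleM[OF uv(2)])
    have "f (\<lambda>x. u x + -1 * v x) = (\<lambda>_. 0)"
      by (subst add[OF uv(1) v'], subst scale[OF uv(2)]) (simp add: uv(3))
    moreover have "(\<lambda>x. u x + -1 * v x) \<in> car M" by (rule addM[OF uv(1) v'])
    ultimately have "(\<lambda>x. u x + -1 * v x) \<in> k" by (simp only: k_def mem_Collect_eq simp_thms)
    then have "(\<lambda>x. u x + -1 * v x) = (\<lambda>_. 0)" using k by blast
    then show "u = v" by (simp add: fun_eq_iff)
  qed
  ultimately show ?thesis using surj by (simp add: bij_betw_def)
qed

lemma bimod_iso_sym:
  assumes "bimod_iso M N" "bimod_wf M"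
  shows "bimod_iso N M"
proof -
  from assms(1) obtain f where f: "clinear_on (car M) f" "bij_betw f (car M) (car N)" "intertwines M N f"
    unfolding bimod_iso_def by blast
  note wf = assms(2)[unfolded bimod_wf_def]
  note addM = csubspace_add[OF wf[THEN conjunct1]] and scaleM = csubspace_scale[OF wf[THEN conjunct1]]
  define g where "g = inv_into (car M) f"
  have g: "bij_betw g (car N) (car M)" unfolding g_def using f(2) by (rule bij_betw_inv_into)
  have fg: "f (g v) = v" and gM: "g v \<in> car M" if "v \<in> car N" for v
    using that f(2) g by (auto simp: g_def bij_betw_inv_into_right bij_betw_apply)
  have gf: "g (f u) = u" if "u \<in> car M" for u
    using that f(2) by (simp add: g_def bij_betw_inv_into_left)
  have "clinear_on (car N) g"
    unfolding clinear_on_def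
  proof (intro conjI ballI allI)
    fix u v assume "u \<in> car N" "v \<in> car N"
    then have "f (\<lambda>x. g u x + g v x) = (\<lambda>x. u x + v x)" "(\<lambda>x. g u x + g v x) \<in> car M"
      using f(1) gM fg by (simp_all add: clinear_on_def addM)
    then show "g (\<lambda>x. u x + v x) = (\<lambda>y. g u y + g v y)" using gf[of "\<lambda>x. g u x + g v x"] by simp
  next
    fix c u assume "u \<in> car N"
    then have "f (\<lambda>x. c * g u x) = (\<lambda>x. c * u x)" "(\<lambda>x. c * g u x) \<in> car M"
      using f(1) gM fg by (simp_all add: clinear_on_def scaleM)
    then show "g (\<lambda>x. c * u x) = (\<lambda>y. c * g u y)" using gf[of "\<lambda>x. c * g u x"] by simp
  qed
  moreover have "intertwines N M g"
    unfolding intertwines_def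
  proof (intro ballI)
    fix u assume "u \<in> car N"
    then have u: "g u \<in> car M" "f (g u) = u" by (simp_all add: gM fg)
    then have "f (opX M (g u)) = opX N u" "f (opY M (g u)) = opY N u" "f (opZ M (g u)) = opZ N u"
      "opX M (g u) \<in> car M" "opY M (g u) \<in> car M" "opZ M (g u) \<in> car M"
      using f(3) wf by (auto simp: intertwines_def)
    then show "g (opX N u) = opX M (g u) \<and> g (opY N u) = opY M (g u) \<and> g (opZ N u) = opZ M (g u)"
      using gf[of "opX M (g u)"] gf[of "opY M (g u)"] gf[of "opZ M (g u)"] by simp
  qed
  ultimately show ?thesis using g unfolding bimod_iso_def by blast
qed

lemma bimod_wf_Omod: "bimod_wf (Omod d a b c)"
  by (auto simp: bimod_wf_def csubspace_def Omod_def OX_def OY_def fun_eq_iff)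

lemma bimod_wf_twist:
  assumes "bimod_wf M"
  shows "bimod_wf (bimod_twist M)"
proof -
  have neg: "(\<lambda>x. - u x) \<in> car M" if "u \<in> car M" for u
  proof -
    have "(\<lambda>x. -1 * u x) \<in> car M" using assms that by (intro csubspace_scale) (simp_all add: bimod_wf_def)
    then show ?thesis by simp
  qed
  show ?thesis using assms unfolding bimod_wf_def bimod_twist_def by (auto simp: neg image_subset_iff)
qed

section \<open>Linearity and eigenvectors of the bidiagonal operators\<close>

lemma OX_lin: "OX d a (\<lambda>x. \<alpha> * u x + \<beta> * v x) = (\<lambda>x. \<alpha> * OX d a u x + \<beta> * OX d a v x)"
  by (auto simp: OX_def fun_eq_iff algebra_simps)

lemma OY_lin: "OY d a b c (\<lambda>x. \<alpha> * u x + \<beta> * v x) = (\<lambda>x. \<alpha> * OY d a b c u x + \<beta> * OY d a b c v x)"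
  by (auto simp: OY_def fun_eq_iff algebra_simps)

lemma OX_sum: "finite I \<Longrightarrow> OX d a (\<lambda>x. \<Sum>i\<in>I. \<alpha> i * w i x) = (\<lambda>x. \<Sum>i\<in>I. \<alpha> i * OX d a (w i) x)"
  by (auto simp: OX_def fun_eq_iff sum_distrib_left sum.distrib[symmetric] algebra_simps)

lemma OY_sum: "finite I \<Longrightarrow> OY d a b c (\<lambda>x. \<Sum>i\<in>I. \<alpha> i * w i x) = (\<lambda>x. \<Sum>i\<in>I. \<alpha> i * OY d a b c (w i) x)"
  by (auto simp: OY_def fun_eq_iff sum_distrib_left sum.distrib[symmetric] algebra_simps)

lemma OX_car: "i > d \<Longrightarrow> OX d a u i = 0" and OY_car: "i > d \<Longrightarrow> OY d a b c u i = 0"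
  by (simp_all add: OX_def OY_def)

text \<open>\<open>Y\<close> is upper bidiagonal: going down from m, each row reduces to (diagonal
  entry - \<open>\<rho>\<close>) times one coordinate. Choosing m below d + 1 exploits coordinates
  already known to vanish.\<close>

lemma OY_eigenvector_eq_0:
  assumes "even d" "\<forall>i>d. u i = 0" "m \<le> Suc d" "\<And>i. m \<le> i \<Longrightarrow> u i = 0"
    and "\<And>i. i < m \<Longrightarrow> Otheta d b i \<noteq> \<rho>" "\<And>i. i < m \<Longrightarrow> OY d a b c u i = \<rho> * u i"
  shows "u = (\<lambda>_. 0)"
proof -
  have "u (m - j) = 0" for j
  proof (induction j)
    case 0
    then show ?case using assms(4) by simp
  next
    case (Suc j)
    show ?case
    proof (cases "j < m")
      case True
      then have e: "m - j = Suc (m - Suc j)" "m - Suc j < m" "m - Suc j \<le> d" using assms(3) by auto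
      have "Otheta d b (m - Suc j) * u (m - Suc j) = \<rho> * u (m - Suc j)"
        using assms(6)[OF e(2)] Suc e(1) by (simp add: OY_even[OF \<open>even d\<close> e(3)])
      then show ?thesis using assms(5)[OF e(2)] by simp
    next
      case False
      then show ?thesis using Suc by simp
    qed
  qed
  then have "u i = 0" for i
    using assms(4)[of i] by (cases "i < m") (metis diff_diff_cancel less_imp_le_nat, simp)
  then show ?thesis by blast
qed

lemma OY_top_eigenvector:
  assumes "even d" "\<And>i. i < d \<Longrightarrow> Otheta d b i \<noteq> Otheta d b d"
  obtains w where "\<forall>i>d. w i = 0" "w d = 1" "OY d a b c w = (\<lambda>i. Otheta d b d * w i)"
proof -
  \<comment> \<open>Back substitution from \<open>w d = 1\<close>: each row of the eigenvector
    equation gives the ratio of \<open>w i\<close> to \<open>w (i + 1)\<close>, and the product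
    collects these ratios.\<close>
  define w where "w i = (if i \<le> d then \<Prod>j\<in>{i..<d}. Ophi d a b c (j + 1) / (Otheta d b d - Otheta d b j) else 0)" for i
  have "OY d a b c w i = Otheta d b d * w i" for i
  proof -
    consider "i < d" | "i = d" | "i > d" by linarith
    then show ?thesis
    proof cases
      case 1
      then have "{i..<d} = insert i {Suc i..<d}" by auto
      then have "(Otheta d b d - Otheta d b i) * w i = Ophi d a b c (i + 1) * w (i + 1)"
        using 1 assms(2)[OF 1] by (simp add: w_def)
      then show ?thesis using 1 by (simp add: OY_even[OF \<open>even d\<close>] algebra_simps)
    qed (simp_all add: OY_def w_def)
  qed
  then show ?thesis by (intro that[of w]) (auto simp: w_def fun_eq_iff)
qed

lemma Otheta_reverse: "even d \<Longrightarrow> Otheta d (- a) 0 = - Otheta d a d"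
  by (simp add: Otheta_def field_simps)

text \<open>Pure algebra for \<open>OY_wseq\<close>: \<open>W2\<close>, \<open>W1\<close>,
  \<open>W0\<close>, \<open>Wm\<close> are the ladder vectors i + 2, i + 1, i, i - 1 at one point,
  \<open>R1\<close>, \<open>R2\<close>, \<open>R3\<close> the cubic words XXY, XYX, YXX applied to
  vector i, and \<open>Z\<close> the still unknown value of \<open>Y\<close> on vector i + 2. The
  vector i - 1 is described only after multiplication by \<open>p0\<close>, since at i = 0 it does
  not exist and \<open>p0\<close> is 0.\<close>

lemma ladder_step:
  fixes t0 :: complex
  assumes "R1 + 2 * R2 + R3 = 2 * \<kappa> * X0 + Y0 + \<mu> * W0"
    and "R1 = - s0 * (- X1 - t0 * X0) - p0 * A2"
    and "R2 = s1 * X1 + p1 * X0 + t0 * (s0 * X0 + p0 * A1)"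
    and "R3 = Z + t1 * Y1 - t0 * (- Y1 - t0 * Y0)"
    and "Y1 = - s1 * W1 - p1 * W0" and "Y0 = - s0 * W0 - p0 * Wm"
    and "X0 = - W1 - t0 * W0" and "X1 = - W2 - t1 * W1"
    and "p0 * A1 = p0 * (- 1 * W0 + - tm * Wm)"
    and "p0 * A2 = p0 * (W1 + (t0 + tm) * W0 + tm ^ 2 * Wm)"
  shows "- Z + (s0 + 2 * s1) * W2
      + (t1 * s0 + t0 * s0 + p0 + t1 * s1 + t0 * s1 + 2 * p1 + 2 * (t1 * s1) + 2 * (t0 * s0)) * W1
      + (4 * t0 ^ 2 * s0 + p0 * (3 * t0 + tm) + p1 * (3 * t0 + t1)) * W0
      + p0 * (t0 + tm) ^ 2 * Wm
    = 2 * \<kappa> * (W1 + t0 * W0) + s0 * W0 + p0 * Wm - \<mu> * W0"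
proof -
  have "- s0 * (- X1 - t0 * X0) - p0 * A2 + 2 * (s1 * X1 + p1 * X0 + t0 * (s0 * X0 + p0 * A1))
     + (Z + t1 * Y1 - t0 * (- Y1 - t0 * Y0)) = 2 * \<kappa> * X0 + Y0 + \<mu> * W0"
    using assms(1) unfolding assms(2-4) .
  then show ?thesis unfolding assms(9,10) assms(5-8)
    by (simp add: algebra_simps power2_eq_square)
qed

section \<open>The ladder generated by the top eigenvector of Y\<close>

context
  fixes d :: nat and a b c :: complex and w :: "nat \<Rightarrow> complex"
  assumes ev: "even d"
    and nz: "\<And>m :: int. m < int d \<Longrightarrow> 2 * b + of_int m \<noteq> 0"
    and w_car: "\<forall>i>d. w i = 0" and w_d: "w d = 1"
    and w_ev: "OY d a b c w = (\<lambda>i. Otheta d b d * w i)"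
begin

private abbreviation "t \<equiv> Otheta d (- a)"
private abbreviation "s \<equiv> Otheta d (- b)"
private abbreviation "p \<equiv> Ophi d (- a) (- b) c"

text \<open>In \<open>Omod d (- a) (- b) c\<close> the basis satisfies
  \<open>v_(i+1) = X v_i - t i * v_i\<close>. With \<open>X\<close> acting as \<open>- X\<close> in
  the twisted module, these are the only possible images of the basis under a homomorphism sending
  \<open>v_0\<close> to w.\<close>

primrec wseq :: "nat \<Rightarrow> nat \<Rightarrow> complex" where
  "wseq 0 = w"
| "wseq (Suc i) = (\<lambda>x. - OX d a (wseq i) x - t i * wseq i x)"

lemma OX_wseq: "OX d a (wseq i) = (\<lambda>x. - 1 * wseq (Suc i) x + - t i * wseq i x)"
  by (simp add: fun_eq_iff)

lemma wseq_car: "x > d \<Longrightarrow> wseq i x = 0"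
  by (induction i) (simp_all add: w_car OX_car)

lemma OY_wseq_0: "OY d a b c w = (\<lambda>x. - s 0 * w x)"
  by (simp add: w_ev Otheta_reverse[OF ev])

text \<open>By \<open>O_relation_Y\<close> the difference of both sides is mapped by a triangular operator to a
  multiple of \<open>w\<close>, and its top coordinate vanishes.\<close>

lemma OY_wseq_1: "OY d a b c (wseq 1) = (\<lambda>x. - s 1 * wseq 1 x - p 1 * w x)"
proof -
  define v where "v = OX d a w"
  define x0 where "x0 = - t 0 * (2 * s 0 + 1) - p 1"
  define q where "q = (\<lambda>x. - OY d a b c (wseq 1) x - s 1 * wseq 1 x - p 1 * w x)"
  have s1: "s 1 = - s 0 - 1" using Otheta_Suc[of d "- b" 0] by simp
  have w1: "wseq 1 = (\<lambda>x. - 1 * v x + - t 0 * w x)" by (simp add: fun_eq_iff v_def)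
  have Yw1: "OY d a b c (wseq 1) = (\<lambda>x. - 1 * OY d a b c v x + - t 0 * (- s 0 * w x))"
    by (simp only: w1 OY_lin OY_wseq_0)
  have q: "q = (\<lambda>x. 1 * (1 * OY d a b c v x + - (s 0 + 1) * v x) + x0 * w x)"
    unfolding q_def s1 Yw1 unfolding w1 by (simp add: x0_def algebra_simps)
  have Yq: "OY d a b c q = (\<lambda>x. 1 * (1 * OY d a b c (OY d a b c v) x + - (s 0 + 1) * OY d a b c v x) + x0 * (- s 0 * w x))"
    by (simp only: q OY_lin OY_wseq_0)
  \<comment> \<open>As w is an eigenvector, the relation collapses to (Y - s_0)^2 v = v + multiple
    of w. Hence Y - s_0 + 1 maps (Y - s_0 - 1) v into the line of w, and \<open>q\<close> is that
    inner vector plus \<open>x0\<close> times w.\<close>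
  have rel: "OY d a b c (OY d a b c v) x = 2 * s 0 * OY d a b c v x + (1 - (s 0)^2) * v x
      + (2 * b * c - a * (of_nat d + 1) - 2 * (2 * a * b - c * (of_nat d + 1)) * s 0) * w x" for x
  proof -
    have "OX d a (\<lambda>x. - s 0 * w x) = (\<lambda>x. - s 0 * v x)"
      "OY d a b c (\<lambda>x. - s 0 * w x) = (\<lambda>x. (s 0)^2 * w x)"
      "OX d a (\<lambda>x. (s 0)^2 * w x) = (\<lambda>x. (s 0)^2 * v x)"
      "OY d a b c (\<lambda>x. - s 0 * v x) = (\<lambda>x. - s 0 * OY d a b c v x)"
      using OX_lin[of d a "- s 0" w 0 w] OY_lin[of d a b c "- s 0" w 0 w]
        OX_lin[of d a "(s 0)^2" w 0 w] OY_lin[of d a b c "- s 0" v 0 v]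
      by (simp_all add: OY_wseq_0 v_def power2_eq_square mult.assoc)
    with O_relation_Y[OF ev w_car, of a b c x] show ?thesis
      by (simp add: OY_wseq_0 v_def[symmetric] algebra_simps)
  qed
  define y where "y = (2 * s 0 - 1) * x0
    - (2 * b * c - a * (of_nat d + 1) - 2 * (2 * a * b - c * (of_nat d + 1)) * s 0)"
  have y: "- OY d a b c q x + (s 0 - 1) * q x = y * w x" for x
    unfolding Yq rel y_def unfolding q by (simp add: algebra_simps power2_eq_square)
  have qd: "q d = 0"
  proof -
    have sd: "s 0 = - Otheta d b d" by (rule Otheta_reverse[OF ev])
    have vd: "v d = - t 0 + (if d = 0 then 0 else w (d - 1))"
      by (simp add: v_def OX_def w_d Otheta_reverse[OF ev])
    have "q d = - (2 * s 0 + 1) * v d + x0"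
      unfolding q by (simp add: OY_even[OF ev] sd Ophi_top[OF ev] w_d algebra_simps)
    also have "\<dots> = - (2 * s 0 + 1) * (if d = 0 then 0 else w (d - 1)) - p 1"
      by (simp add: vd x0_def algebra_simps)
    \<comment> \<open>Row d - 1 of the eigenvector equation for w; 2 s_0 + 1 is the difference of
      the eigenvalues of \<open>Y\<close> at d - 1 and d.\<close>
    also have "- (2 * s 0 + 1) * (if d = 0 then 0 else w (d - 1)) = Ophi d a b c d"
    proof (cases d)
      case (Suc e)
      have "Otheta d b e * w e + Ophi d a b c d * w d = Otheta d b d * w e"
        using fun_cong[OF w_ev, of e] OY_even[OF ev, of e a b c w] by (simp add: Suc)
      moreover have "Otheta d b d = 1 - Otheta d b e"
        using Otheta_Suc[of d b e] ev by (simp add: Suc)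
      ultimately show ?thesis
        using w_d by (simp add: sd Suc[symmetric]) (simp add: Suc algebra_simps)
    qed simp
    also have "Ophi d a b c d = p 1"
      using ev by (simp add: Ophi_def algebra_simps)
    finally show ?thesis by simp
  qed
  have q_car: "\<forall>i>d. q i = 0"
    by (simp add: q v_def OX_car OY_car w_car)
  have "y = 0" using y[of d] qd w_d by (simp add: OY_even[OF ev] Ophi_top[OF ev])
  have "q = (\<lambda>_. 0)"
  proof (rule OY_eigenvector_eq_0[OF ev q_car])
    show "d \<le> Suc d" by simp
    show "q i = 0" if "d \<le> i" for i using that qd q_car by (cases "i = d") auto
    show "OY d a b c q i = (s 0 - 1) * q i" if "i < d" for i
      using y[of i] \<open>y = 0\<close> by simp
    show "Otheta d b i \<noteq> s 0 - 1" if "i < d" for i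
    proof (cases "even i")
      case True
      then have "Suc i < d" using that ev by (metis Suc_lessI even_Suc)
      then have "2 * b + of_int (int i + 1) \<noteq> 0" using nz[of "int i + 1"] by simp
      moreover have "Otheta d b i - (s 0 - 1) = 2 * b + of_int (int i + 1)"
        using True by (simp add: Otheta_def field_simps)
      ultimately show ?thesis by (metis diff_self)
    next
      case False
      have "of_nat (d - i) + (1::complex) \<noteq> 0"
        by (metis Suc_eq_plus1 of_nat_Suc of_nat_neq_0 add.commute)
      moreover have "Otheta d b i - (s 0 - 1) = of_nat (d - i) + (1::complex)"
        using False that by (simp add: Otheta_def field_simps)
      ultimately show ?thesis by (metis diff_self)
    qed
  qed
  then show ?thesis by (simp add: q_def fun_eq_iff algebra_simps)
qed

text \<open>\<open>O_relation_X\<close> at \<open>wseq i\<close> contains \<open>Y\<close> of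
  \<open>wseq (i + 2)\<close> and otherwise only values known for i and i + 1. The coefficients
  agree because passing from a, b to - a, - b fixes 2ab - c(d + 1) and negates 2ca - b(d + 1), just
  as the twist demands.\<close>

lemma OY_wseq: "OY d a b c (wseq i) = (\<lambda>x. - s i * wseq i x - p i * wseq (i - 1) x)"
proof -
  have "OY d a b c (wseq i) = (\<lambda>x. - s i * wseq i x - p i * wseq (i - 1) x) \<and>
    OY d a b c (wseq (Suc i)) = (\<lambda>x. - s (Suc i) * wseq (Suc i) x - p (Suc i) * wseq i x)"
  proof (induction i)
    case 0
    then show ?case using OY_wseq_0 OY_wseq_1 by simp
  next
    case (Suc i)
    then have Y0: "OY d a b c (wseq i) = (\<lambda>x. - s i * wseq i x + - p i * wseq (i - 1) x)"
      and Y1: "OY d a b c (wseq (Suc i)) = (\<lambda>x. - s (Suc i) * wseq (Suc i) x + - p (Suc i) * wseq i x)"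
      by simp_all
    have XX: "OX d a (OX d a (wseq k)) = (\<lambda>x. - 1 * OX d a (wseq (Suc k)) x + - t k * OX d a (wseq k) x)" for k
      by (subst OX_wseq[of k], subst OX_lin) (rule refl)
    have XXY: "OX d a (OX d a (OY d a b c (wseq i))) =
        (\<lambda>x. - s i * OX d a (OX d a (wseq i)) x + - p i * OX d a (OX d a (wseq (i - 1))) x)"
      by (simp only: Y0 OX_lin)
    have YX: "OY d a b c (OX d a (wseq i)) =
        (\<lambda>x. - 1 * OY d a b c (wseq (Suc i)) x + - t i * OY d a b c (wseq i) x)"
      by (subst OX_wseq[of i], subst OY_lin) (rule refl)
    have XYX: "OX d a (OY d a b c (OX d a (wseq i))) = (\<lambda>x.
        - 1 * (- s (Suc i) * OX d a (wseq (Suc i)) x + - p (Suc i) * OX d a (wseq i) x)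
        + - t i * (- s i * OX d a (wseq i) x + - p i * OX d a (wseq (i - 1)) x))"
      unfolding YX by (simp only: OX_lin Y0 Y1)
    have YXX: "OY d a b c (OX d a (OX d a (wseq i))) = (\<lambda>x.
        - 1 * (- 1 * OY d a b c (wseq (Suc (Suc i))) x + - t (Suc i) * OY d a b c (wseq (Suc i)) x)
        + - t i * OY d a b c (OX d a (wseq i)) x)"
      unfolding XX[of i] OX_wseq[of "Suc i"] by (simp only: OY_lin)
    have "OY d a b c (wseq (Suc (Suc i))) x =
        - s (Suc (Suc i)) * wseq (Suc (Suc i)) x - p (Suc (Suc i)) * wseq (Suc i) x" for x
    proof -
      have rel: "OX d a (OX d a (OY d a b c (wseq i))) x + 2 * OX d a (OY d a b c (OX d a (wseq i))) x
           + OY d a b c (OX d a (OX d a (wseq i))) x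
        = 2 * (2 * a * b - c * (of_nat d + 1)) * OX d a (wseq i) x + OY d a b c (wseq i) x
          + (2 * c * a - b * (of_nat d + 1)) * wseq i x"
        using wseq_car by (intro O_relation_X[OF ev]) blast
      have prev1: "p i * OX d a (wseq (i - 1)) x = p i * (- 1 * wseq i x + - t (i - 1) * wseq (i - 1) x)"
        by (cases i) (simp_all add: OX_wseq del: wseq.simps(2))
      have prev2: "p i * OX d a (OX d a (wseq (i - 1))) x
        = p i * (wseq (Suc i) x + (t i + t (i - 1)) * wseq i x + (t (i - 1))^2 * wseq (i - 1) x)"
      proof (cases i)
        case (Suc j)
        have "OX d a (OX d a (wseq j)) x = - 1 * OX d a (wseq (Suc j)) x + - t j * OX d a (wseq j) x"
          by (simp only: XX)
        also have "\<dots> = wseq (Suc (Suc j)) x + (t (Suc j) + t j) * wseq (Suc j) x + (t j)^2 * wseq j x"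
          unfolding OX_wseq by (simp add: algebra_simps power2_eq_square del: wseq.simps(2))
        finally show ?thesis by (simp add: Suc del: wseq.simps(2))
      qed simp
      define Z where "Z = OY d a b c (wseq (Suc (Suc i))) x"
      have c1: "t (Suc i) * s i + t i * s i + p i + t (Suc i) * s (Suc i) + t i * s (Suc i)
          + 2 * p (Suc i) + 2 * (t (Suc i) * s (Suc i)) + 2 * (t i * s i)
          = 2 * (2 * a * b - c * (of_nat d + 1)) - p (Suc (Suc i))"
        using relation_coeff_offdiag[of d "- a" i "- b" c] by (simp add: algebra_simps)
      have c2: "4 * t i ^ 2 * s i + p i * (3 * t i + t (i - 1)) + p (Suc i) * (3 * t i + t (Suc i))
          = 2 * (2 * a * b - c * (of_nat d + 1)) * t i + s i - (2 * c * a - b * (of_nat d + 1))"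
        using relation_coeff_diag[of d "- a" _ "- b" c] relation_coeff_diag_0[of d "- a" "- b" c]
        by (cases i) simp_all
      have c3: "p i * (t i + t (i - 1)) ^ 2 = p i"
        using Otheta_sum_square[of d "- a"] by (cases i) simp_all
      have "- Z + (s i + 2 * s (Suc i)) * wseq (Suc (Suc i)) x
          + (t (Suc i) * s i + t i * s i + p i + t (Suc i) * s (Suc i) + t i * s (Suc i)
          + 2 * p (Suc i) + 2 * (t (Suc i) * s (Suc i)) + 2 * (t i * s i)) * wseq (Suc i) x
          + (4 * t i ^ 2 * s i + p i * (3 * t i + t (i - 1)) + p (Suc i) * (3 * t i + t (Suc i))) * wseq i x
          + p i * (t i + t (i - 1)) ^ 2 * wseq (i - 1) x
        = 2 * (2 * a * b - c * (of_nat d + 1)) * (wseq (Suc i) x + t i * wseq i x) + s i * wseq i x + p i * wseq (i - 1) x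
          - (2 * c * a - b * (of_nat d + 1)) * wseq i x"
      proof (rule ladder_step[where ?X0.0 = "OX d a (wseq i) x" and ?X1.0 = "OX d a (wseq (Suc i)) x"])
        show "OX d a (OX d a (OY d a b c (wseq i))) x =
            - s i * (- OX d a (wseq (Suc i)) x - t i * OX d a (wseq i) x)
            - p i * OX d a (OX d a (wseq (i - 1))) x"
          by (simp add: XXY XX[of i] del: wseq.simps(2))
        show "OX d a (OY d a b c (OX d a (wseq i))) x =
            s (Suc i) * OX d a (wseq (Suc i)) x + p (Suc i) * OX d a (wseq i) x
            + t i * (s i * OX d a (wseq i) x + p i * OX d a (wseq (i - 1)) x)"
          by (simp add: XYX algebra_simps del: wseq.simps(2))
        show "OY d a b c (OX d a (OX d a (wseq i))) x =
            Z + t (Suc i) * OY d a b c (wseq (Suc i)) x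
            - t i * (- OY d a b c (wseq (Suc i)) x - t i * OY d a b c (wseq i) x)"
          by (simp add: YXX YX Z_def algebra_simps del: wseq.simps(2))
        show "OY d a b c (wseq (Suc i)) x = - s (Suc i) * wseq (Suc i) x - p (Suc i) * wseq i x"
          "OY d a b c (wseq i) x = - s i * wseq i x - p i * wseq (i - 1) x"
          by (simp_all add: Y0 Y1 del: wseq.simps(2))
        show "OX d a (wseq i) x = - wseq (Suc i) x - t i * wseq i x"
          "OX d a (wseq (Suc i)) x = - wseq (Suc (Suc i)) x - t (Suc i) * wseq (Suc i) x"
          by (simp_all add: OX_wseq del: wseq.simps(2))
      qed (fact rel prev1 prev2)+
      moreover have "s i + 2 * s (Suc i) = - s (Suc (Suc i))"
        using Otheta_sum3[of d "- b" i] by (simp add: eq_neg_iff_add_eq_0 algebra_simps)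
      ultimately have "Z - (- s (Suc (Suc i)) * wseq (Suc (Suc i)) x - p (Suc (Suc i)) * wseq (Suc i) x) = 0"
        unfolding c1 c2 c3 by (simp add: algebra_simps del: wseq.simps(2))
      then have "Z = - s (Suc (Suc i)) * wseq (Suc (Suc i)) x - p (Suc (Suc i)) * wseq (Suc i) x"
        by (rule eq_iff_diff_eq_0[THEN iffD2])
      then show ?thesis by (simp only: Z_def)
    qed
    then have "OY d a b c (wseq (Suc (Suc i))) =
        (\<lambda>x. - s (Suc (Suc i)) * wseq (Suc (Suc i)) x - p (Suc (Suc i)) * wseq (Suc i) x)"
      by (rule ext)
    with Suc.IH show ?case by (simp only: diff_Suc_1)
  qed
  then show ?thesis by blast
qed

text \<open>As \<open>Ophi\<close> vanishes at d + 1, this vector is an eigenvector of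
  \<open>Y\<close>, for a value absent from the diagonal of \<open>Y\<close>. Hence the ladder ends
  where the basis of O does.\<close>

lemma wseq_top: "wseq (Suc d) = (\<lambda>_. 0)"
proof (rule OY_eigenvector_eq_0[OF ev])
  show "\<forall>i>d. wseq (Suc d) i = 0" using wseq_car by blast
  then show "\<And>i. Suc d \<le> i \<Longrightarrow> wseq (Suc d) i = 0" by simp
  show "Suc d \<le> Suc d" by simp
  show "OY d a b c (wseq (Suc d)) i = - s (Suc d) * wseq (Suc d) i" for i
    using fun_cong[OF OY_wseq[of "Suc d"], of i] Ophi_top[OF ev, of "- a" "- b" c]
    by (simp del: wseq.simps(2))
  show "Otheta d b i \<noteq> - s (Suc d)" if "i < Suc d" for i
  proof (cases "even i")
    case True
    have "2 * b + of_int (int i - int d - 1) \<noteq> 0" using nz[of "int i - int d - 1"] that by simp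
    moreover have "Otheta d b i - - s (Suc d) = 2 * b + of_int (int i - int d - 1)"
      using True ev by (simp add: Otheta_def field_simps)
    ultimately show ?thesis by (metis diff_self)
  next
    case False
    have "of_nat (Suc i) \<noteq> (0 :: complex)" by (rule of_nat_neq_0)
    moreover have "Otheta d b i - - s (Suc d) = - of_nat (Suc i)"
      using False ev by (simp add: Otheta_def field_simps)
    ultimately show ?thesis by (metis diff_self neg_equal_0_iff_equal)
  qed
qed

text \<open>\<open>wseq_top\<close> closes the sum for \<open>X\<close> at the upper end.
  \<open>Z\<close> follows from \<open>X\<close> and \<open>Y\<close>: in \<open>{X, Y}\<close> the
  two signs of the twist cancel, and the constant is unchanged by negating a and b.\<close>

lemma reversal_hom:
  defines "f \<equiv> (\<lambda>u x. \<Sum>i\<le>d. u i * wseq i x)"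
  shows "clinear_on (car (Omod d (- a) (- b) c)) f"
    and "intertwines (Omod d (- a) (- b) c) (bimod_twist (Omod d a b c)) f"
    and "f ` car (Omod d (- a) (- b) c) \<subseteq> car (bimod_twist (Omod d a b c))"
    and "f (unit_vec 0) = w"
proof -
  show "clinear_on (car (Omod d (- a) (- b) c)) f"
    by (auto simp: clinear_on_def f_def fun_eq_iff sum.distrib[symmetric] sum_distrib_left algebra_simps
        simp del: wseq.simps(2))
  show "f ` car (Omod d (- a) (- b) c) \<subseteq> car (bimod_twist (Omod d a b c))"
    by (auto simp: f_def bimod_twist_def wseq_car)
  have "f (unit_vec 0) x = w x" for x
  proof -
    have "f (unit_vec 0) x = (\<Sum>i\<le>d. if i = 0 then w x else 0)"
      unfolding f_def by (intro sum.cong) (auto simp: unit_vec_def)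
    then show ?thesis by (simp add: sum.delta)
  qed
  then show "f (unit_vec 0) = w" by blast
  have X: "f (OX d (- a) u) = (\<lambda>x. - OX d a (f u) x)" for u
  proof
    fix x
    have "- OX d a (f u) x = (\<Sum>i\<le>d. u i * wseq (Suc i) x) + (\<Sum>i\<le>d. t i * u i * wseq i x)"
      unfolding f_def OX_sum[OF finite_atMost] OX_wseq
      by (simp add: sum.distrib[symmetric] sum_negf[symmetric] algebra_simps del: wseq.simps(2))
    also have "(\<Sum>i\<le>d. u i * wseq (Suc i) x) = (\<Sum>i\<le>Suc d. if i = 0 then 0 else u (i - 1) * wseq i x)"
      by (subst sum.atMost_Suc_shift) (simp del: wseq.simps(2))
    also have "\<dots> = (\<Sum>i\<le>d. if i = 0 then 0 else u (i - 1) * wseq i x)"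
      by (simp add: wseq_top del: wseq.simps(2))
    also have "\<dots> + (\<Sum>i\<le>d. t i * u i * wseq i x) = f (OX d (- a) u) x"
      unfolding f_def sum.distrib[symmetric]
      by (intro sum.cong refl) (auto simp: OX_def algebra_simps simp del: wseq.simps(2))
    finally show "f (OX d (- a) u) x = - OX d a (f u) x" by simp
  qed
  have Y: "f (OY d (- a) (- b) c u) = (\<lambda>x. - OY d a b c (f u) x)" for u
  proof
    fix x
    have "- OY d a b c (f u) x = (\<Sum>i\<le>d. s i * u i * wseq i x) + (\<Sum>i\<le>d. u i * p i * wseq (i - 1) x)"
      unfolding f_def OY_sum[OF finite_atMost] OY_wseq
      by (simp add: sum.distrib[symmetric] sum_negf[symmetric] algebra_simps del: wseq.simps(2))
    also have "(\<Sum>i\<le>d. u i * p i * wseq (i - 1) x) = (\<Sum>i\<le>Suc d. u i * p i * wseq (i - 1) x)"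
      by (simp add: Ophi_top[OF ev] del: wseq.simps(2))
    also have "\<dots> = (\<Sum>i\<le>d. u (Suc i) * p (Suc i) * wseq i x)"
      by (subst sum.atMost_Suc_shift) (simp del: wseq.simps(2))
    also have "(\<Sum>i\<le>d. s i * u i * wseq i x) + \<dots> = f (OY d (- a) (- b) c u) x"
      unfolding f_def sum.distrib[symmetric]
      by (intro sum.cong refl) (simp add: OY_even[OF ev] algebra_simps del: wseq.simps(2))
    finally show "f (OY d (- a) (- b) c u) x = - OY d a b c (f u) x" by simp
  qed
  have lin: "f (\<lambda>x. u x + v x - \<alpha> * y x) = (\<lambda>x. f u x + f v x - \<alpha> * f y x)" for u v y \<alpha>
    by (auto simp: f_def fun_eq_iff sum.distrib[symmetric] sum_distrib_left sum_subtractf[symmetric]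
        algebra_simps simp del: wseq.simps(2))
  have "OX d a (\<lambda>x. - u x) = (\<lambda>x. - OX d a u x)" "OY d a b c (\<lambda>x. - u x) = (\<lambda>x. - OY d a b c u x)" for u
    using OX_lin[of d a "-1" u 0 u] OY_lin[of d a b c "-1" u 0 u] by simp_all
  then show "intertwines (Omod d (- a) (- b) c) (bimod_twist (Omod d a b c)) f"
    by (auto simp: intertwines_def X Y bimod_twist_def Omod_def lin)
qed

end

text \<open>Eigenvalues of \<open>Y\<close> at different indices of equal parity differ by a nonzero
  integer, those of opposite parity by 2b plus an integer up to sign. The condition on integers m is
  what separates the latter.\<close>

theorem Omod_reverse_iso:
  assumes "even d" "\<And>m :: int. m < int d \<Longrightarrow> 2 * b + of_int m \<noteq> 0"
    and "Oregular d a b c" "Oregular d (- a) (- b) c"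
  shows "bimod_iso (bimod_twist (Omod d a b c)) (Omod d (- a) (- b) c)"
proof -
  have ne: "Otheta d b i \<noteq> Otheta d b d" if "i < d" for i
  proof (cases "even i")
    case True
    have "of_nat (d - i) \<noteq> (0 :: complex)" using that by simp
    moreover have "Otheta d b d - Otheta d b i = of_nat (d - i)"
      using True that \<open>even d\<close> by (simp add: Otheta_def field_simps)
    ultimately show ?thesis by (metis diff_self)
  next
    case False
    have "2 * b + of_int (int i) \<noteq> 0" using assms(2)[of "int i"] that by simp
    moreover have "Otheta d b d - Otheta d b i = 2 * b + of_int (int i)"
      using False \<open>even d\<close> by (simp add: Otheta_def field_simps)
    ultimately show ?thesis by (metis diff_self)
  qed
  obtain w where w: "\<forall>i>d. w i = 0" "w d = 1" "OY d a b c w = (\<lambda>i. Otheta d b d * w i)"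
    using OY_top_eigenvector[OF \<open>even d\<close> ne] by blast
  note hom = reversal_hom[OF assms(1,2) w]
  have "w \<noteq> (\<lambda>_. 0)" using w(2) by auto
  moreover have "unit_vec 0 \<in> car (Omod d (- a) (- b) c)" by (simp add: unit_vec_def)
  ultimately have "bimod_iso (Omod d (- a) (- b) c) (bimod_twist (Omod d a b c))"
    unfolding bimod_iso_def
    using bimod_schur[OF Omod_irred[OF assms(1,4)] bimod_wf_Omod
        bimod_irred_twist[OF Omod_irred[OF assms(1,3)]] bimod_wf_twist[OF bimod_wf_Omod] hom(1-3), of "unit_vec 0"]
      hom by (intro exI conjI) auto
  then show ?thesis by (rule bimod_iso_sym[OF _ bimod_wf_Omod])
qed

section \<open>Pascal matrices and the change of basis\<close>

text \<open>With p read as the polynomial with coefficients \<open>p j\<close> for j up to h, this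
  is the coefficient of y^i after the substitution of 1 + y for y.\<close>

definition binsum :: "nat \<Rightarrow> (nat \<Rightarrow> complex) \<Rightarrow> nat \<Rightarrow> complex" where
  "binsum h p i = (\<Sum>j\<le>h. of_nat (j choose i) * p j)"

lemma binsum_add: "binsum h (\<lambda>j. p j + q j) i = binsum h p i + binsum h q i"
  and binsum_diff: "binsum h (\<lambda>j. p j - q j) i = binsum h p i - binsum h q i"
  and binsum_scale: "binsum h (\<lambda>j. x * p j) i = x * binsum h p i"
  and binsum_uminus: "binsum h (\<lambda>j. - p j) i = - binsum h p i"
  by (simp_all add: binsum_def algebra_simps sum.distrib sum_subtractf sum_distrib_left sum_negf)

lemma times_binomial: "n * (n choose k) = k * (n choose k) + Suc k * (n choose Suc k)"
proof (cases "k \<le> n")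
  case True
  have "(n - k) * (n choose k) = Suc k * (n choose Suc k)"
    by (simp only: binomial_absorb_comp binomial_absorption)
  moreover have "n * (n choose k) = k * (n choose k) + (n - k) * (n choose k)"
    using True by (simp add: add_mult_distrib[symmetric])
  ultimately show ?thesis by simp
qed (simp add: binomial_eq_0)

text \<open>Under the translation y d/dy turns into (1 + y) d/dy.\<close>

lemma binsum_mult:
  "binsum h (\<lambda>j. of_nat j * p j) i = of_nat i * binsum h p i + of_nat (Suc i) * binsum h p (Suc i)"
proof -
  have "(of_nat (j choose i) * (of_nat j * p j) :: complex) =
      of_nat i * (of_nat (j choose i) * p j) + of_nat (Suc i) * (of_nat (j choose Suc i) * p j)" for j
  proof -
    have "(of_nat (j * (j choose i)) :: complex) = of_nat (i * (j choose i) + Suc i * (j choose Suc i))"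
      by (simp only: times_binomial)
    then have "(of_nat j * of_nat (j choose i) :: complex)
        = of_nat i * of_nat (j choose i) + of_nat (Suc i) * of_nat (j choose Suc i)"
      by (simp only: of_nat_mult of_nat_add)
    then have "(of_nat j * of_nat (j choose i) * p j :: complex)
        = (of_nat i * of_nat (j choose i) + of_nat (Suc i) * of_nat (j choose Suc i)) * p j" by simp
    then show ?thesis by (simp only: ring_distribs ac_simps)
  qed
  then show ?thesis unfolding binsum_def by (simp only: sum.distrib sum_distrib_left)
qed

text \<open>Multiplication by y turns into multiplication by 1 + y; \<open>q h = 0\<close> keeps the
  degree within h.\<close>

lemma binsum_shift:
  assumes "q h = 0"
  shows "binsum h (\<lambda>j. if j = 0 then 0 else q (j - 1)) i
    = binsum h q i + (if i = 0 then 0 else binsum h q (i - 1))"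
proof -
  have "binsum h (\<lambda>j. if j = 0 then 0 else q (j - 1)) i
      = (\<Sum>j\<le>Suc h. of_nat (j choose i) * (if j = 0 then 0 else q (j - 1)))"
    using assms by (simp add: binsum_def)
  also have "\<dots> = (\<Sum>j\<le>h. of_nat (Suc j choose i) * q j)"
    by (subst sum.atMost_Suc_shift) simp
  also have "\<dots> = binsum h q i + (if i = 0 then 0 else binsum h q (i - 1))"
    by (cases i) (simp_all add: binsum_def sum.distrib[symmetric] algebra_simps)
  finally show ?thesis .
qed

text \<open>d/dy commutes with translation. The hypothesis excludes a contribution from y^(h+1),
  which the sum would not see.\<close>

lemma binsum_deriv:
  assumes "p (Suc h) = 0"
  shows "binsum h (\<lambda>j. of_nat (Suc j) * p (Suc j)) i = of_nat (Suc i) * binsum h p (Suc i)"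
proof -
  have "of_nat (Suc i) * binsum h p (Suc i) = (\<Sum>j\<le>Suc h. of_nat (Suc i) * (of_nat (j choose Suc i) * p j))"
    using assms by (simp add: binsum_def sum_distrib_left)
  also have "\<dots> = (\<Sum>j\<le>h. of_nat (Suc i) * (of_nat (Suc j choose Suc i) * p (Suc j)))"
    by (subst sum.atMost_Suc_shift) simp
  also have "\<dots> = (\<Sum>j\<le>h. of_nat (j choose i) * (of_nat (Suc j) * p (Suc j)))"
  proof (intro sum.cong refl)
    fix j
    have "(of_nat (Suc i * (Suc j choose Suc i)) :: complex) = of_nat (Suc j * (j choose i))"
      by (simp only: Suc_times_binomial)
    then have "(of_nat (Suc i) * of_nat (Suc j choose Suc i) :: complex) = of_nat (Suc j) * of_nat (j choose i)"
      by (simp only: of_nat_mult)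
    then have "of_nat (Suc i) * of_nat (Suc j choose Suc i) * p (Suc j) = of_nat (Suc j) * of_nat (j choose i) * p (Suc j)"
      by simp
    then show "of_nat (Suc i) * (of_nat (Suc j choose Suc i) * p (Suc j))
        = of_nat (j choose i) * (of_nat (Suc j) * p (Suc j))"
      by (simp only: ac_simps)
  qed
  finally show ?thesis by (simp add: binsum_def)
qed

lemma binsum_cut: "i \<le> h \<Longrightarrow> binsum h p i = p i + (\<Sum>j\<in>{i<..h}. of_nat (j choose i) * p j)"
proof -
  assume "i \<le> h"
  have "binsum h p i = (\<Sum>j\<in>{i..h}. of_nat (j choose i) * p j)"
    unfolding binsum_def by (intro sum.mono_neutral_right) (auto simp: binomial_eq_0)
  also have "{i..h} = insert i {i<..h}" using \<open>i \<le> h\<close> by auto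
  finally show ?thesis by simp
qed

lemma binsum_zero_ge: "i \<ge> h \<Longrightarrow> p h = 0 \<Longrightarrow> binsum h p i = 0"
  unfolding binsum_def
proof (intro sum.neutral ballI)
  fix j assume "i \<ge> h" "p h = 0" "j \<in> {..h}"
  then show "of_nat (j choose i) * p j = 0"
    by (cases "j = h") (simp_all add: binomial_eq_0)
qed

text \<open>The Pascal matrix is upper unitriangular, so the coefficients are recovered from the
  highest one downwards.\<close>

lemma binsum_eq_0D:
  assumes "\<And>i. i \<le> h \<Longrightarrow> binsum h p i = 0" "j \<le> h"
  shows "p j = 0"
  using assms(2)
proof (induction "h - j" arbitrary: j rule: less_induct)
  case less
  have "(\<Sum>l\<in>{j<..h}. of_nat (l choose j) * p l) = 0"
    by (intro sum.neutral ballI) (use less in auto)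
  then show ?case using binsum_cut[OF less.prems, of p] assms(1)[OF less.prems] by simp
qed

lemma binsum_surj: "\<exists>p. (\<forall>j>h. p j = 0) \<and> (\<forall>i\<le>h. binsum h p i = t i)"
proof (induction h arbitrary: t)
  case 0
  show ?case by (rule exI[of _ "\<lambda>j. if j = 0 then t 0 else 0"]) (simp add: binsum_def)
next
  case (Suc h)
  from Suc.IH[of "\<lambda>i. t i - of_nat (Suc h choose i) * t (Suc h)"] obtain p
    where p: "\<forall>j>h. p j = 0" "\<forall>i\<le>h. binsum h p i = t i - of_nat (Suc h choose i) * t (Suc h)" by blast
  define p' where "p' = p(Suc h := t (Suc h))"
  have "binsum (Suc h) p' i = binsum h p i + of_nat (Suc h choose i) * t (Suc h)" for i
    by (simp add: binsum_def p'_def)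
  moreover have "binsum h p (Suc h) = 0" using p(1)
    by (auto simp: binsum_def binomial_eq_0 intro!: sum.neutral)
  ultimately have "\<forall>i\<le>Suc h. binsum (Suc h) p' i = t i"
    using p(2) by (auto simp: le_Suc_eq)
  moreover have "\<forall>j>Suc h. p' j = 0" using p(1) by (simp add: p'_def)
  ultimately show ?case by blast
qed

definition trid :: "complex \<Rightarrow> complex \<Rightarrow> (nat \<Rightarrow> complex) \<Rightarrow> (nat \<Rightarrow> complex) \<Rightarrow> nat \<Rightarrow> complex" where
  "trid x y e w i = (if i = 0 then 0 else w (i - 1)) + (x + (-1) ^ i * y) * w i + e (i + 1) * w (i + 1)"

definition bidiag :: "complex \<Rightarrow> complex \<Rightarrow> (nat \<Rightarrow> complex) \<Rightarrow> (nat \<Rightarrow> complex) \<Rightarrow> nat \<Rightarrow> complex" where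
  "bidiag x y e w i = x * (-1) ^ i * ((y - of_nat i) * w i + e (i + 1) * w (i + 1))"

lemma index_cases:
  fixes i h :: nat
  obtains "i > 2 * h" | "i = 0" | l where "l < h" "i = 2 * Suc l" | l where "l < h" "i = Suc (2 * l)"
proof (cases "even i")
  case True
  then obtain m where "i = 2 * m" by blast
  then show ?thesis using that by (cases m; cases "m \<le> h") auto
next
  case False
  then obtain m where "i = Suc (2 * m)" using oddE by fastforce
  then show ?thesis using that by (cases "m < h") auto
qed

section \<open>The quotient: from tridiagonal coordinates to O\<close>

locale quotient_map =
  fixes h :: nat and N k1 k3 :: complex
  assumes nzN: "\<And>j. j < h \<Longrightarrow> N - 1 - 2 * of_nat j \<noteq> 0"
begin

definition D :: complex where "D = 2 * of_nat h"

definition e :: "nat \<Rightarrow> complex" where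
  "e i = (if even i then of_nat i * (N + 1 - of_nat i) else (of_nat i - 1 - D) * (N + 1 - of_nat i + 2 * k3))"

abbreviation "XX \<equiv> trid (- 1 / 2) (k3 + (D + 1) / 2) e"
abbreviation "YY \<equiv> bidiag (- 1) (N + 1 / 2 + k1 + k3) e"

text \<open>The diagonal factors for which the change of basis is a Pascal matrix, with the odd coordinates
  sheared into the even ones.\<close>

primrec g :: "nat \<Rightarrow> complex" where
  "g 0 = 1"
| "g (Suc j) = g j * (D - 2 * of_nat j) * (N - 1 - 2 * of_nat j)"

lemma D_minus_nz: "j < h \<Longrightarrow> D - 2 * of_nat j \<noteq> 0"
  unfolding D_def by (metis right_minus_eq mult_cancel_left of_nat_eq_iff less_irrefl zero_neq_numeral)

lemma g_nz: "j \<le> h \<Longrightarrow> g j \<noteq> 0"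
  by (induction j) (use nzN D_minus_nz in auto)

text \<open>The factor D - 2j is zero at j = h. Hence \<open>P\<close> and \<open>Q\<close> ignore
  all coordinates beyond 2h, the sums up to h lose nothing, and \<open>L\<close> factors through the
  quotient.\<close>

lemma g_beyond: "j > h \<Longrightarrow> g j = 0"
proof (induction j)
  case (Suc j)
  then show ?case by (cases "j = h") (simp_all add: D_def)
qed simp

definition P where "P w j = g j * w (2 * j)" for w :: "nat \<Rightarrow> complex"
definition Q where "Q w j = g j * (D - 2 * of_nat j) * w (Suc (2 * j))" for w :: "nat \<Rightarrow> complex"

lemma P_h: "P w (Suc h) = 0" and Q_h: "Q w h = 0"
  by (simp_all add: P_def Q_def g_beyond D_def)

abbreviation "BP w \<equiv> binsum h (P w)"
abbreviation "BQ w \<equiv> binsum h (Q w)"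

text \<open>In terms of the polynomials with coefficients \<open>P w j\<close> and
  \<open>Q w j\<close>, the derivative terms of \<open>X\<close> are 2y(1 - y) dQ/dy here and 2(1 -
  y) dP/dy in \<open>Q_XX\<close>. Translating y = 1 to the origin makes 1 - y into - y, so no term
  lowers the power of y any more.\<close>

lemma P_XX: "P (XX w) = (\<lambda>j. (if j = 0 then 0 else (\<lambda>j. (N - 1) * Q w j - 2 * (of_nat j * Q w j)) (j - 1))
    + ((k3 + D / 2) * P w j - ((N + 2 * k3) * Q w j - 2 * (of_nat j * Q w j))))"
proof
  fix j
  show "P (XX w) j = (if j = 0 then 0 else (\<lambda>j. (N - 1) * Q w j - 2 * (of_nat j * Q w j)) (j - 1))
    + ((k3 + D / 2) * P w j - ((N + 2 * k3) * Q w j - 2 * (of_nat j * Q w j)))"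
    by (cases j) (simp_all add: P_def Q_def trid_def e_def field_simps)
qed

lemma Q_XX: "Q (XX w) = (\<lambda>j. D * P w j - 2 * (of_nat j * P w j) - (k3 + D / 2 + 1) * Q w j
    + 2 * (of_nat (Suc j) * P w (Suc j)))"
  by (rule ext) (simp add: P_def Q_def trid_def e_def field_simps)

lemma P_YY: "P (YY w) = (\<lambda>j. 2 * (of_nat j * P w j) - (N + 1 / 2 + k1 + k3) * P w j
    + ((N + 2 * k3) * Q w j - 2 * (of_nat j * Q w j)))"
  by (rule ext) (simp add: P_def Q_def bidiag_def e_def field_simps)

lemma Q_YY: "Q (YY w) = (\<lambda>j. (N - 1 / 2 + k1 + k3) * Q w j - 2 * (of_nat j * Q w j)
    + 2 * (of_nat (Suc j) * P w (Suc j)))"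
  by (rule ext) (simp add: P_def Q_def bidiag_def e_def field_simps)

lemmas binsum_rules = binsum_add binsum_diff binsum_scale binsum_mult

lemma BP_XX: "BP (XX w) i = (if i = 0 then 0 else (N + 1 - 2 * of_nat i) * BQ w (i - 1))
    - (1 + 2 * of_nat i + 2 * k3) * BQ w i + (k3 + D / 2) * BP w i"
proof -
  have "BP (XX w) i = binsum h (\<lambda>j. if j = 0 then 0 else (\<lambda>j. (N - 1) * Q w j - 2 * (of_nat j * Q w j)) (j - 1)) i
     + ((k3 + D / 2) * BP w i - ((N + 2 * k3) * BQ w i - 2 * (of_nat i * BQ w i + of_nat (Suc i) * BQ w (Suc i))))"
    by (simp only: P_XX binsum_rules)
  also have "binsum h (\<lambda>j. if j = 0 then 0 else (\<lambda>j. (N - 1) * Q w j - 2 * (of_nat j * Q w j)) (j - 1)) i =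
      binsum h (\<lambda>j. (N - 1) * Q w j - 2 * (of_nat j * Q w j)) i
      + (if i = 0 then 0 else binsum h (\<lambda>j. (N - 1) * Q w j - 2 * (of_nat j * Q w j)) (i - 1))"
    by (rule binsum_shift) (simp add: Q_h)
  finally show ?thesis
    by (cases i) (simp_all add: binsum_rules algebra_simps)
qed

lemma BQ_XX: "BQ (XX w) i = (D - 2 * of_nat i) * BP w i - (k3 + D / 2 + 1) * BQ w i"
proof -
  have "binsum h (\<lambda>j. of_nat (Suc j) * P w (Suc j)) i = of_nat (Suc i) * BP w (Suc i)"
    by (rule binsum_deriv[of "P w", OF P_h])
  then show ?thesis by (simp only: Q_XX binsum_rules) (simp add: algebra_simps)
qed

lemma BP_YY: "BP (YY w) i = (2 * of_nat i - (N + 1 / 2 + k1 + k3)) * BP w i + 2 * of_nat (Suc i) * BP w (Suc i)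
    + (N + 2 * k3 - 2 * of_nat i) * BQ w i - 2 * of_nat (Suc i) * BQ w (Suc i)"
  by (simp only: P_YY binsum_rules) (simp add: algebra_simps)

lemma BQ_YY: "BQ (YY w) i = (N - 1 / 2 + k1 + k3 - 2 * of_nat i) * BQ w i - 2 * of_nat (Suc i) * BQ w (Suc i)
    + 2 * of_nat (Suc i) * BP w (Suc i)"
proof -
  have "binsum h (\<lambda>j. of_nat (Suc j) * P w (Suc j)) i = of_nat (Suc i) * BP w (Suc i)"
    by (rule binsum_deriv[of "P w", OF P_h])
  then show ?thesis by (simp only: Q_YY binsum_rules) (simp add: algebra_simps)
qed

text \<open>On the pair \<open>BP w i\<close>, \<open>BQ w i\<close> the operator \<open>X\<close>
  has a full 2 by 2 diagonal block with left eigenvector (1, -1); the difference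
  \<open>BP - BQ\<close> thus makes \<open>X\<close> lower bidiagonal. The denominators normalise
  its subdiagonal to 1.\<close>

definition L :: "(nat \<Rightarrow> complex) \<Rightarrow> nat \<Rightarrow> complex" where
  "L w i = (if i \<le> 2 * h then
      if even i then (BP w (i div 2) - BQ w (i div 2)) / g (i div 2)
      else BQ w (i div 2) / ((D - 2 * of_nat (i div 2)) * g (i div 2)) else 0)"

lemma L_even: "i \<le> h \<Longrightarrow> L w (2 * i) = (BP w i - BQ w i) / g i"
  and L_odd: "i < h \<Longrightarrow> L w (Suc (2 * i)) = BQ w i / ((D - 2 * of_nat i) * g i)"
  and L_beyond: "i > 2 * h \<Longrightarrow> L w i = 0"
  by (simp_all add: L_def)

lemma L_XX: "L (XX w) = OX (2 * h) k3 (L w)"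
proof
  fix i
  show "L (XX w) i = OX (2 * h) k3 (L w) i"
  proof (cases rule: index_cases[where i = i and h = h])
    case 1
    then show ?thesis by (simp add: L_beyond OX_def)
  next
    case 2
    have "L (XX w) 0 = BP (XX w) 0 - BQ (XX w) 0" "L w 0 = BP w 0 - BQ w 0"
      using L_even[of 0 "XX w"] L_even[of 0 w] by simp_all
    moreover have "BP (XX w) 0 - BQ (XX w) 0 = Otheta (2 * h) k3 0 * (BP w 0 - BQ w 0)"
      unfolding BP_XX BQ_XX by (simp add: Otheta_def D_def field_simps)
    ultimately show ?thesis by (simp add: 2 OX_def)
  next
    case (3 l)
    have nz: "D - 2 * of_nat l \<noteq> 0" "N - 1 - 2 * of_nat l \<noteq> 0" "g l \<noteq> 0"
      using 3 D_minus_nz nzN g_nz by auto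
    have "L w (2 * Suc l - 1) = BQ w l * (N - 1 - 2 * of_nat l) / g (Suc l)"
    proof -
      have cancel: "x / (y * z) = x * v / (z * y * v)" if "v \<noteq> 0" for x y z v :: complex
        using that by (simp add: mult.commute)
      have "2 * Suc l - 1 = Suc (2 * l)" by simp
      then show ?thesis unfolding g.simps using L_odd[OF 3(1), of w] cancel[OF nz(2)] by metis
    qed
    then have "OX (2 * h) k3 (L w) i = (Otheta (2 * h) k3 i * (BP w (Suc l) - BQ w (Suc l)) + BQ w l * (N - 1 - 2 * of_nat l)) / g (Suc l)"
      using 3 L_even[of "Suc l" w] by (simp add: OX_def add_divide_distrib del: g.simps)
    also have "Otheta (2 * h) k3 i * (BP w (Suc l) - BQ w (Suc l)) + BQ w l * (N - 1 - 2 * of_nat l)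
        = BP (XX w) (Suc l) - BQ (XX w) (Suc l)"
      unfolding BP_XX BQ_XX by (simp add: 3(2) Otheta_def D_def field_simps)
    finally show ?thesis using 3 L_even[of "Suc l" "XX w"] by simp
  next
    case (4 l)
    have nz: "D - 2 * of_nat l \<noteq> 0" "g l \<noteq> 0" using 4 D_minus_nz g_nz by auto
    have "L w (2 * l) = (D - 2 * of_nat l) * (BP w l - BQ w l) / ((D - 2 * of_nat l) * g l)"
      using L_even[of l w] 4 nz by simp
    then have "OX (2 * h) k3 (L w) i = (Otheta (2 * h) k3 i * BQ w l + (D - 2 * of_nat l) * (BP w l - BQ w l)) / ((D - 2 * of_nat l) * g l)"
      using 4 L_odd[OF 4(1), of w] by (simp add: OX_def add_divide_distrib)
    also have "Otheta (2 * h) k3 i * BQ w l + (D - 2 * of_nat l) * (BP w l - BQ w l) = BQ (XX w) l"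
      unfolding BQ_XX by (simp add: 4(2) Otheta_def D_def field_simps)
    finally show ?thesis using 4 L_odd[OF 4(1), of "XX w"] by simp
  qed
qed

lemma L_YY: "L (YY w) = OY (2 * h) k3 (- k1 - k3 - N - 1 / 2 + D / 2) k1 (L w)" (is "_ = OY _ _ ?b _ _")
proof
  fix i
  let ?t = "Otheta (2 * h) ?b" and ?p = "Ophi (2 * h) k3 ?b k1"
  have even: "L (YY w) (2 * l) = ?t (2 * l) * L w (2 * l) + ?p (Suc (2 * l)) * L w (Suc (2 * l))" if "l \<le> h" for l
  proof -
    have "?p (Suc (2 * l)) * L w (Suc (2 * l)) = (- (D + 1 - 2 * (2 * of_nat l + 1) - 2 * k3 - 2 * ?b + 2 * k1) / 2) * BQ w l / g l"
    proof (cases "l < h")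
      case True
      have "?p (Suc (2 * l)) = (D - 2 * of_nat l) * (- (D + 1 - 2 * (2 * of_nat l + 1) - 2 * k3 - 2 * ?b + 2 * k1) / 2)"
        by (simp add: Ophi_def D_def field_simps)
      moreover have "x * r * (y / (x * z)) = r * y / z" if "x \<noteq> 0" for x r y z :: complex
        using that by simp
      ultimately show ?thesis
        unfolding L_odd[OF True, of w] using D_minus_nz[OF True] by metis
    next
      case False
      \<comment> \<open>Here l = h: there is no odd partner of the last even coordinate, and both
        sides are 0.\<close>
      then have "BQ w l = 0" using Q_h by (intro binsum_zero_ge) auto
      moreover have "L w (Suc (2 * l)) = 0" using False by (intro L_beyond) simp
      ultimately show ?thesis by simp
    qed
    then have "?t (2 * l) * L w (2 * l) + ?p (Suc (2 * l)) * L w (Suc (2 * l)) =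
        (?t (2 * l) * (BP w l - BQ w l)
         + (- (D + 1 - 2 * (2 * of_nat l + 1) - 2 * k3 - 2 * ?b + 2 * k1) / 2) * BQ w l) / g l"
      using L_even[OF that, of w] by (simp add: add_divide_distrib)
    also have "?t (2 * l) * (BP w l - BQ w l)
         + (- (D + 1 - 2 * (2 * of_nat l + 1) - 2 * k3 - 2 * ?b + 2 * k1) / 2) * BQ w l
        = BP (YY w) l - BQ (YY w) l"
      unfolding BP_YY BQ_YY by (simp add: Otheta_def D_def field_simps)
    finally show ?thesis using L_even[OF that, of "YY w"] by simp
  qed
  show "L (YY w) i = OY (2 * h) k3 ?b k1 (L w) i"
  proof (cases rule: index_cases[where i = i and h = h])
    case 1
    then show ?thesis by (simp add: L_beyond OY_def)
  next
    case 2
    then show ?thesis using even[of 0] by (simp add: OY_even)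
  next
    case (3 l)
    then show ?thesis using even[of "Suc l"] by (simp add: OY_even del: mult_Suc_right)
  next
    case (4 l)
    have nz: "D - 2 * of_nat l \<noteq> 0" "N - 1 - 2 * of_nat l \<noteq> 0" "g l \<noteq> 0"
      using 4 D_minus_nz nzN g_nz by auto
    have "?p (Suc i) = 2 * of_nat (Suc l) * (N - 1 - 2 * of_nat l)"
      by (simp add: 4(2) Ophi_def D_def field_simps)
    moreover have "L w (Suc i) = (BP w (Suc l) - BQ w (Suc l)) / (g l * (D - 2 * of_nat l) * (N - 1 - 2 * of_nat l))"
      using L_even[of "Suc l" w] 4 by simp
    moreover have "x * v * (y / (z * r * v)) = x * y / (r * z)" if "v \<noteq> 0" for x y z r v :: complex
      using that by (simp add: mult.commute)
    ultimately have "?p (Suc i) * L w (Suc i) = 2 * of_nat (Suc l) * (BP w (Suc l) - BQ w (Suc l)) / ((D - 2 * of_nat l) * g l)"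
      using nz(2) by metis
    then have "OY (2 * h) k3 ?b k1 (L w) i =
        (?t i * BQ w l + 2 * of_nat (Suc l) * (BP w (Suc l) - BQ w (Suc l))) / ((D - 2 * of_nat l) * g l)"
      using 4 L_odd[OF 4(1), of w] by (simp add: OY_even add_divide_distrib)
    also have "?t i * BQ w l + 2 * of_nat (Suc l) * (BP w (Suc l) - BQ w (Suc l)) = BQ (YY w) l"
      unfolding BQ_YY by (simp add: 4(2) Otheta_def D_def field_simps)
    finally show ?thesis using 4 L_odd[OF 4(1), of "YY w"] by simp
  qed
qed

lemma L_lin: "L (\<lambda>x. \<alpha> * u x + \<beta> * v x) = (\<lambda>x. \<alpha> * L u x + \<beta> * L v x)"
proof -
  have "P (\<lambda>x. \<alpha> * u x + \<beta> * v x) = (\<lambda>j. \<alpha> * P u j + \<beta> * P v j)"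
    "Q (\<lambda>x. \<alpha> * u x + \<beta> * v x) = (\<lambda>j. \<alpha> * Q u j + \<beta> * Q v j)"
    by (rule ext, simp add: P_def Q_def algebra_simps)+
  then have "BP (\<lambda>x. \<alpha> * u x + \<beta> * v x) i = \<alpha> * BP u i + \<beta> * BP v i"
    "BQ (\<lambda>x. \<alpha> * u x + \<beta> * v x) i = \<alpha> * BQ u i + \<beta> * BQ v i" for i
    by (simp_all only: binsum_rules)
  then show ?thesis
    by (auto simp: L_def fun_eq_iff add_divide_distrib diff_divide_distrib algebra_simps)
qed

text \<open>\<open>Q\<close> is recovered before \<open>P\<close>, because the shear leaves the odd
  coordinates of \<open>L\<close> free of \<open>P\<close>. This determines the kernel of the map
  out of \<open>Mmod\<close>.\<close>

lemma L_eq_0_iff: "L w = (\<lambda>_. 0) \<longleftrightarrow> (\<forall>i\<le>2 * h. w i = 0)"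
proof
  assume L0: "L w = (\<lambda>_. 0)"
  have Q0: "Q w j = 0" if "j \<le> h" for j
  proof (rule binsum_eq_0D[OF _ that])
    fix i assume "i \<le> h"
    show "BQ w i = 0"
    proof (cases "i < h")
      case True
      then show ?thesis
        using L_odd[OF True, of w] D_minus_nz[OF True] g_nz[of i] fun_cong[OF L0, of "Suc (2 * i)"] by simp
    next
      case False
      then show ?thesis using Q_h by (intro binsum_zero_ge) auto
    qed
  qed
  have P0: "P w j = 0" if "j \<le> h" for j
  proof (rule binsum_eq_0D[OF _ that])
    fix i assume "i \<le> h"
    moreover have "BQ w i = 0" unfolding binsum_def using Q0 by (intro sum.neutral) auto
    ultimately show "BP w i = 0"
      using L_even[of i w] g_nz[of i] fun_cong[OF L0, of "2 * i"] by simp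
  qed
  show "\<forall>i\<le>2 * h. w i = 0"
  proof (intro allI impI)
    fix i assume "i \<le> 2 * h"
    then show "w i = 0"
    proof (cases rule: index_cases[where i = i and h = h])
      case 2
      then show ?thesis using P0[of 0] by (simp add: P_def)
    next
      case (3 l)
      then show ?thesis using P0[of "Suc l"] g_nz[of "Suc l"] by (simp add: P_def del: g.simps)
    next
      case (4 l)
      then show ?thesis using Q0[of l] g_nz[of l] D_minus_nz[of l] by (simp add: Q_def)
    qed simp
  qed
next
  assume "\<forall>i\<le>2 * h. w i = 0"
  then have "P w j = 0 \<and> Q w j = 0" if "j \<le> h" for j
    using that by (cases "j = h") (auto simp: P_def Q_def D_def)
  then have "BP w i = 0" "BQ w i = 0" for i
    by (auto simp: binsum_def intro!: sum.neutral)
  then show "L w = (\<lambda>_. 0)" by (simp add: L_def fun_eq_iff)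
qed

lemma L_surj:
  assumes "\<forall>i>2 * h. u i = 0"
  shows "\<exists>w. (\<forall>i>2 * h. w i = 0) \<and> L w = u"
proof -
  obtain q where q: "\<forall>j>h. q j = 0"
      "\<forall>i\<le>h. binsum h q i = (if i < h then u (Suc (2 * i)) * ((D - 2 * of_nat i) * g i) else 0)"
    using binsum_surj[of h "\<lambda>i. if i < h then u (Suc (2 * i)) * ((D - 2 * of_nat i) * g i) else 0"] by metis
  obtain p where p: "\<forall>j>h. p j = 0" "\<forall>i\<le>h. binsum h p i = u (2 * i) * g i + binsum h q i"
    using binsum_surj[of h "\<lambda>i. u (2 * i) * g i + binsum h q i"] by metis
  \<comment> \<open>\<open>Q\<close> has no coordinate at h, so the target there was set to 0;
    unitriangularity transfers this to q.\<close>
  have qh: "q h = 0" using q(2)[rule_format, of h] by (simp add: binsum_cut)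
  define w where "w i = (if even i then p (i div 2) / g (i div 2)
      else q (i div 2) / (g (i div 2) * (D - 2 * of_nat (i div 2))))" for i
  have "P w j = p j" for j
    using p(1) g_nz[of j] by (cases "j \<le> h") (simp_all add: P_def w_def)
  moreover have "Q w j = q j" for j
    using q(1) qh g_nz[of j] D_minus_nz[of j] by (cases "j < h"; cases "j = h") (simp_all add: Q_def w_def)
  ultimately have PQ: "P w = p" "Q w = q" by auto
  have "L w i = u i" for i
  proof (cases rule: index_cases[where i = i and h = h])
    case 1
    then show ?thesis using assms by (simp add: L_beyond)
  next
    case 2
    then show ?thesis using L_even[of 0 w] p(2) by (simp add: PQ)
  next
    case (3 l)
    then show ?thesis using L_even[of "Suc l" w] p(2) g_nz[of "Suc l"] by (simp add: PQ del: g.simps)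
  next
    case (4 l)
    then show ?thesis using L_odd[of l w] q(2) g_nz[of l] D_minus_nz[of l] by (simp add: PQ)
  qed
  moreover have "w i = 0" if "i > 2 * h" for i
  proof -
    have "i div 2 \<ge> h" "even i \<Longrightarrow> i div 2 > h" using that by presburger+
    then show ?thesis using p(1) q(1) qh by (cases "i div 2 = h") (auto simp: w_def)
  qed
  ultimately show ?thesis by (intro exI[of _ w] conjI ext) simp_all
qed

end

section \<open>The submodule: from tridiagonal coordinates to the twisted O\<close>

locale submodule_map =
  fixes h :: nat and T k1 k3 :: complex
  assumes nzT: "\<And>j. j < h \<Longrightarrow> T + 1 + 2 * of_nat j \<noteq> 0"
begin

definition D :: complex where "D = 2 * of_nat h"

definition e :: "nat \<Rightarrow> complex" where
  "e i = (if even i then of_nat i * (D + 1 - of_nat i + 2 * k3) else (T + of_nat i) * (D + 1 - of_nat i))"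

abbreviation "XX \<equiv> trid (- 1 / 2) (- k3 - T / 2) e"
abbreviation "YY \<equiv> bidiag 1 (D + 1 / 2 + k1 + k3) e"

text \<open>The value at j + 1 is the product of the entries of \<open>e\<close> at the odd indices
  up to 2j + 1.\<close>

primrec g :: "nat \<Rightarrow> complex" where
  "g 0 = 1"
| "g (Suc j) = g j * ((D - 2 * of_nat j) * (T + 1 + 2 * of_nat j))"

lemma D_minus_nz: "j < h \<Longrightarrow> D - 2 * of_nat j \<noteq> 0"
  unfolding D_def by (metis right_minus_eq mult_cancel_left of_nat_eq_iff less_irrefl zero_neq_numeral)

lemma g_nz: "j \<le> h \<Longrightarrow> g j \<noteq> 0"
  by (induction j) (use nzT D_minus_nz in auto)

lemma g_beyond: "j > h \<Longrightarrow> g j = 0"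
proof (induction j)
  case (Suc j)
  then show ?case by (cases "j = h") (simp_all add: D_def)
qed simp

text \<open>The sign amounts to replacing y by - y. It moves the distinguished point from y = -1 to
  y = 1, so that the same Pascal transform applies as for the quotient.\<close>

definition P where "P w j = (-1) ^ j * (g j * w (2 * j))" for w :: "nat \<Rightarrow> complex"
definition Q where "Q w j = (-1) ^ j * (g (Suc j) * w (Suc (2 * j)))" for w :: "nat \<Rightarrow> complex"

lemma P_h: "P w (Suc h) = 0" and Q_h: "Q w h = 0"
  by (simp_all add: P_def Q_def g_beyond del: g.simps)

abbreviation "BP w \<equiv> binsum h (P w)"
abbreviation "BQ w \<equiv> binsum h (Q w)"

lemma P_XX: "P (XX w) = (\<lambda>j. (if j = 0 then 0 else (\<lambda>j. - Q w j) (j - 1)) + (Q w j - (1 / 2 + k3 + T / 2) * P w j))"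
proof
  fix j
  show "P (XX w) j = (if j = 0 then 0 else (\<lambda>j. - Q w j) (j - 1)) + (Q w j - (1 / 2 + k3 + T / 2) * P w j)"
    by (cases j) (simp_all add: P_def Q_def trid_def e_def field_simps)
qed

text \<open>Both linear factors of \<open>e\<close> at odd indices are absorbed into
  \<open>Q\<close>, so \<open>X\<close> and \<open>Y\<close> send \<open>P\<close> to
  \<open>Q\<close> by operators of second order.\<close>

lemma Q_XX: "Q (XX w) = (\<lambda>j. D * (T + 1) * P w j + 2 * (D - T - 1) * (of_nat j * P w j) - 4 * (of_nat j * (of_nat j * P w j))
    + (k3 + T / 2 - 1 / 2) * Q w j
    - (2 * (D + 1 + 2 * k3) * (of_nat (Suc j) * P w (Suc j)) - 4 * (of_nat (Suc j) * (of_nat (Suc j) * P w (Suc j)))))"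
  by (rule ext) (simp add: P_def Q_def trid_def e_def field_simps)

lemma P_YY: "P (YY w) = (\<lambda>j. (D + 1 / 2 + k1 + k3) * P w j - 2 * (of_nat j * P w j) + Q w j)"
  by (rule ext) (simp add: P_def Q_def bidiag_def e_def field_simps)

lemma Q_YY: "Q (YY w) = (\<lambda>j. 2 * (of_nat j * Q w j) - (D - 1 / 2 + k1 + k3) * Q w j
    + (2 * (D + 1 + 2 * k3) * (of_nat (Suc j) * P w (Suc j)) - 4 * (of_nat (Suc j) * (of_nat (Suc j) * P w (Suc j)))))"
  by (rule ext) (simp add: P_def Q_def bidiag_def e_def field_simps)

lemmas binsum_rules = binsum_add binsum_diff binsum_scale binsum_mult

lemma BP_deriv: "binsum h (\<lambda>j. of_nat (Suc j) * P w (Suc j)) i = of_nat (Suc i) * BP w (Suc i)"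
    "binsum h (\<lambda>j. of_nat (Suc j) * (of_nat (Suc j) * P w (Suc j))) i
      = of_nat (Suc i) * binsum h (\<lambda>j. of_nat j * P w j) (Suc i)"
  by (rule binsum_deriv[of "P w", OF P_h], rule binsum_deriv[of "\<lambda>j. of_nat j * P w j"]) (simp add: P_h)

lemma BP_XX: "BP (XX w) i = - (1 / 2 + k3 + T / 2) * BP w i - (if i = 0 then 0 else BQ w (i - 1))"
proof -
  have "BP (XX w) i = binsum h (\<lambda>j. if j = 0 then 0 else (\<lambda>j. - Q w j) (j - 1)) i
     + (BQ w i - (1 / 2 + k3 + T / 2) * BP w i)"
    by (simp only: P_XX binsum_rules)
  also have "binsum h (\<lambda>j. if j = 0 then 0 else (\<lambda>j. - Q w j) (j - 1)) i =
      binsum h (\<lambda>j. - Q w j) i + (if i = 0 then 0 else binsum h (\<lambda>j. - Q w j) (i - 1))"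
    by (rule binsum_shift) (simp add: Q_h)
  finally have "BP (XX w) i = binsum h (\<lambda>j. - Q w j) i + (if i = 0 then 0 else binsum h (\<lambda>j. - Q w j) (i - 1))
     + (BQ w i - (1 / 2 + k3 + T / 2) * BP w i)" .
  then show ?thesis
    by (simp only: binsum_uminus) (simp add: algebra_simps)
qed

lemma BQ_XX: "BQ (XX w) i = (D - 2 * of_nat i) * (T + 1 + 2 * of_nat i) * BP w i
    - of_nat (Suc i) * (4 * of_nat (Suc i) + 2 * T + 4 * k3) * BP w (Suc i)
    + (k3 + T / 2 - 1 / 2) * BQ w i"
  by (simp only: Q_XX binsum_rules BP_deriv) (simp add: field_simps)

lemma BP_YY: "BP (YY w) i = (D + 1 / 2 + k1 + k3 - 2 * of_nat i) * BP w i - 2 * of_nat (Suc i) * BP w (Suc i) + BQ w i"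
  by (simp only: P_YY binsum_rules) (simp add: algebra_simps)

lemma BQ_YY: "BQ (YY w) i = (2 * of_nat i - (D - 1 / 2 + k1 + k3)) * BQ w i + 2 * of_nat (Suc i) * BQ w (Suc i)
    + 2 * of_nat (Suc i) * (D + 1 + 2 * k3 - 2 * of_nat (Suc i)) * BP w (Suc i)
    - 4 * of_nat (Suc i) * of_nat (Suc (Suc i)) * BP w (Suc (Suc i))"
  by (simp only: Q_YY binsum_rules BP_deriv) (simp add: algebra_simps)

text \<open>The coefficient of Q - 2 dP/dy after translation. In the order \<open>BP w 0\<close>,
  \<open>V w 0\<close>, \<open>BP w 1\<close>, \<open>V w 1\<close> and so on, \<open>X\<close> is
  lower and \<open>Y\<close> upper bidiagonal.\<close>

definition V where "V w i = BQ w i - 2 * of_nat (Suc i) * BP w (Suc i)" for w i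

text \<open>The signs and the minus before \<open>V\<close> are chosen so that \<open>- X\<close>,
  not \<open>X\<close>, gets subdiagonal entries 1; this is where the twist enters.\<close>

definition L :: "(nat \<Rightarrow> complex) \<Rightarrow> nat \<Rightarrow> complex" where
  "L w i = (if i \<le> 2 * h then (-1) ^ (i div 2) *
      (if even i then BP w (i div 2) / g (i div 2) else - V w (i div 2) / g (Suc (i div 2))) else 0)"

lemma L_even: "i \<le> h \<Longrightarrow> L w (2 * i) = (-1) ^ i * (BP w i / g i)"
  and L_odd: "i < h \<Longrightarrow> L w (Suc (2 * i)) = (-1) ^ i * (- V w i / g (Suc i))"
  and L_beyond: "i > 2 * h \<Longrightarrow> L w i = 0"
  by (simp_all add: L_def del: g.simps)

lemma V_h: "V w h = 0"
proof -
  have "BQ w h = 0" "BP w (Suc h) = 0"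
    using binsum_zero_ge[of h h "Q w"] binsum_zero_ge[of h "Suc h" "P w"] Q_h
    by (simp_all add: binsum_def binomial_eq_0)
  then show ?thesis by (simp add: V_def)
qed

lemma V_XX: "V (XX w) i = (k3 + (T + 1) / 2 + 2 * of_nat i + 1) * V w i
    + (D - 2 * of_nat i) * (T + 1 + 2 * of_nat i) * BP w i"
  unfolding V_def BQ_XX BP_XX by (simp add: field_simps)

lemma V_YY: "V (YY w) i = (2 * of_nat i - (D - 1 / 2 + k1 + k3)) * V w i
    - 2 * of_nat (Suc i) * (D + 1 + 2 * k1 - 2 * of_nat (Suc i)) * BP w (Suc i)"
  unfolding V_def BQ_YY BP_YY by (simp add: field_simps)

lemma BP_YY': "BP (YY w) i = (D + 1 / 2 + k1 + k3 - 2 * of_nat i) * BP w i + V w i"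
  unfolding V_def BP_YY by (simp add: algebra_simps)

context
  fixes a b c :: complex
  assumes a: "a = k3 + (D + T + 1) / 2" and b: "b = - k1 - k3 - (D + 1) / 2" and c: "c = - k1 - (D + T + 1) / 2"
begin

lemma L_XX: "L (XX w) = (\<lambda>i. - OX (2 * h) a (L w) i)"
proof
  fix i
  let ?t = "Otheta (2 * h) a"
  have t0: "?t (2 * l) = k3 + (T + 1) / 2 + 2 * of_nat l" for l
    by (simp add: Otheta_def D_def a field_simps)
  have t1: "?t (Suc (2 * l)) = - (k3 + (T + 1) / 2 + 2 * of_nat l + 1)" for l
    by (simp add: Otheta_def D_def a field_simps)
  show "L (XX w) i = - OX (2 * h) a (L w) i"
  proof (cases rule: index_cases[where i = i and h = h])
    case 1
    then show ?thesis by (simp add: L_beyond OX_def)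
  next
    case 2
    have "L (XX w) 0 = BP (XX w) 0" "L w 0 = BP w 0"
      using L_even[of 0 "XX w"] L_even[of 0 w] by simp_all
    moreover have "BP (XX w) 0 = - ?t (2 * 0) * BP w 0"
      unfolding BP_XX t0 by (simp add: field_simps)
    ultimately show ?thesis by (simp add: 2 OX_def)
  next
    case (3 l)
    have "L w (2 * Suc l - 1) = (-1) ^ Suc l * (V w l / g (Suc l))"
      using L_odd[OF 3(1), of w] by (simp del: g.simps)
    then have "- OX (2 * h) a (L w) i = (-1) ^ Suc l * ((- ?t i * BP w (Suc l) - V w l) / g (Suc l))"
      using 3 L_even[of "Suc l" w] by (simp add: OX_def diff_divide_distrib algebra_simps del: g.simps)
    also have "- ?t i * BP w (Suc l) - V w l = BP (XX w) (Suc l)"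
      unfolding BP_XX 3(2) t0 V_def by (simp add: field_simps)
    finally show ?thesis using 3 L_even[of "Suc l" "XX w"] by simp
  next
    case (4 l)
    have nz: "(D - 2 * of_nat l) * (T + 1 + 2 * of_nat l) \<noteq> 0" "g l \<noteq> 0"
      using 4 D_minus_nz nzT g_nz by auto
    have "L w (2 * l) = (-1) ^ l * ((D - 2 * of_nat l) * (T + 1 + 2 * of_nat l) * BP w l / g (Suc l))"
      using L_even[of l w] 4 nz by simp
    then have "- OX (2 * h) a (L w) i = (-1) ^ l * (- (- ?t i * V w l + (D - 2 * of_nat l) * (T + 1 + 2 * of_nat l) * BP w l) / g (Suc l))"
      using 4 L_odd[OF 4(1), of w] by (simp add: OX_def add_divide_distrib diff_divide_distrib algebra_simps del: g.simps)
    also have "- ?t i * V w l + (D - 2 * of_nat l) * (T + 1 + 2 * of_nat l) * BP w l = V (XX w) l"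
      unfolding V_XX 4(2) t1 by simp
    finally show ?thesis using 4 L_odd[OF 4(1), of "XX w"] by simp
  qed
qed

lemma L_YY: "L (YY w) = (\<lambda>i. - OY (2 * h) a b c (L w) i)"
proof
  fix i
  let ?t = "Otheta (2 * h) b" and ?p = "Ophi (2 * h) a b c"
  have t0: "?t (2 * l) = - (D + 1 / 2 + k1 + k3 - 2 * of_nat l)" for l
    by (simp add: Otheta_def D_def b field_simps)
  have t1: "?t (Suc (2 * l)) = - (2 * of_nat l - (D - 1 / 2 + k1 + k3))" for l
    by (simp add: Otheta_def D_def b field_simps)
  have p1: "?p (Suc (2 * l)) = (D - 2 * of_nat l) * (T + 1 + 2 * of_nat l)" for l
    by (simp add: Ophi_def D_def a b c field_simps)
  have even: "L (YY w) (2 * l) = - (?t (2 * l) * L w (2 * l) + ?p (Suc (2 * l)) * L w (Suc (2 * l)))" if "l \<le> h" for l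
  proof -
    have "?p (Suc (2 * l)) * L w (Suc (2 * l)) = - ((-1) ^ l * (V w l / g l))"
    proof (cases "l < h")
      case True
      have "x * (s * (- y / (z * x))) = - (s * (y / z))" if "x \<noteq> 0" for x y z s :: complex
        using that by simp
      moreover have "(D - 2 * of_nat l) * (T + 1 + 2 * of_nat l) \<noteq> 0"
        using True D_minus_nz nzT by auto
      ultimately show ?thesis unfolding p1 L_odd[OF True] g.simps by metis
    next
      case False
      moreover have "L w (Suc (2 * l)) = 0" using False by (intro L_beyond) simp
      moreover have "V w l = 0" using False that V_h by simp
      ultimately show ?thesis by simp
    qed
    then have "- (?t (2 * l) * L w (2 * l) + ?p (Suc (2 * l)) * L w (Suc (2 * l))) =
        (-1) ^ l * ((- ?t (2 * l) * BP w l + V w l) / g l)"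
      using L_even[OF that, of w] by (simp add: diff_divide_distrib right_diff_distrib mult.left_commute)
    also have "- ?t (2 * l) * BP w l + V w l = BP (YY w) l"
      unfolding BP_YY' t0 by simp
    finally show ?thesis using L_even[OF that, of "YY w"] by simp
  qed
  show "L (YY w) i = - OY (2 * h) a b c (L w) i"
  proof (cases rule: index_cases[where i = i and h = h])
    case 1
    then show ?thesis by (simp add: L_beyond OY_def)
  next
    case 2
    then show ?thesis using even[of 0] by (simp add: OY_even)
  next
    case (3 l)
    then show ?thesis using even[of "Suc l"] by (simp add: OY_even del: mult_Suc_right)
  next
    case (4 l)
    have p2: "?p (Suc i) = 2 * of_nat (Suc l) * (D + 1 + 2 * k1 - 2 * of_nat (Suc l))"
      by (simp add: 4(2) Ophi_def D_def a b c field_simps)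
    have L2: "L w (Suc i) = - ((-1) ^ l * (BP w (Suc l) / g (Suc l)))"
      using L_even[of "Suc l" w] 4 by (simp del: g.simps)
    have "- OY (2 * h) a b c (L w) i =
        (-1) ^ l * (- (- ?t i * V w l - ?p (Suc i) * BP w (Suc l)) / g (Suc l))"
      using 4 L_odd[OF 4(1), of w] L2
      by (simp add: OY_even add_divide_distrib diff_divide_distrib algebra_simps del: g.simps)
    also have "- ?t i * V w l - ?p (Suc i) * BP w (Suc l) = V (YY w) l"
      unfolding V_YY p2 unfolding 4(2) t1 by simp
    finally show ?thesis using 4 L_odd[OF 4(1), of "YY w"] by simp
  qed
qed

end

lemma L_lin: "L (\<lambda>x. \<alpha> * u x + \<beta> * v x) = (\<lambda>x. \<alpha> * L u x + \<beta> * L v x)"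
proof -
  have "P (\<lambda>x. \<alpha> * u x + \<beta> * v x) = (\<lambda>j. \<alpha> * P u j + \<beta> * P v j)"
    "Q (\<lambda>x. \<alpha> * u x + \<beta> * v x) = (\<lambda>j. \<alpha> * Q u j + \<beta> * Q v j)"
    by (rule ext, simp add: P_def Q_def algebra_simps del: g.simps)+
  then have "BP (\<lambda>x. \<alpha> * u x + \<beta> * v x) i = \<alpha> * BP u i + \<beta> * BP v i"
    "BQ (\<lambda>x. \<alpha> * u x + \<beta> * v x) i = \<alpha> * BQ u i + \<beta> * BQ v i" for i
    by (simp_all only: binsum_rules)
  then show ?thesis
    by (auto simp: L_def V_def fun_eq_iff add_divide_distrib diff_divide_distrib algebra_simps simp del: g.simps)
qed

lemma L_eq_0_iff: "L w = (\<lambda>_. 0) \<longleftrightarrow> (\<forall>i\<le>2 * h. w i = 0)"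
proof
  assume L0: "L w = (\<lambda>_. 0)"
  have BP0: "BP w i = 0" if "i \<le> h" for i
    using L_even[OF that, of w] g_nz[OF that] fun_cong[OF L0, of "2 * i"] by simp
  then have P0: "P w j = 0" if "j \<le> h" for j
    using binsum_eq_0D that by blast
  have Q0: "Q w j = 0" if "j \<le> h" for j
  proof (rule binsum_eq_0D[OF _ that])
    fix i assume "i \<le> h"
    show "BQ w i = 0"
    proof (cases "i < h")
      case True
      then have "V w i = 0"
        using L_odd[OF True, of w] g_nz[of "Suc i"] fun_cong[OF L0, of "Suc (2 * i)"] by (simp del: g.simps)
      then show ?thesis using BP0[of "Suc i"] True by (simp add: V_def)
    next
      case False
      then show ?thesis using Q_h by (intro binsum_zero_ge) auto
    qed
  qed
  show "\<forall>i\<le>2 * h. w i = 0"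
  proof (intro allI impI)
    fix i assume "i \<le> 2 * h"
    then show "w i = 0"
    proof (cases rule: index_cases[where i = i and h = h])
      case 2
      then show ?thesis using P0[of 0] by (simp add: P_def)
    next
      case (3 l)
      then show ?thesis using P0[of "Suc l"] g_nz[of "Suc l"] by (simp add: P_def del: g.simps)
    next
      case (4 l)
      then show ?thesis using Q0[of l] g_nz[of "Suc l"] by (simp add: Q_def del: g.simps)
    qed simp
  qed
next
  assume "\<forall>i\<le>2 * h. w i = 0"
  then have "P w j = 0 \<and> Q w j = 0" if "j \<le> h" for j
    using that Q_h[of w] by (cases "j = h") (auto simp: P_def Q_def simp del: g.simps)
  then have "BP w i = 0" "BQ w i = 0" for i
    by (auto simp: binsum_def intro!: sum.neutral)
  then show "L w = (\<lambda>_. 0)" by (simp add: L_def V_def fun_eq_iff)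
qed

lemma L_surj:
  assumes "\<forall>i>2 * h. u i = 0"
  shows "\<exists>w. (\<forall>i>2 * h. w i = 0) \<and> L w = u"
proof -
  obtain p where p: "\<forall>j>h. p j = 0" "\<forall>i\<le>h. binsum h p i = (-1) ^ i * (u (2 * i) * g i)"
    using binsum_surj[of h "\<lambda>i. (-1) ^ i * (u (2 * i) * g i)"] by metis
  \<comment> \<open>The prescribed odd coordinate fixes \<open>V\<close>; adding back the derivative
    term, known from p, gives the target for \<open>Q\<close>. At h it is 0 since \<open>Q\<close>
    ends before h.\<close>
  define t where "t i = (if i < h then - ((-1) ^ i * (u (Suc (2 * i)) * g (Suc i))) + 2 * of_nat (Suc i) * binsum h p (Suc i) else 0)" for i
  obtain q where q: "\<forall>j>h. q j = 0" "\<forall>i\<le>h. binsum h q i = t i"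
    using binsum_surj[of h t] by metis
  have qh: "q h = 0" using q(2)[rule_format, of h] by (simp add: binsum_cut t_def)
  define w where "w i = (-1) ^ (i div 2) * (if even i then p (i div 2) / g (i div 2)
      else q (i div 2) / g (Suc (i div 2)))" for i
  have sq: "(-1) ^ j * ((-1) ^ j * z) = z" for j and z :: complex
    by (simp add: mult.assoc[symmetric] power_mult_distrib[symmetric])
  have "P w j = p j" for j
    using p(1) g_nz[of j] sq by (cases "j \<le> h") (simp_all add: P_def w_def mult.left_commute[of "g j"] del: g.simps)
  moreover have "Q w j = q j" for j
    using q(1) qh g_nz[of "Suc j"] sq
    by (cases "j < h"; cases "j = h") (simp_all add: Q_def w_def mult.left_commute[of "g (Suc j)"] del: g.simps)
  ultimately have PQ: "P w = p" "Q w = q" by auto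
  have "L w i = u i" for i
  proof (cases rule: index_cases[where i = i and h = h])
    case 1
    then show ?thesis using assms by (simp add: L_beyond)
  next
    case 2
    then show ?thesis using L_even[of 0 w] p(2) by (simp add: PQ)
  next
    case (3 l)
    then show ?thesis using L_even[of "Suc l" w] p(2) g_nz[of "Suc l"] by (simp add: PQ sq del: g.simps power_Suc)
  next
    case (4 l)
    then show ?thesis using L_odd[of l w] q(2) g_nz[of "Suc l"] by (simp add: PQ V_def t_def sq del: g.simps)
  qed
  moreover have "w i = 0" if "i > 2 * h" for i
  proof -
    have "i div 2 \<ge> h" "even i \<Longrightarrow> i div 2 > h" using that by presburger+
    then show ?thesis using p(1) q(1) qh by (cases "i div 2 = h") (auto simp: w_def)
  qed
  ultimately show ?thesis by (intro exI[of _ w] conjI ext) simp_all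
qed

end

section \<open>The kernel of the Dirac operator\<close>

text \<open>The factor in \<open>T_j x_j^m = dk x_j^(m-1)\<close>.\<close>

definition dk :: "complex \<Rightarrow> nat \<Rightarrow> complex" where
  "dk \<kappa> m = of_nat m + \<kappa> * (1 - (-1) ^ m)"

lemma dunkl_apply: "dunkl k j f (s, m) = dk (of_real (k j)) (Suc (ex j m)) * f (s, incr j m)"
  by (simp add: dunkl_def dk_def)

lemma dirac_False:
  "dirac k f (False, (a, b, c)) = dk (of_real (k 1)) (Suc a) * f (True, (Suc a, b, c))
     - \<i> * (dk (of_real (k 2)) (Suc b) * f (True, (a, Suc b, c)))
     + dk (of_real (k 3)) (Suc c) * f (False, (a, b, Suc c))"
  by (simp add: dirac_def pauli_def dunkl_apply)

lemma dirac_True: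
  "dirac k f (True, (a, b, c)) = dk (of_real (k 1)) (Suc a) * f (False, (Suc a, b, c))
     + \<i> * (dk (of_real (k 2)) (Suc b) * f (False, (a, Suc b, c)))
     - dk (of_real (k 3)) (Suc c) * f (True, (a, b, Suc c))"
  by (simp add: dirac_def pauli_def dunkl_apply)

lemma homog_0: "f \<in> homog n \<Longrightarrow> a + b + c \<noteq> n \<Longrightarrow> f (s, (a, b, c)) = 0"
  unfolding homog_def by (metis (mono_tags, lifting) mdeg.simps mem_Collect_eq)

locale dunkl_setting =
  fixes k :: "nat \<Rightarrow> real" and n :: nat
  assumes odd_n: "odd n"
    and dk1_nz: "\<And>m. 1 \<le> m \<Longrightarrow> m \<le> n \<Longrightarrow> dk (of_real (k 1)) m \<noteq> 0"
    and dk3_nz: "\<And>m. 1 \<le> m \<Longrightarrow> m \<le> n \<Longrightarrow> dk (of_real (k 3)) m \<noteq> 0"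
begin

abbreviation k1 :: complex where "k1 \<equiv> of_real (k 1)"
abbreviation k2 :: complex where "k2 \<equiv> of_real (k 2)"
abbreviation k3 :: complex where "k3 \<equiv> of_real (k 3)"

lemma Mn_recursion:
  assumes "u \<in> Mn k n"
  shows "dk k1 (Suc a) * u (True, (Suc a, b, c)) =
      \<i> * (dk k2 (Suc b) * u (True, (a, Suc b, c))) - dk k3 (Suc c) * u (False, (a, b, Suc c))"
    and "dk k1 (Suc a) * u (False, (Suc a, b, c)) =
      dk k3 (Suc c) * u (True, (a, b, Suc c)) - \<i> * (dk k2 (Suc b) * u (False, (a, Suc b, c)))"
proof -
  have "dirac k u = (\<lambda>_. 0)" using assms by (simp add: Mn_def)
  then have 1: "dirac k u (False, (a, b, c)) = 0" and 2: "dirac k u (True, (a, b, c)) = 0" by simp_all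
  show "dk k1 (Suc a) * u (True, (Suc a, b, c)) =
      \<i> * (dk k2 (Suc b) * u (True, (a, Suc b, c))) - dk k3 (Suc c) * u (False, (a, b, Suc c))"
    using 1 unfolding dirac_False by (simp add: algebra_simps add_eq_0_iff2)
  show "dk k1 (Suc a) * u (False, (Suc a, b, c)) =
      dk k3 (Suc c) * u (True, (a, b, Suc c)) - \<i> * (dk k2 (Suc b) * u (False, (a, Suc b, c)))"
    using 2 unfolding dirac_True by (simp add: algebra_simps add_eq_0_iff2)
qed

text \<open>Induction on the exponent of x_1: the recursion at x_2-exponent b uses only b and b + 1.
  A step from b = t - 1 to t contributes nothing, either because its factor is 0 or because the
  degree would exceed n.\<close>

lemma Mn_vanish:
  assumes u: "u \<in> Mn k n" and t: "dk k2 t = 0 \<or> n < t"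
    and u0: "\<And>s b c. b < t \<Longrightarrow> u (s, (0, b, c)) = 0"
  shows "b < t \<Longrightarrow> u (s, (a, b, c)) = 0"
proof (induction a arbitrary: s b c)
  case 0
  then show ?case using u0 by simp
next
  case (Suc a)
  have hom: "u \<in> homog n" using u by (simp add: Mn_def)
  show ?case
  proof (cases "Suc a \<le> n")
    case True
    have next_b: "dk k2 (Suc b) * u (s, (a, Suc b, c)) = 0" for s
    proof (cases "Suc b = t")
      case True
      then show ?thesis using t homog_0[OF hom, of a "Suc b" c s] by auto
    next
      case False
      then show ?thesis using Suc by simp
    qed
    have "dk k1 (Suc a) * u (s, (Suc a, b, c)) = 0"
      using Mn_recursion[OF u, of a b c] next_b Suc by (cases s) simp_all
    then show ?thesis using dk1_nz[of "Suc a"] True by simp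
  next
    case False
    then show ?thesis using homog_0[OF hom, of "Suc a" b c s] by simp
  qed
qed

text \<open>The Cauchy-Kovalevskaya extension: the solution with prescribed restriction to \<open>x\<^sub>1 = 0\<close>.\<close>

primrec ck :: "(bool \<Rightarrow> nat \<Rightarrow> complex) \<Rightarrow> nat \<Rightarrow> bool \<Rightarrow> nat \<Rightarrow> nat \<Rightarrow> complex" where
  "ck v 0 s b c = (if b + c = n then v s b else 0)"
| "ck v (Suc a) s b c = (if s
      then \<i> * (dk k2 (Suc b) * ck v a True (Suc b) c) - dk k3 (Suc c) * ck v a False b (Suc c)
      else dk k3 (Suc c) * ck v a True b (Suc c) - \<i> * (dk k2 (Suc b) * ck v a False (Suc b) c))
    / dk k1 (Suc a)"

definition ck_ext :: "(bool \<Rightarrow> nat \<Rightarrow> complex) \<Rightarrow> cpoly" where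
  "ck_ext v = (\<lambda>(s, (a, b, c)). ck v a s b c)"

lemma ck_homog: "a + b + c \<noteq> n \<Longrightarrow> ck v a s b c = 0"
  by (induction a arbitrary: s b c) simp_all

lemma ck_ext_Mn: "ck_ext v \<in> Mn k n"
proof -
  have rec: "dk k1 (Suc a) * ck v (Suc a) s b c = (if s
      then \<i> * (dk k2 (Suc b) * ck v a True (Suc b) c) - dk k3 (Suc c) * ck v a False b (Suc c)
      else dk k3 (Suc c) * ck v a True b (Suc c) - \<i> * (dk k2 (Suc b) * ck v a False (Suc b) c))" for a s b c
  proof (cases "Suc a \<le> n")
    case True
    then show ?thesis using dk1_nz[of "Suc a"] by simp
  next
    case False
    \<comment> \<open>Beyond degree n the divisor may be 0, but there all coefficients vanish by
      homogeneity.\<close>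
    then show ?thesis by (simp add: ck_homog del: ck.simps)
  qed
  have "dirac k (ck_ext v) (s, (a, b, c)) = 0" for s a b c
    using rec[of a True b c] rec[of a False b c]
    by (cases s) (simp_all add: dirac_False dirac_True ck_ext_def del: ck.simps)
  then have "dirac k (ck_ext v) = (\<lambda>_. 0)" by (auto simp: fun_eq_iff)
  moreover have "ck_ext v \<in> homog n"
    unfolding homog_def ck_ext_def by (auto dest: contrapos_nn[OF _ ck_homog] intro: ccontr)
  ultimately show ?thesis by (simp add: Mn_def)
qed

lemma ck_ext_0: "b + c = n \<Longrightarrow> ck_ext v (s, (0, b, c)) = v s b"
  by (simp add: ck_ext_def)

end

section \<open>Matrices of X, Y, Z on the restriction to x_1 = 0\<close>

context dunkl_setting
begin

text \<open>Coefficient of \<open>x\<^sub>2\<^sup>j x\<^sub>3\<^sup>c\<close> in the restriction to \<open>x\<^sub>1 = 0\<close>, projected to the eigenspace of \<open>e\<^sub>1\<close> for \<open>\<epsilon> = \<plusminus> 1\<close>.\<close>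

definition lc :: "complex \<Rightarrow> cpoly \<Rightarrow> nat \<Rightarrow> nat \<Rightarrow> complex" where
  "lc \<epsilon> u j c = u (False, (0, j, c)) + \<epsilon> * u (True, (0, j, c))"

text \<open>\<open>X\<close> contains neither x_1 nor \<open>T_1\<close>, so it acts on the
  restriction itself. With j + c = n odd, \<open>R_2 R_3\<close> is -1 and \<open>R_3\<close> is
  \<open>- R_2\<close>, whence the alternating k_3 - k_2.\<close>

lemma lc_X:
  assumes "j + c = n" "\<epsilon> * \<epsilon> = 1"
  shows "lc \<epsilon> (Jop k 1 2 3 u) j c =
     (if j = 0 then 0 else \<i> * \<epsilon> * dk k3 (Suc c) * lc \<epsilon> u (j - 1) (Suc c))
     + (- 1 / 2 + (-1) ^ j * (k3 - k2)) * lc \<epsilon> u j c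
     - (if c = 0 then 0 else \<i> * \<epsilon> * dk k2 (Suc j) * lc \<epsilon> u (Suc j) (c - 1))"
proof -
  have par: "even j \<longleftrightarrow> odd c" using odd_n assms(1) by auto
  have J: "Jop k 1 2 3 u (s, (0, j, c)) =
     (if j = 0 then 0 else \<i> * dk k3 (Suc c) * u (\<not> s, (0, j - 1, Suc c)))
     + (- 1 / 2 + (-1) ^ j * (k3 - k2)) * u (s, (0, j, c))
     - (if c = 0 then 0 else \<i> * dk k2 (Suc j) * u (\<not> s, (0, Suc j, c - 1)))" for s
    using par by (cases j; cases c; cases "even j")
      (simp_all add: Jop_def Let_def refl_def xmul_def dunkl_apply pauli_def algebra_simps)
  have sq: "\<epsilon> * (\<epsilon> * z) = z" for z using assms(2) by (simp add: mult.assoc[symmetric])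
  show ?thesis unfolding lc_def J by (auto simp: algebra_simps sq)
qed

text \<open>At x_1 = 0 the term with factor x_1 drops out, and \<open>T_1 u\<close> is replaced
  through the Dirac equation. The products e_2 e_1 e_2 = - e_1 and e_2 e_1 e_3 = -
  \<open>\<i>\<close> leave only \<open>e_1\<close>, that is \<open>\<epsilon>\<close>, and scalars.
  \<open>lc_Z\<close> follows the same scheme.\<close>

lemma lc_Y:
  assumes u: "u \<in> Mn k n" and "j + c = n" "\<epsilon> * \<epsilon> = 1"
  shows "lc \<epsilon> (Jop k 2 3 1 u) j c =
     - ((-1) ^ j) * (of_nat c + 1 / 2 + k1 + k3) * lc \<epsilon> u j c
     + (if c = 0 then 0 else (-1) ^ j * (\<i> * \<epsilon> * dk k2 (Suc j) * lc \<epsilon> u (Suc j) (c - 1)))"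
proof -
  have par: "even j \<longleftrightarrow> odd c" using odd_n assms(2) by auto
  have J: "Jop k 2 3 1 u (s, (0, j, c)) =
     (if c = 0 then 0 else (-1) ^ j * (dk k1 1 * (if s then - u (False, (1, j, c - 1)) else u (True, (1, j, c - 1)))))
     - (-1) ^ j * (1 / 2 + k1) * u (s, (0, j, c)) + k3 * u (s, (0, j, c))" for s
    using par by (cases c; cases "even j"; cases s)
      (simp_all add: Jop_def Let_def refl_def xmul_def dunkl_apply pauli_def algebra_simps)
  have sq: "\<epsilon> * (\<epsilon> * z) = z" for z using assms(3) by (simp add: mult.assoc[symmetric])
  show ?thesis
  proof (cases c)
    case 0
    then have "odd j" using par by simp
    then show ?thesis unfolding lc_def J using 0 by (simp add: algebra_simps)
  next
    case (Suc q)
    have r: "dk k1 1 * u (True, (1, j, q)) =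
        \<i> * (dk k2 (Suc j) * u (True, (0, Suc j, q))) - dk k3 (Suc q) * u (False, (0, j, Suc q))"
      "dk k1 1 * u (False, (1, j, q)) =
        dk k3 (Suc q) * u (True, (0, j, Suc q)) - \<i> * (dk k2 (Suc j) * u (False, (0, Suc j, q)))"
      using Mn_recursion[OF u, of 0 j q] by simp_all
    have d3: "dk k3 (Suc q) = of_nat c + k3 * (1 + (-1) ^ j)"
      using par by (cases "even j") (simp_all add: dk_def Suc)
    have JF: "Jop k 2 3 1 u (False, (0, j, c)) = (-1) ^ j *
        (\<i> * (dk k2 (Suc j) * u (True, (0, Suc j, q))) - dk k3 (Suc q) * u (False, (0, j, Suc q)))
        - (-1) ^ j * (1 / 2 + k1) * u (False, (0, j, c)) + k3 * u (False, (0, j, c))"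
      unfolding J r(1)[symmetric] by (simp add: Suc)
    have JT: "Jop k 2 3 1 u (True, (0, j, c)) = - ((-1) ^ j *
        (dk k3 (Suc q) * u (True, (0, j, Suc q)) - \<i> * (dk k2 (Suc j) * u (False, (0, Suc j, q)))))
        - (-1) ^ j * (1 / 2 + k1) * u (True, (0, j, c)) + k3 * u (True, (0, j, c))"
      unfolding J r(2)[symmetric] by (simp add: Suc)
    show ?thesis unfolding lc_def JF JT d3
      by (cases "even j") (simp_all add: Suc algebra_simps sq)
  qed
qed

lemma lc_Z:
  assumes u: "u \<in> Mn k n" and "j + c = n" "\<epsilon> * \<epsilon> = 1"
  shows "lc \<epsilon> (Jop k 3 1 2 u) j c =
     (-1) ^ j * (of_nat j + 1 / 2 + k1 + k2) * lc \<epsilon> u j c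
     + (if j = 0 then 0 else (-1) ^ j * (\<i> * \<epsilon> * dk k3 (Suc c) * lc \<epsilon> u (j - 1) (Suc c)))"
proof -
  have J: "Jop k 3 1 2 u (s, (0, j, c)) =
     (if j = 0 then 0 else (-1) ^ j * (\<i> * (dk k1 1 * (if s then - u (True, (1, j - 1, c)) else u (False, (1, j - 1, c))))))
     + (-1) ^ j * (1 / 2 + k1) * u (s, (0, j, c)) + k2 * u (s, (0, j, c))" for s
    by (cases j; cases "even j"; cases s)
      (simp_all add: Jop_def Let_def refl_def xmul_def dunkl_apply pauli_def algebra_simps)
  have sq: "\<epsilon> * (\<epsilon> * z) = z" for z using assms(3) by (simp add: mult.assoc[symmetric])
  have ii: "\<i> * (\<i> * z) = - z" for z by (simp add: mult.assoc[symmetric])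
  show ?thesis
  proof (cases j)
    case 0
    then show ?thesis unfolding lc_def J by (simp add: algebra_simps)
  next
    case (Suc q)
    have r: "dk k1 1 * u (True, (1, q, c)) =
        \<i> * (dk k2 (Suc q) * u (True, (0, Suc q, c))) - dk k3 (Suc c) * u (False, (0, q, Suc c))"
      "dk k1 1 * u (False, (1, q, c)) =
        dk k3 (Suc c) * u (True, (0, q, Suc c)) - \<i> * (dk k2 (Suc q) * u (False, (0, Suc q, c)))"
      using Mn_recursion[OF u, of 0 q c] by simp_all
    have d2: "dk k2 (Suc q) = of_nat j + k2 * (1 - (-1) ^ j)"
      by (simp add: dk_def Suc)
    have JF: "Jop k 3 1 2 u (False, (0, j, c)) = (-1) ^ j * (\<i> *
        (dk k3 (Suc c) * u (True, (0, q, Suc c)) - \<i> * (dk k2 (Suc q) * u (False, (0, Suc q, c)))))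
        + (-1) ^ j * (1 / 2 + k1) * u (False, (0, j, c)) + k2 * u (False, (0, j, c))"
      unfolding J r(2)[symmetric] by (simp add: Suc)
    have JT: "Jop k 3 1 2 u (True, (0, j, c)) = - ((-1) ^ j * (\<i> *
        (\<i> * (dk k2 (Suc q) * u (True, (0, Suc q, c))) - dk k3 (Suc c) * u (False, (0, q, Suc c)))))
        + (-1) ^ j * (1 / 2 + k1) * u (True, (0, j, c)) + k2 * u (True, (0, j, c))"
      unfolding J r(1)[symmetric] by (simp add: Suc)
    show ?thesis unfolding lc_def JF JT d2
      by (cases "even j") (simp_all add: Suc algebra_simps sq ii)
  qed
qed

text \<open>Rescaling which makes the subdiagonal entries of \<open>X\<close> equal to 1 and removes \<open>\<epsilon>\<close> from its matrix.\<close>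

primrec G :: "complex \<Rightarrow> nat \<Rightarrow> complex" where
  "G \<epsilon> 0 = 1"
| "G \<epsilon> (Suc j) = G \<epsilon> j / (\<i> * \<epsilon> * dk k3 (n - j))"

definition W :: "complex \<Rightarrow> cpoly \<Rightarrow> nat \<Rightarrow> complex" where
  "W \<epsilon> u j = (if j \<le> n then G \<epsilon> j * lc \<epsilon> u j (n - j) else 0)"

text \<open>The product of opposite off-diagonal entries of \<open>X\<close>, which no diagonal
  rescaling changes; in it \<open>\<epsilon>\<close> occurs squared. Written without natural
  subtraction it makes sense for all j and vanishes at n + 1, where the matrices are cut.\<close>

definition e :: "nat \<Rightarrow> complex" where
  "e j = dk k2 j * (of_nat n + 1 - of_nat j + k3 * (1 - (-1) ^ j))"

lemma e_Suc: "j \<le> n \<Longrightarrow> e (Suc j) = dk k2 (Suc j) * dk k3 (n - j)"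
proof -
  assume j: "j \<le> n"
  then have "even (n - j) \<longleftrightarrow> odd j" using odd_n by auto
  then show ?thesis using j by (cases "even j") (simp_all add: e_def dk_def)
qed

lemma G_nz: "\<epsilon> \<noteq> 0 \<Longrightarrow> j \<le> n \<Longrightarrow> G \<epsilon> j \<noteq> 0"
  by (induction j) (use dk3_nz in auto)

lemma G_step: "\<epsilon> \<noteq> 0 \<Longrightarrow> j < n \<Longrightarrow> G \<epsilon> j = \<i> * \<epsilon> * dk k3 (n - j) * G \<epsilon> (Suc j)"
  using dk3_nz[of "n - j"] by simp

lemma W_raise:
  assumes "\<epsilon> * \<epsilon> = 1" "j \<le> n"
  shows "G \<epsilon> j * (if j = 0 then 0 else \<i> * \<epsilon> * dk k3 (Suc (n - j)) * lc \<epsilon> u (j - 1) (Suc (n - j)))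
    = (if j = 0 then 0 else W \<epsilon> u (j - 1))"
proof (cases j)
  case (Suc q)
  then have s: "Suc (n - Suc q) = n - q" using assms(2) by auto
  have "\<epsilon> \<noteq> 0" using assms(1) by auto
  then have "G \<epsilon> q = \<i> * \<epsilon> * dk k3 (n - q) * G \<epsilon> j"
    unfolding Suc using Suc assms(2) by (intro G_step) auto
  then show ?thesis using Suc assms(2) by (simp add: W_def s del: G.simps)
qed simp

lemma W_lower:
  assumes "\<epsilon> * \<epsilon> = 1" "j \<le> n"
  shows "G \<epsilon> j * (if n - j = 0 then 0 else \<i> * \<epsilon> * dk k2 (Suc j) * lc \<epsilon> u (Suc j) (n - j - 1))
    = - (e (Suc j) * W \<epsilon> u (Suc j))"
proof (cases "j < n")
  case True
  have "\<epsilon> \<noteq> 0" using assms(1) by auto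
  have sq: "\<epsilon> * (\<epsilon> * z) = z" for z using assms(1) by (simp add: mult.assoc[symmetric])
  have ii: "\<i> * (\<i> * z) = - z" for z by (simp add: mult.assoc[symmetric])
  have "n - j - 1 = n - Suc j" by simp
  then show ?thesis
    using True by (simp add: G_step[OF \<open>\<epsilon> \<noteq> 0\<close> True] W_def e_Suc sq ii algebra_simps del: G.simps)
next
  case False
  then show ?thesis using assms(2) e_Suc[of n] by (simp add: W_def)
qed

abbreviation "XX \<equiv> trid (- 1 / 2) (k3 - k2) e"
abbreviation "YY \<equiv> bidiag (- 1) (of_nat n + 1 / 2 + k1 + k3) e"

definition ZZ :: "(nat \<Rightarrow> complex) \<Rightarrow> nat \<Rightarrow> complex" where
  "ZZ w j = (-1) ^ j * ((of_nat j + 1 / 2 + k1 + k2) * w j + (if j = 0 then 0 else w (j - 1)))"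

lemma W_X:
  assumes "\<epsilon> * \<epsilon> = 1" "j \<le> n"
  shows "W \<epsilon> (Jop k 1 2 3 u) j = XX (W \<epsilon> u) j"
proof -
  have "W \<epsilon> (Jop k 1 2 3 u) j =
      G \<epsilon> j * (if j = 0 then 0 else \<i> * \<epsilon> * dk k3 (Suc (n - j)) * lc \<epsilon> u (j - 1) (Suc (n - j)))
      + (- 1 / 2 + (-1) ^ j * (k3 - k2)) * W \<epsilon> u j
      - G \<epsilon> j * (if n - j = 0 then 0 else \<i> * \<epsilon> * dk k2 (Suc j) * lc \<epsilon> u (Suc j) (n - j - 1))"
    using lc_X[of j "n - j" \<epsilon> u] assms unfolding W_def
    by (simp only: if_True le_add_diff_inverse ring_distribs) (simp add: algebra_simps)
  then show ?thesis unfolding W_raise[OF assms] W_lower[OF assms] by (simp add: trid_def)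
qed

lemma W_Y:
  assumes "u \<in> Mn k n" "\<epsilon> * \<epsilon> = 1" "j \<le> n"
  shows "W \<epsilon> (Jop k 2 3 1 u) j = YY (W \<epsilon> u) j"
proof -
  have "W \<epsilon> (Jop k 2 3 1 u) j = - ((-1) ^ j) * (of_nat (n - j) + 1 / 2 + k1 + k3) * W \<epsilon> u j
      + (-1) ^ j * (G \<epsilon> j * (if n - j = 0 then 0 else \<i> * \<epsilon> * dk k2 (Suc j) * lc \<epsilon> u (Suc j) (n - j - 1)))"
    using lc_Y[OF assms(1), of j "n - j" \<epsilon>] assms unfolding W_def
    by (simp only: if_True le_add_diff_inverse ring_distribs) (simp add: algebra_simps)
  then show ?thesis unfolding W_lower[OF assms(2,3)] using assms(3)
    by (simp add: bidiag_def of_nat_diff algebra_simps)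
qed

lemma W_Z:
  assumes "u \<in> Mn k n" "\<epsilon> * \<epsilon> = 1" "j \<le> n"
  shows "W \<epsilon> (Jop k 3 1 2 u) j = ZZ (W \<epsilon> u) j"
proof -
  have "W \<epsilon> (Jop k 3 1 2 u) j = (-1) ^ j * (of_nat j + 1 / 2 + k1 + k2) * W \<epsilon> u j
      + (-1) ^ j * (G \<epsilon> j * (if j = 0 then 0 else \<i> * \<epsilon> * dk k3 (Suc (n - j)) * lc \<epsilon> u (j - 1) (Suc (n - j))))"
    using lc_Z[OF assms(1), of j "n - j" \<epsilon>] assms unfolding W_def
    by (simp only: if_True le_add_diff_inverse ring_distribs) (simp add: algebra_simps)
  then show ?thesis unfolding W_raise[OF assms(2,3)] by (simp add: ZZ_def algebra_simps)
qed

text \<open>The constant is compared with 2ab - c(d + 1) separately for the quotient and for the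
  submodule.\<close>

lemma ZZ_eq: "ZZ w j = XX (YY w) j + YY (XX w) j - (2 * k1 * k2 - 2 * k3 * (k1 + k2 + k3 + of_nat n + 1)) * w j"
  by (cases j; cases "even j") (simp_all add: ZZ_def trid_def bidiag_def e_def dk_def field_simps)

lemma W_lin: "W \<epsilon> (\<lambda>x. \<alpha> * u x + \<beta> * v x) = (\<lambda>x. \<alpha> * W \<epsilon> u x + \<beta> * W \<epsilon> v x)"
  by (simp add: W_def lc_def fun_eq_iff algebra_simps)

lemma W_surj:
  assumes "\<forall>i>n. wp i = 0" "\<forall>i>n. wm i = 0"
  obtains u where "u \<in> Mn k n" "W 1 u = wp" "W (-1) u = wm"
proof -
  \<comment> \<open>Half the sum and half the difference of the two eigencomponents, with the
    rescaling undone.\<close>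
  define v where "v s j = (wp j / G 1 j + (if s then -1 else 1) * (wm j / G (-1) j)) / 2" for s j
  have "W 1 (ck_ext v) = wp"
    using assms G_nz[of 1] by (auto simp: W_def lc_def ck_ext_0 v_def fun_eq_iff field_simps simp del: G.simps)
  moreover have "W (-1) (ck_ext v) = wm"
    using assms G_nz[of "-1"] by (auto simp: W_def lc_def ck_ext_0 v_def fun_eq_iff field_simps simp del: G.simps)
  ultimately show ?thesis using that ck_ext_Mn by blast
qed

lemma W_eq_0D:
  assumes "W 1 u j = 0" "W (-1) u j = 0" "u \<in> Mn k n"
  shows "u (s, (0, j, c)) = 0"
proof (cases "j + c = n")
  case True
  then have "lc 1 u j c = 0" "lc (-1) u j c = 0"
    using assms G_nz[of 1 j] G_nz[of "-1" j] by (auto simp: W_def)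
  then show ?thesis by (cases s) (simp_all add: lc_def)
next
  case False
  then show ?thesis using assms(3) homog_0[of u n 0 j c s] by (simp add: Mn_def)
qed

end

section \<open>Maps into direct sums and linearity\<close>

lemma bimod_dsum_sel:
  "car (bimod_dsum M N) = {w. (\<lambda>i. w (Inl i)) \<in> car M \<and> (\<lambda>j. w (Inr j)) \<in> car N}"
  "opX (bimod_dsum M N) = dsum_op (opX M) (opX N)"
  "opY (bimod_dsum M N) = dsum_op (opY M) (opY N)"
  "opZ (bimod_dsum M N) = dsum_op (opZ M) (opZ N)"
  by (simp_all add: bimod_dsum_def)

lemma case_sum_dsum: "dsum_op F G (case_sum u v) = case_sum (F u) (G v)"
  by (simp add: dsum_op_def)

lemma case_sum_expand: "case_sum (\<lambda>i. w (Inl i)) (\<lambda>j. w (Inr j)) = w"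
  by (auto simp: fun_eq_iff split: sum.split)

lemma intertwines_case_sum:
  assumes "intertwines M N f" "intertwines M N' f'"
  shows "intertwines M (bimod_dsum N N') (\<lambda>u. case_sum (f u) (f' u))"
  using assms by (simp add: intertwines_def bimod_dsum_sel case_sum_dsum)

lemma clinear_on_case_sum:
  assumes "clinear_on S f" "clinear_on S f'"
  shows "clinear_on S (\<lambda>u. case_sum (f u) (f' u))"
  using assms by (auto simp: clinear_on_def fun_eq_iff split: sum.split)

lemma clinear_onI:
  assumes "\<And>\<alpha> \<beta> u v. f (\<lambda>x. \<alpha> * u x + \<beta> * v x) = (\<lambda>y. \<alpha> * f u y + \<beta> * f v y)"
  shows "clinear_on S f"
  unfolding clinear_on_def
proof (intro conjI ballI allI)
  fix u v
  show "f (\<lambda>x. u x + v x) = (\<lambda>y. f u y + f v y)" using assms[of 1 u 1 v] by simp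
next
  fix c u
  show "f (\<lambda>x. c * u x) = (\<lambda>y. c * f u y)" using assms[of c u 0 u] by simp
qed

lemma dirac_lin: "dirac k (\<lambda>x. \<alpha> * u x + \<beta> * v x) = (\<lambda>x. \<alpha> * dirac k u x + \<beta> * dirac k v x)"
proof
  fix x :: "bool \<times> mono"
  obtain s a b c where "x = (s, (a, b, c))" by (cases x) auto
  then show "dirac k (\<lambda>x. \<alpha> * u x + \<beta> * v x) x = \<alpha> * dirac k u x + \<beta> * dirac k v x"
    by (cases s) (simp_all add: dirac_True dirac_False algebra_simps)
qed

lemma Mn_lin:
  assumes "u \<in> Mn k n" "v \<in> Mn k n"
  shows "(\<lambda>x. \<alpha> * u x + \<beta> * v x) \<in> Mn k n"
proof -
  have "mdeg m = n" if "\<alpha> * u (s, m) + \<beta> * v (s, m) \<noteq> 0" for s m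
  proof -
    have "u (s, m) \<noteq> 0 \<or> v (s, m) \<noteq> 0" using that by auto
    then show ?thesis using assms unfolding Mn_def homog_def by blast
  qed
  then have "(\<lambda>x. \<alpha> * u x + \<beta> * v x) \<in> homog n" unfolding homog_def by blast
  then show ?thesis using assms by (simp add: Mn_def dirac_lin)
qed

context quotient_map
begin

lemma L_cong: assumes "\<And>i. i \<le> 2 * h \<Longrightarrow> u i = v i" shows "L u = L v"
proof -
  have "L (\<lambda>x. 1 * u x + -1 * v x) = (\<lambda>_. 0)" using assms by (simp add: L_eq_0_iff)
  then show ?thesis unfolding L_lin by (simp add: fun_eq_iff)
qed

lemma L_lin3: "L (\<lambda>x. u x + v x - \<alpha> * w x) = (\<lambda>x. L u x + L v x - \<alpha> * L w x)"
proof -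
  have "L (\<lambda>x. 1 * (1 * u x + 1 * v x) + - \<alpha> * w x) = (\<lambda>x. 1 * (1 * L u x + 1 * L v x) + - \<alpha> * L w x)"
    by (simp only: L_lin)
  then show ?thesis by simp
qed

end

context submodule_map
begin

lemma L_cong: assumes "\<And>i. i \<le> 2 * h \<Longrightarrow> u i = v i" shows "L u = L v"
proof -
  have "L (\<lambda>x. 1 * u x + -1 * v x) = (\<lambda>_. 0)" using assms by (simp add: L_eq_0_iff)
  then show ?thesis unfolding L_lin by (simp add: fun_eq_iff)
qed

lemma L_lin3: "L (\<lambda>x. u x + v x - \<alpha> * w x) = (\<lambda>x. L u x + L v x - \<alpha> * L w x)"
proof -
  have "L (\<lambda>x. 1 * (1 * u x + 1 * v x) + - \<alpha> * w x) = (\<lambda>x. 1 * (1 * L u x + 1 * L v x) + - \<alpha> * L w x)"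
    by (simp only: L_lin)
  then show ?thesis by simp
qed

end

section \<open>Submodule and quotient\<close>

locale dunkl_sub_setting = dunkl_setting +
  fixes t :: nat
  assumes odd_t: "odd t" and t_le: "t \<le> n" and k2_t: "k 2 = - real t / 2" and tval_t: "tval (k 2) = enat t"
begin

lemma k2_eq: "k2 = - of_nat t / 2"
  by (simp add: k2_t)

lemma dk2_t: "dk k2 t = 0"
  using odd_t by (simp add: dk_def k2_eq)

lemma Mnx_iff: "u \<in> Mnx k n 2 \<longleftrightarrow> u \<in> Mn k n \<and> (\<forall>s a b c. b < t \<longrightarrow> u (s, (a, b, c)) = 0)"
  unfolding Mnx_def tval_t by (auto simp: not_less[symmetric])

text \<open>Divisibility by x_2^t can be tested at x_1 = 0, since \<open>Mn_vanish\<close>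
  propagates it to all powers of x_1.\<close>

lemma Mnx_iff_W: "u \<in> Mnx k n 2 \<longleftrightarrow> u \<in> Mn k n \<and> (\<forall>j<t. W 1 u j = 0 \<and> W (-1) u j = 0)"
proof
  assume "u \<in> Mnx k n 2"
  then show "u \<in> Mn k n \<and> (\<forall>j<t. W 1 u j = 0 \<and> W (-1) u j = 0)"
    by (auto simp: Mnx_iff W_def lc_def)
next
  assume u: "u \<in> Mn k n \<and> (\<forall>j<t. W 1 u j = 0 \<and> W (-1) u j = 0)"
  then have "u (s, (a, b, c)) = 0" if "b < t" for s a b c
    using Mn_vanish[of u t] W_eq_0D[of u] dk2_t that by blast
  then show "u \<in> Mnx k n 2" using u by (simp add: Mnx_iff)
qed

text \<open>\<open>Mn_vanish\<close> with n + 1 in place of t: a solution is determined by its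
  restriction to x_1 = 0.\<close>

lemma Mn_eqI:
  assumes "u \<in> Mn k n" "v \<in> Mn k n" "W 1 u = W 1 v" "W (-1) u = W (-1) v"
  shows "u = v"
proof -
  define z where "z = (\<lambda>x. 1 * u x + -1 * v x)"
  have z: "z \<in> Mn k n" unfolding z_def by (rule Mn_lin[OF assms(1,2)])
  have "W 1 z j = 0" "W (-1) z j = 0" for j unfolding z_def W_lin using assms by simp_all
  then have "z (s, (0, b, c)) = 0" for s b c using W_eq_0D z by blast
  then have "z (s, (a, b, c)) = 0" if "b < Suc n" for s a b c
    using Mn_vanish[OF z, of "Suc n"] that by blast
  moreover have "z (s, (a, b, c)) = 0" if "\<not> b < Suc n" for s a b c
    using z homog_0[of z n a b c s] that by (simp add: Mn_def)
  ultimately have "z (s, (a, b, c)) = 0" for s a b c by blast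
  then have "z x = 0" for x by (cases x) auto
  then show ?thesis by (simp add: z_def fun_eq_iff)
qed

end

locale dunkl_quotient = dunkl_sub_setting + fixes h :: nat assumes t_h: "t = Suc (2 * h)"
begin

sublocale q: quotient_map h "of_nat n" k1 k3
proof
  fix j assume "j < h"
  then have "Suc (2 * j) < n" using t_h t_le by simp
  then have "(of_nat n :: complex) \<noteq> of_nat (Suc (2 * j))" by (simp only: of_nat_eq_iff)
  then show "of_nat n - 1 - 2 * of_nat j \<noteq> (0 :: complex)" by (simp add: diff_eq_eq add.commute)
qed

lemma q_e: "q.e = e"
  by (rule ext) (simp add: q.e_def e_def dk_def q.D_def k2_eq t_h field_simps)

lemma q_XX: "q.XX = XX"
  by (simp add: q_e q.D_def k2_eq t_h field_simps)

definition quot where "quot \<epsilon> u = q.L (W \<epsilon> u)"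

lemma quot_lin: "quot \<epsilon> (\<lambda>x. \<alpha> * u x + \<beta> * v x) = (\<lambda>x. \<alpha> * quot \<epsilon> u x + \<beta> * quot \<epsilon> v x)"
  by (simp only: quot_def W_lin q.L_lin)

lemma L_W: "(\<And>j. j \<le> n \<Longrightarrow> W \<epsilon> u j = w j) \<Longrightarrow> quot \<epsilon> u = q.L w"
  unfolding quot_def using t_le t_h by (intro q.L_cong) simp

lemma quot_intertwines:
  assumes "\<epsilon> * \<epsilon> = 1"
  shows "intertwines (Mmod k n) (Omod (t - 1) k3 (- (k1 + k2 + k3) - of_nat n - 1) k1) (quot \<epsilon>)"
proof -
  let ?b = "- (k1 + k2 + k3) - of_nat n - 1"
  have d: "t - 1 = 2 * h" by (simp add: t_h)
  have b: "?b = - k1 - k3 - of_nat n - 1 / 2 + q.D / 2"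
    by (simp add: q.D_def k2_eq t_h field_simps)
  have X: "q.L (XX w) = OX (t - 1) k3 (q.L w)" for w
    using q.L_XX[of w] unfolding q_XX d .
  have Y: "q.L (YY w) = OY (t - 1) k3 ?b k1 (q.L w)" for w
    using q.L_YY[of w] unfolding q_e d b .
  show ?thesis
    unfolding intertwines_def
  proof (intro ballI conjI)
    fix u assume "u \<in> car (Mmod k n)"
    then have u: "u \<in> Mn k n" by (simp add: Mmod_def)
    have fX: "quot \<epsilon> (Jop k 1 2 3 u) = q.L (XX (W \<epsilon> u))"
      using W_X[OF assms] by (intro L_W) blast
    then show "quot \<epsilon> (opX (Mmod k n) u) = opX (Omod (t - 1) k3 ?b k1) (quot \<epsilon> u)"
      unfolding X by (simp add: Mmod_def quot_def)
    have fY: "quot \<epsilon> (Jop k 2 3 1 u) = q.L (YY (W \<epsilon> u))"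
      using W_Y[OF u assms] by (intro L_W) blast
    then show "quot \<epsilon> (opY (Mmod k n) u) = opY (Omod (t - 1) k3 ?b k1) (quot \<epsilon> u)"
      unfolding Y by (simp add: Mmod_def quot_def)
    let ?\<kappa> = "2 * k1 * k2 - 2 * k3 * (k1 + k2 + k3 + of_nat n + 1)"
    have "quot \<epsilon> (Jop k 3 1 2 u) = q.L (\<lambda>j. XX (YY (W \<epsilon> u)) j + YY (XX (W \<epsilon> u)) j - ?\<kappa> * W \<epsilon> u j)"
      using W_Z[OF u assms] ZZ_eq by (intro L_W) simp
    also have "\<dots> = (\<lambda>i. OX (t - 1) k3 (OY (t - 1) k3 ?b k1 (quot \<epsilon> u)) i
        + OY (t - 1) k3 ?b k1 (OX (t - 1) k3 (quot \<epsilon> u)) i - ?\<kappa> * quot \<epsilon> u i)"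
      by (simp only: q.L_lin3 X Y quot_def)
    \<comment> \<open>With 2 k_2 = - t the constant of \<open>ZZ_eq\<close> becomes the one in the
      definition of \<open>Omod\<close>.\<close>
    also have "?\<kappa> = 2 * k3 * ?b - k1 * (of_nat (t - 1) + 1)"
      by (simp add: t_h k2_eq field_simps)
    finally show "quot \<epsilon> (opZ (Mmod k n) u) = opZ (Omod (t - 1) k3 ?b k1) (quot \<epsilon> u)"
      by (simp add: Mmod_def Omod_def)
  qed
qed

lemma quot_eq_0_iff: "quot \<epsilon> u = (\<lambda>_. 0) \<longleftrightarrow> (\<forall>j<t. W \<epsilon> u j = 0)"
  unfolding quot_def q.L_eq_0_iff by (auto simp: t_h less_Suc_eq_le)

lemma quot_iso:
  defines "N \<equiv> Omod (t - 1) k3 (- (k1 + k2 + k3) - of_nat n - 1) k1"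
  shows "bimod_quot_iso (Mmod k n) (Mnx k n 2) (bimod_dsum N N)"
  unfolding bimod_quot_iso_def
proof (intro exI conjI)
  let ?f = "\<lambda>u. case_sum (quot 1 u) (quot (-1) u)"
  have carN: "car N = {u. \<forall>i>2 * h. u i = 0}" by (simp add: N_def t_h)
  show "clinear_on (car (Mmod k n)) ?f"
    by (intro clinear_on_case_sum clinear_onI quot_lin)
  show "intertwines (Mmod k n) (bimod_dsum N N) ?f"
    unfolding N_def by (intro intertwines_case_sum quot_intertwines) simp_all
  show "?f ` car (Mmod k n) = car (bimod_dsum N N)"
  proof (intro equalityI subsetI)
    fix v assume "v \<in> ?f ` car (Mmod k n)"
    then show "v \<in> car (bimod_dsum N N)"
      by (auto simp: bimod_dsum_sel carN quot_def q.L_beyond)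
  next
    fix v assume "v \<in> car (bimod_dsum N N)"
    then have v: "\<forall>i>2 * h. v (Inl i) = 0" "\<forall>i>2 * h. v (Inr i) = 0"
      by (simp_all add: bimod_dsum_sel carN)
    obtain wp where wp: "\<forall>i>2 * h. wp i = 0" "q.L wp = (\<lambda>i. v (Inl i))"
      using q.L_surj[OF v(1)] by (elim exE conjE)
    obtain wm where wm: "\<forall>i>2 * h. wm i = 0" "q.L wm = (\<lambda>i. v (Inr i))"
      using q.L_surj[OF v(2)] by (elim exE conjE)
    have "\<forall>i>n. wp i = 0" "\<forall>i>n. wm i = 0" using wp(1) wm(1) t_le t_h by simp_all
    then obtain u where "u \<in> Mn k n" "W 1 u = wp" "W (-1) u = wm" by (rule W_surj)
    then have "v = ?f u" "u \<in> car (Mmod k n)"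
      by (simp_all add: quot_def wp wm case_sum_expand Mmod_def)
    then show "v \<in> ?f ` car (Mmod k n)" by (intro image_eqI[of v ?f u])
  qed
  have "?f u = (\<lambda>_. 0) \<longleftrightarrow> quot 1 u = (\<lambda>_. 0) \<and> quot (-1) u = (\<lambda>_. 0)" for u
    by (auto simp: fun_eq_iff split: sum.split)
  then show "{u \<in> car (Mmod k n). ?f u = (\<lambda>_. 0)} = Mnx k n 2"
    by (auto simp: Mnx_iff_W quot_eq_0_iff Mmod_def)
qed

end

locale dunkl_submodule = dunkl_sub_setting + fixes h :: nat assumes n_h: "n = t + 2 * h"
begin

sublocale s: submodule_map h "of_nat t" k1 k3
proof
  fix j
  have "of_nat (Suc (t + 2 * j)) \<noteq> (0 :: complex)" by (rule of_nat_neq_0)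
  then show "of_nat t + 1 + 2 * of_nat j \<noteq> (0 :: complex)" by (simp add: algebra_simps)
qed

lemma n_eq: "of_nat n = (of_nat t + 2 * of_nat h :: complex)"
  by (subst n_h) simp

lemma shift_le: "i \<le> 2 * h \<Longrightarrow> t + i \<le> n"
  using n_h by simp

lemma s_e: "s.e i = e (t + i)"
  using odd_t by (simp add: s.e_def e_def dk_def s.D_def k2_eq n_eq field_simps)

lemma e_t: "e t = 0" by (simp add: e_def dk2_t)

lemma t_pos: "t > 0" using odd_t by (cases t) auto

text \<open>Only the subdiagonal entry from t - 1 to t leads into the shifted range from below; the
  hypothesis removes it.\<close>

lemma shift_XX:
  assumes "w (t - 1) = 0"
  shows "XX w (t + i) = s.XX (\<lambda>i. w (t + i)) i"
proof (cases i)
  case 0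
  then show ?thesis using odd_t assms t_pos by (simp add: trid_def s_e k2_eq)
next
  case (Suc j)
  then show ?thesis using odd_t by (cases "even j") (simp_all add: trid_def s_e k2_eq)
qed

lemma shift_YY: "YY w (t + i) = s.YY (\<lambda>i. w (t + i)) i"
  using odd_t by (cases "even i") (simp_all add: bidiag_def s_e s.D_def n_eq algebra_simps)

text \<open>\<open>e t = 0\<close> cuts the link from t down to t - 1. It is needed because
  \<open>Z\<close> applies \<open>X\<close> after \<open>Y\<close>.\<close>

lemma YY_t: "w (t - 1) = 0 \<Longrightarrow> YY w (t - 1) = 0"
  using t_pos e_t by (simp add: bidiag_def)

definition sub where "sub \<epsilon> u = s.L (\<lambda>i. W \<epsilon> u (t + i))"

lemma sub_lin: "sub \<epsilon> (\<lambda>x. \<alpha> * u x + \<beta> * v x) = (\<lambda>x. \<alpha> * sub \<epsilon> u x + \<beta> * sub \<epsilon> v x)"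
  by (simp only: sub_def W_lin s.L_lin)

lemma L_W: "(\<And>j. j \<le> n \<Longrightarrow> W \<epsilon> u j = w j) \<Longrightarrow> sub \<epsilon> u = s.L (\<lambda>i. w (t + i))"
  unfolding sub_def by (intro s.L_cong) (simp add: shift_le)

lemma sub_intertwines:
  assumes "\<epsilon> * \<epsilon> = 1"
  shows "intertwines (Mxmod k n 2) (bimod_twist (Omod (n - t) (k3 + (of_nat n + 1) / 2)
     (- (k1 + k2 + k3) - (of_nat n + 1) / 2) (- k1 - (of_nat n + 1) / 2))) (sub \<epsilon>)"
proof -
  let ?a = "k3 + (of_nat n + 1) / 2" and ?b = "- (k1 + k2 + k3) - (of_nat n + 1) / 2"
    and ?c = "- k1 - (of_nat n + 1) / 2"
  have d: "n - t = 2 * h" by (simp add: n_h)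
  have abc: "?a = k3 + (s.D + of_nat t + 1) / 2" "?b = - k1 - k3 - (s.D + 1) / 2" "?c = - k1 - (s.D + of_nat t + 1) / 2"
    by (simp_all add: s.D_def n_eq k2_eq field_simps)
  have X: "s.L (s.XX w) = (\<lambda>i. - OX (n - t) ?a (s.L w) i)" for w
    using s.L_XX[OF abc] unfolding d .
  have Y: "s.L (s.YY w) = (\<lambda>i. - OY (n - t) ?a ?b ?c (s.L w) i)" for w
    using s.L_YY[OF abc] unfolding d .
  have neg: "OX (n - t) ?a (\<lambda>i. - w i) = (\<lambda>i. - OX (n - t) ?a w i)"
    "OY (n - t) ?a ?b ?c (\<lambda>i. - w i) = (\<lambda>i. - OY (n - t) ?a ?b ?c w i)" for w
    using OX_lin[of "n - t" ?a "-1" w 0 w] OY_lin[of "n - t" ?a ?b ?c "-1" w 0 w] by simp_all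
  show ?thesis
    unfolding intertwines_def
  proof (intro ballI conjI)
    fix u assume "u \<in> car (Mxmod k n 2)"
    then have ux: "u \<in> Mnx k n 2" by (simp add: Mxmod_def)
    then have u: "u \<in> Mn k n" by (simp add: Mnx_iff)
    let ?w = "\<lambda>i. W \<epsilon> u (t + i)"
    have z: "W \<epsilon> u (t - 1) = 0" using ux t_pos by (auto simp: Mnx_iff W_def lc_def)
    have "sub \<epsilon> (Jop k 1 2 3 u) = s.L (\<lambda>i. XX (W \<epsilon> u) (t + i))"
      using W_X[OF assms] by (intro L_W) blast
    also have "(\<lambda>i. XX (W \<epsilon> u) (t + i)) = s.XX ?w"
      using z by (intro ext shift_XX)
    finally show "sub \<epsilon> (opX (Mxmod k n 2) u) = opX (bimod_twist (Omod (n - t) ?a ?b ?c)) (sub \<epsilon> u)"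
      unfolding X by (simp add: Mxmod_def bimod_twist_def sub_def)
    have "sub \<epsilon> (Jop k 2 3 1 u) = s.L (\<lambda>i. YY (W \<epsilon> u) (t + i))"
      using W_Y[OF u assms] by (intro L_W) blast
    also have "(\<lambda>i. YY (W \<epsilon> u) (t + i)) = s.YY ?w"
      by (intro ext shift_YY)
    finally show "sub \<epsilon> (opY (Mxmod k n 2) u) = opY (bimod_twist (Omod (n - t) ?a ?b ?c)) (sub \<epsilon> u)"
      unfolding Y by (simp add: Mxmod_def bimod_twist_def sub_def)
    let ?\<kappa> = "2 * k1 * k2 - 2 * k3 * (k1 + k2 + k3 + of_nat n + 1)"
    have "sub \<epsilon> (Jop k 3 1 2 u) = s.L (\<lambda>i. XX (YY (W \<epsilon> u)) (t + i) + YY (XX (W \<epsilon> u)) (t + i) - ?\<kappa> * ?w i)"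
      using W_Z[OF u assms] ZZ_eq by (intro L_W) simp
    also have "(\<lambda>i. XX (YY (W \<epsilon> u)) (t + i) + YY (XX (W \<epsilon> u)) (t + i) - ?\<kappa> * ?w i)
        = (\<lambda>i. s.XX (s.YY ?w) i + s.YY (s.XX ?w) i - ?\<kappa> * ?w i)"
      by (simp only: shift_XX[of "YY (W \<epsilon> u)", OF YY_t[of "W \<epsilon> u", OF z]] shift_YY shift_XX[of "W \<epsilon> u", OF z])
    also have "s.L \<dots> = (\<lambda>i. OX (n - t) ?a (OY (n - t) ?a ?b ?c (sub \<epsilon> u)) i
        + OY (n - t) ?a ?b ?c (OX (n - t) ?a (sub \<epsilon> u)) i - ?\<kappa> * sub \<epsilon> u i)"
      by (simp only: s.L_lin3 X Y sub_def neg minus_minus)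
    also have "?\<kappa> = 2 * ?a * ?b - ?c * (of_nat (n - t) + 1)"
      by (simp add: d n_eq k2_eq field_simps)
    finally show "sub \<epsilon> (opZ (Mxmod k n 2) u) = opZ (bimod_twist (Omod (n - t) ?a ?b ?c)) (sub \<epsilon> u)"
      by (simp add: Mxmod_def bimod_twist_def Omod_def)
  qed
qed

lemma sub_iso:
  defines "N \<equiv> bimod_twist (Omod (n - t) (k3 + (of_nat n + 1) / 2)
     (- (k1 + k2 + k3) - (of_nat n + 1) / 2) (- k1 - (of_nat n + 1) / 2))"
  shows "bimod_iso (Mxmod k n 2) (bimod_dsum N N)"
  unfolding bimod_iso_def
proof (intro exI conjI)
  let ?f = "\<lambda>u. case_sum (sub 1 u) (sub (-1) u)"
  have carN: "car N = {u. \<forall>i>2 * h. u i = 0}" by (simp add: N_def n_h bimod_twist_def)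
  have carM: "car (Mxmod k n 2) = Mnx k n 2" by (simp add: Mxmod_def)
  show "clinear_on (car (Mxmod k n 2)) ?f"
    by (intro clinear_on_case_sum clinear_onI sub_lin)
  show "intertwines (Mxmod k n 2) (bimod_dsum N N) ?f"
    unfolding N_def by (intro intertwines_case_sum sub_intertwines) simp_all
  show "bij_betw ?f (car (Mxmod k n 2)) (car (bimod_dsum N N))"
    unfolding bij_betw_def carM
  proof (intro conjI inj_onI)
    fix u v assume uv: "u \<in> Mnx k n 2" "v \<in> Mnx k n 2" "?f u = ?f v"
    have eq: "W \<epsilon> u = W \<epsilon> v" if "sub \<epsilon> u = sub \<epsilon> v" "\<epsilon> = 1 \<or> \<epsilon> = -1" for \<epsilon>
    proof
      fix j
      have "s.L (\<lambda>i. 1 * W \<epsilon> u (t + i) + -1 * W \<epsilon> v (t + i)) = (\<lambda>_. 0)"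
        unfolding s.L_lin using that by (simp add: sub_def fun_eq_iff)
      then have *: "W \<epsilon> u (t + i) = W \<epsilon> v (t + i)" if "i \<le> 2 * h" for i
        using that unfolding s.L_eq_0_iff by simp
      consider "j < t" | "j > n" | i where "j = t + i" "i \<le> 2 * h"
        using n_h by (metis add_le_cancel_left le_Suc_ex linorder_not_less)
      then show "W \<epsilon> u j = W \<epsilon> v j"
      proof cases
        case 1
        then show ?thesis using uv(1,2) that(2) by (auto simp: Mnx_iff_W)
      qed (simp_all add: W_def *[unfolded W_def])
    qed
    have "sub 1 u = sub 1 v" "sub (-1) u = sub (-1) v"
      using fun_cong[OF uv(3), of "Inl _"] fun_cong[OF uv(3), of "Inr _"] by (auto simp: fun_eq_iff)
    then show "u = v" using uv by (intro Mn_eqI eq) (simp_all add: Mnx_iff)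
  next
    show "?f ` Mnx k n 2 = car (bimod_dsum N N)"
    proof (intro equalityI subsetI)
      fix v assume "v \<in> ?f ` Mnx k n 2"
      then show "v \<in> car (bimod_dsum N N)"
        by (auto simp: bimod_dsum_sel carN sub_def s.L_beyond)
    next
      fix v assume "v \<in> car (bimod_dsum N N)"
      then have v: "\<forall>i>2 * h. v (Inl i) = 0" "\<forall>i>2 * h. v (Inr i) = 0"
        by (simp_all add: bimod_dsum_sel carN)
      obtain wp where wp: "\<forall>i>2 * h. wp i = 0" "s.L wp = (\<lambda>i. v (Inl i))"
        using s.L_surj[OF v(1)] by (elim exE conjE)
      obtain wm where wm: "\<forall>i>2 * h. wm i = 0" "s.L wm = (\<lambda>i. v (Inr i))"
        using s.L_surj[OF v(2)] by (elim exE conjE)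
      define up where "up w j = (if j < t then 0 else w (j - t))" for w :: "nat \<Rightarrow> complex" and j
      have "\<forall>i>n. up wp i = 0" "\<forall>i>n. up wm i = 0" using wp(1) wm(1) n_h by (simp_all add: up_def)
      then obtain u where u: "u \<in> Mn k n" "W 1 u = up wp" "W (-1) u = up wm" by (rule W_surj)
      then have "u \<in> Mnx k n 2" by (simp add: Mnx_iff_W up_def)
      moreover have "v = ?f u" using u by (simp add: sub_def up_def wp wm case_sum_expand)
      ultimately show "v \<in> ?f ` Mnx k n 2" by (intro image_eqI[of v ?f u])
    qed
  qed
qed

end

section \<open>Real parameters and assembly\<close>

lemma tval_enat:
  assumes "tval r = enat t"
  shows "odd t" and "r = - real t / 2"
proof -
  have ex: "\<exists>m::nat. odd m \<and> 2 * r = - real m" using assms by (auto simp: tval_def split: if_splits)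
  then obtain m where m: "odd m" "2 * r = - real m" by blast
  have "tval r = enat (nat \<lfloor>- 2 * r\<rfloor>)" using ex unfolding tval_def by (simp only: if_True)
  also have "- 2 * r = real m" using m(2) by simp
  finally have "t = m" using assms by simp
  then show "odd t" "r = - real t / 2" using m by simp_all
qed

text \<open>For odd m the factor is m + 2r; if it vanished, \<open>tval r\<close> would be m, which
  is at most n.\<close>

lemma dk_nz:
  assumes "enat n < tval r" "1 \<le> m" "m \<le> n"
  shows "dk (of_real r) m \<noteq> 0"
proof (cases "even m")
  case True
  then show ?thesis using assms by (simp add: dk_def)
next
  case False
  show ?thesis
  proof
    assume "dk (of_real r) m = 0"
    then have "complex_of_real (real m + 2 * r) = 0" using False by (simp add: dk_def mult.commute)
    then have r: "2 * r = - real m" by (simp only: of_real_eq_0_iff)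
    then have "tval r = enat (nat \<lfloor>- 2 * r\<rfloor>)" using False unfolding tval_def by auto
    also have "- 2 * r = real m" using r by simp
    finally show False using assms by simp
  qed
qed

lemma Oregular_of_real:
  fixes a b c :: real
  assumes even: "\<And>r. 1 \<le> r \<Longrightarrow> r \<le> d \<Longrightarrow> even r \<Longrightarrow>
      real d + 1 - 2 * real r - 2 * a - 2 * b - 2 * c \<noteq> 0 \<and>
      real d + 1 - 2 * real r + 2 * a - 2 * b + 2 * c \<noteq> 0 \<and> real d + 1 - real r - 2 * b \<noteq> 0"
    and odd: "\<And>r. 1 \<le> r \<Longrightarrow> r \<le> d \<Longrightarrow> odd r \<Longrightarrow>
      real d + 1 - 2 * real r - 2 * a - 2 * b + 2 * c \<noteq> 0 \<and>
      real d + 1 - 2 * real r + 2 * a - 2 * b - 2 * c \<noteq> 0 \<and> 2 * b + real r \<noteq> 0"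
  shows "Oregular d (of_real a) (of_real b) (of_real c)"
  unfolding Oregular_def
proof (intro allI impI)
  fix r assume r: "1 \<le> r \<and> r \<le> d"
  let ?a = "complex_of_real a" and ?b = "complex_of_real b" and ?c = "complex_of_real c"
  show "Ophi d ?a ?b ?c r \<noteq> 0 \<and>
     (if even r
      then (of_nat d + 1 - 2 * of_nat r + 2 * ?a - 2 * ?b + 2 * ?c) * (of_nat d + 1 - of_nat r - 2 * ?b)
      else (of_nat d + 1 - 2 * of_nat r + 2 * ?a - 2 * ?b - 2 * ?c) * (2 * ?b + of_nat r)) \<noteq> 0"
  proof (cases "even r")
    case True
    have "Ophi d ?a ?b ?c r = of_real (real r * (real d + 1 - 2 * real r - 2 * a - 2 * b - 2 * c) / 2)"
      using True by (simp add: Ophi_def)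
    moreover have "(of_nat d + 1 - 2 * of_nat r + 2 * ?a - 2 * ?b + 2 * ?c) * (of_nat d + 1 - of_nat r - 2 * ?b)
        = of_real ((real d + 1 - 2 * real r + 2 * a - 2 * b + 2 * c) * (real d + 1 - real r - 2 * b))"
      by simp
    ultimately show ?thesis using True r even[of r]
      by (simp only: of_real_eq_0_iff if_True) simp
  next
    case False
    have "Ophi d ?a ?b ?c r = of_real ((real r - real d - 1) * (real d + 1 - 2 * real r - 2 * a - 2 * b + 2 * c) / 2)"
      using False by (simp add: Ophi_def)
    moreover have "(of_nat d + 1 - 2 * of_nat r + 2 * ?a - 2 * ?b - 2 * ?c) * (2 * ?b + of_nat r)
        = of_real ((real d + 1 - 2 * real r + 2 * a - 2 * b - 2 * c) * (2 * b + real r))"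
      by simp
    moreover have "real r - real d - 1 \<noteq> 0" using r by linarith
    ultimately show ?thesis using False r odd[of r]
      by (simp only: of_real_eq_0_iff if_False) simp
  qed
qed

theorem theorem7p2:
  fixes k :: "nat \<Rightarrow> real" and n t2 :: nat and K :: real
    and W1 W2 :: "nat bimod"
  assumes "odd n"
    and "tval (k 2) = enat t2" and "t2 \<le> n"
    and "enat n < tval (k 1)" and "enat n < tval (k 3)"
  defines "K \<equiv> k 1 + k 2 + k 3"
  defines "W1 \<equiv> bimod_twist (Omod (n - t2)
              (of_real (k 3) + (of_nat n + 1) / 2)
              (- of_real K - (of_nat n + 1) / 2)
              (- of_real (k 1) - (of_nat n + 1) / 2))"
  defines "W2 \<equiv> Omod (t2 - 1) (of_real (k 3)) (- of_real K - of_nat n - 1) (of_real (k 1))"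
  shows "bimod_iso (Mxmod k n 2) (bimod_dsum W1 W1)
       \<and> bimod_quot_iso (Mmod k n) (Mnx k n 2) (bimod_dsum W2 W2)
       \<and> (k 1 \<ge> 0 \<and> k 3 \<ge> 0 \<longrightarrow>
            bimod_irred W1 \<and> bimod_irred W2 \<and>
            bimod_iso W1 (Omod (n - t2)
              (- of_real (k 3) - (of_nat n + 1) / 2)
              (of_real K + (of_nat n + 1) / 2)
              (- of_real (k 1) - (of_nat n + 1) / 2)))"
proof -
  have t: "odd t2" "k 2 = - real t2 / 2" by (rule tval_enat[OF assms(2)])+
  obtain h where h: "t2 = Suc (2 * h)" using t(1) oddE by fastforce
  have "even (n - t2)" using \<open>odd n\<close> t(1) \<open>t2 \<le> n\<close> by simp
  then obtain h' where "n - t2 = 2 * h'" by blast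
  then have h': "n = t2 + 2 * h'" using \<open>t2 \<le> n\<close> by simp
  interpret dunkl_sub_setting k n t2
    by unfold_locales (use assms(1-5) t dk_nz in auto)
  interpret q: dunkl_quotient k n t2 h by unfold_locales (rule h)
  interpret s: dunkl_submodule k n t2 h' by unfold_locales (rule h')
  have K: "complex_of_real K = of_real (k 1) + of_real (k 2) + of_real (k 3)" by (simp add: K_def)
  have K': "2 * K = 2 * k 1 + 2 * k 3 - real t2" by (simp add: K_def t(2))
  have d: "even (n - t2)" "even (t2 - 1)" "real (n - t2) = real n - real t2" "real (t2 - 1) = real t2 - 1"
    using h' h by auto
  have iso: "bimod_iso (Mxmod k n 2) (bimod_dsum W1 W1)"
    using s.sub_iso unfolding W1_def K .
  have quot: "bimod_quot_iso (Mmod k n) (Mnx k n 2) (bimod_dsum W2 W2)"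
    using q.quot_iso unfolding W2_def K .
  have "bimod_irred W1 \<and> bimod_irred W2 \<and> bimod_iso W1 (Omod (n - t2)
              (- of_real (k 3) - (of_nat n + 1) / 2)
              (of_real K + (of_nat n + 1) / 2)
              (- of_real (k 1) - (of_nat n + 1) / 2))"
    if pos: "k 1 \<ge> 0" "k 3 \<ge> 0"
  proof -
    define a where "a = k 3 + (real n + 1) / 2"
    define b where "b = - K - (real n + 1) / 2"
    define c where "c = - k 1 - (real n + 1) / 2"
    have a2: "2 * a = 2 * k 3 + real n + 1" and b2: "2 * b = real t2 - 2 * k 1 - 2 * k 3 - real n - 1"
      and c2: "2 * c = - 2 * k 1 - real n - 1"
      using K' by (simp_all add: a_def b_def c_def field_simps)
    have W1: "W1 = bimod_twist (Omod (n - t2) (of_real a) (of_real b) (of_real c))"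
      by (simp add: W1_def a_def b_def c_def)
    have tn: "real t2 \<le> real n" using \<open>t2 \<le> n\<close> by simp
    \<comment> \<open>For k_1, k_3 nonnegative and r between 1 and d each linear factor keeps a
      fixed sign, so linear arithmetic suffices. The same holds for \<open>reg1'\<close> and
      \<open>reg2\<close>; \<open>reg1'\<close> supplies the second irreducible module for Schur's
      lemma.\<close>
    have reg1: "Oregular (n - t2) (of_real a) (of_real b) (of_real c)"
    proof (rule Oregular_of_real, goal_cases)
      case (1 r)
      then have "real r \<le> real n - real t2" "1 \<le> real r" using d(3) by simp_all
      then show ?case using a2 b2 c2 pos tn unfolding d(3) by linarith
    next
      case (2 r)
      then have "real r \<le> real n - real t2" "1 \<le> real r" using d(3) by simp_all
      then show ?case using a2 b2 c2 pos tn unfolding d(3) by linarith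
    qed
    have reg1': "Oregular (n - t2) (of_real (- a)) (of_real (- b)) (of_real c)"
    proof (rule Oregular_of_real, goal_cases)
      case (1 r)
      then have "real r \<le> real n - real t2" "1 \<le> real r" using d(3) by simp_all
      then show ?case using a2 b2 c2 pos tn unfolding d(3) by linarith
    next
      case (2 r)
      then have "real r \<le> real n - real t2" "1 \<le> real r" using d(3) by simp_all
      then show ?case using a2 b2 c2 pos tn unfolding d(3) by linarith
    qed
    define b' where "b' = - K - real n - 1"
    have b2': "2 * b' = real t2 - 2 * k 1 - 2 * k 3 - 2 * real n - 2"
      using K' by (simp add: b'_def)
    have reg2: "Oregular (t2 - 1) (of_real (k 3)) (of_real b') (of_real (k 1))"
    proof (rule Oregular_of_real, goal_cases)
      case (1 r)
      then have "real r \<le> real t2 - 1" "1 \<le> real r" using d(4) by simp_all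
      then show ?case using b2' pos tn unfolding d(4) by linarith
    next
      case (2 r)
      then have "real r \<le> real t2 - 1" "1 \<le> real r" using d(4) by simp_all
      then show ?case using b2' pos tn unfolding d(4) by linarith
    qed
    \<comment> \<open>2b is at most t2 - n - 1, so 2b + m is negative for m below n - t2.\<close>
    have nz: "2 * complex_of_real b + of_int m \<noteq> 0" if "m < int (n - t2)" for m
    proof -
      have "real_of_int m < real n - real t2" using that \<open>t2 \<le> n\<close> by linarith
      then have "2 * b + real_of_int m \<noteq> 0" using b2 pos by linarith
      moreover have "2 * complex_of_real b + of_int m = of_real (2 * b + real_of_int m)" by simp
      ultimately show ?thesis by (simp only: of_real_eq_0_iff not_False_eq_True)
    qed
    have "bimod_iso W1 (Omod (n - t2) (- of_real a) (- of_real b) (of_real c))"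
      unfolding W1 by (rule Omod_reverse_iso[OF d(1) nz reg1]) (use reg1' in simp_all)
    moreover have "bimod_irred W1"
      unfolding W1 by (intro bimod_irred_twist Omod_irred d(1) reg1)
    moreover have "bimod_irred W2"
      unfolding W2_def using Omod_irred[OF d(2) reg2] by (simp add: b'_def)
    ultimately show ?thesis by (simp add: a_def b_def c_def add.commute)
  qed
  then show ?thesis using iso quot by blast
qed

end
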